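(* Let $G \in \mathcal{G}$. Then $$\varepsilon(G) = \frac{1}{g}\left(\frac{1}{\cos(\frac{\pi}{g})} - 1\right),$$ where $g$ is the length of the smallest induced cycle of $G$ of length at least $4$; if $G$ has no such cycle (i.e. $G$ is chordal), then $g=\infty$ and the right-hand side is read as $0$.
   Context: Graphs are finite, simple, undirected, with at least one vertex. For a graph $G$ with vertex set $[n]$, $\mathrm{Sym}(G)=\mathbb{R}^{V(G)+E(G)}$ is the space of partially specified symmetric $n\times n$ real matrices: $A\in\mathrm{Sym}(G)$ specifies the diagonal entries $A_{ii}$ and the entries $A_{ij}=A_{ji}$ for $\{i,j\}\in E(G)$, the others being unspecified. $\mathrm{tr}(A)=\sum_i A_{ii}$, and $I_n$ also denotes the image of the identity matrix in $\mathrm{Sym}(G)$ (diagonal entries $1$, edge entries $0$). $\Sigma(G)$ is the set of $A\in\mathrm{Sym}(G)$ for which there is a real symmetric positive semidefinite (PSD) $n\times n$ matrix agreeing with $A$ on all specified entries. $\mathcal{P}(G)$ is the set of $A\in \mathrm{Sym}(G)$ such that for every maximal clique $K$ of $G$ the (fully specified) principal submatrix of $A$ indexed by $K$ is PSD. $\bar{\mathcal{P}}(G)=\{A\in\mathcal{P}(G):\mathrm{tr}(A)=1\}$. The conical distance $\varepsilon(G)$ is the smallest real $\varepsilon\ge 0$ such that $M+\varepsilon I_n\in\Sigma(G)$ for all $M\in\bar{\mathcal{P}}(G)$. A graph is series-parallel if it has no $K_4$ minor. A graph is chordal if it has no induced cycle of length at least $4$. A clique sum of graphs $G$ and $H$ is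 a graph obtained as follows: given a complete graph $K$ (possibly empty) and injective graph homomorphisms $\phi:K\to G$, $\psi:K\to H$, take the disjoint union of $G$ and $H$ and identify $\phi(x)$ with $\psi(x)$ for each vertex $x$ of $K$ (no edges are deleted). The cone over $G$ is obtained from $G$ by adding one new vertex adjacent to all vertices of $G$. $\mathcal{G}$ is the smallest collection of graphs such that: (1) series-parallel and chordal graphs are in $\mathcal{G}$; (2) any clique sum of two graphs in $\mathcal{G}$ is in $\mathcal{G}$; (3) the cone over any graph in $\mathcal{G}$ is in $\mathcal{G}$. *)

theory Defs
  imports Complex_Main "HOL-Library.Extended_Nat" "HOL-Library.FuncSet"
begin

section \<open>Graphs\<close>

record 'a sgraph =
  verts :: "'a set"
  edges :: "'a set set"

text \<open>Finite simple undirected graphs; the graph without vertices satisfies \<open>simple_graph\<close>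
  but not \<open>graph\<close>.\<close>

definition simple_graph :: "'a sgraph \<Rightarrow> bool" where
  "simple_graph G \<longleftrightarrow> finite (verts G) \<and> edges G \<subseteq> {e. e \<subseteq> verts G \<and> card e = 2}"

definition graph :: "'a sgraph \<Rightarrow> bool" where
  "graph G \<longleftrightarrow> simple_graph G \<and> verts G \<noteq> {}"

definition graph_hom :: "('a \<Rightarrow> 'b) \<Rightarrow> 'a sgraph \<Rightarrow> 'b sgraph \<Rightarrow> bool" where
  "graph_hom f G H \<longleftrightarrow> f \<in> verts G \<rightarrow> verts H \<and> (\<forall>e\<in>edges G. f ` e \<in> edges H)"

definition graph_iso :: "'a sgraph \<Rightarrow> 'b sgraph \<Rightarrow> bool" where
  "graph_iso G H \<longleftrightarrow> (\<exists>f. bij_betw f (verts G) (verts H) \<and> edges H = (`) f ` edges G)"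

definition complete_graph :: "'a set \<Rightarrow> 'a sgraph" where
  "complete_graph V = \<lparr>verts = V, edges = {e. e \<subseteq> V \<and> card e = 2}\<rparr>"

definition induced_subgraph :: "'a sgraph \<Rightarrow> 'a set \<Rightarrow> 'a sgraph" where
  "induced_subgraph G W = \<lparr>verts = W, edges = {e \<in> edges G. e \<subseteq> W}\<rparr>"

text \<open>Only used for \<open>k \<ge> 3\<close>.\<close>

definition cycle_graph :: "nat \<Rightarrow> nat sgraph" where
  "cycle_graph k = \<lparr>verts = {..<k}, edges = {{i, Suc i mod k} | i. i < k}\<rparr>"

definition has_induced_cycle :: "'a sgraph \<Rightarrow> nat \<Rightarrow> bool" where
  "has_induced_cycle G k \<longleftrightarrow>
     k \<ge> 3 \<and> (\<exists>W \<subseteq> verts G. graph_iso (cycle_graph k) (induced_subgraph G W))"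

definition chordal :: "'a sgraph \<Rightarrow> bool" where
  "chordal G \<longleftrightarrow> \<not> (\<exists>k\<ge>4. has_induced_cycle G k)"

text \<open>Length of the smallest induced cycle of length at least 4; the infimum of the empty set
  is \<open>\<infinity>\<close> in \<open>enat\<close>, so this is \<open>\<infinity>\<close> exactly for chordal graphs.\<close>

definition chordal_girth :: "'a sgraph \<Rightarrow> enat" where
  "chordal_girth G = (INF k \<in> {k. k \<ge> 4 \<and> has_induced_cycle G k}. enat k)"

definition connected_in :: "'a sgraph \<Rightarrow> 'a set \<Rightarrow> bool" where
  "connected_in G W \<longleftrightarrow> W \<noteq> {} \<and>
     (\<forall>u\<in>W. \<forall>v\<in>W. (u, v) \<in> {(x, y). x \<in> W \<and> y \<in> W \<and> {x, y} \<in> edges G}\<^sup>*)"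

text \<open>Minors in terms of branch sets: contracting each \<open>B x\<close> to a vertex, after deletion of
  the remaining vertices and edges, yields \<open>H\<close>.\<close>

definition is_minor :: "'b sgraph \<Rightarrow> 'a sgraph \<Rightarrow> bool" where
  "is_minor H G \<longleftrightarrow> (\<exists>B.
     (\<forall>x\<in>verts H. B x \<subseteq> verts G \<and> connected_in G (B x)) \<and>
     (\<forall>x\<in>verts H. \<forall>y\<in>verts H. x \<noteq> y \<longrightarrow> B x \<inter> B y = {}) \<and>
     (\<forall>x\<in>verts H. \<forall>y\<in>verts H. {x, y} \<in> edges H \<longrightarrow>
        (\<exists>u\<in>B x. \<exists>v\<in>B y. {u, v} \<in> edges G)))"

definition series_parallel :: "'a sgraph \<Rightarrow> bool" where
  "series_parallel G \<longleftrightarrow> \<not> is_minor (complete_graph {..<4::nat}) G"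

definition is_clique :: "'a sgraph \<Rightarrow> 'a set \<Rightarrow> bool" where
  "is_clique G K \<longleftrightarrow> K \<subseteq> verts G \<and> (\<forall>i\<in>K. \<forall>j\<in>K. i \<noteq> j \<longrightarrow> {i, j} \<in> edges G)"

definition is_maximal_clique :: "'a sgraph \<Rightarrow> 'a set \<Rightarrow> bool" where
  "is_maximal_clique G K \<longleftrightarrow> is_clique G K \<and> (\<forall>K'. is_clique G K' \<and> K \<subseteq> K' \<longrightarrow> K' = K)"


section \<open>Clique sums, cones and the class of graphs generated by them\<close>

text \<open>In the disjoint union of \<open>G\<close> and \<open>H\<close>, the vertex \<open>\<psi> x\<close> of \<open>H\<close> is replaced by the vertex
  \<open>\<phi> x\<close> of \<open>G\<close>, for each \<open>x\<close> in the vertex set \<open>K\<close> of the complete graph; \<open>glue K \<phi> \<psi>\<close> is the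
  resulting map from the vertices of \<open>H\<close> to those of the clique sum.\<close>

definition glue :: "'k set \<Rightarrow> ('k \<Rightarrow> 'a) \<Rightarrow> ('k \<Rightarrow> 'b) \<Rightarrow> 'b \<Rightarrow> 'a + 'b" where
  "glue K \<phi> \<psi> y = (if y \<in> \<psi> ` K then Inl (\<phi> (inv_into K \<psi> y)) else Inr y)"

definition clique_sum ::
    "'k set \<Rightarrow> ('k \<Rightarrow> 'a) \<Rightarrow> ('k \<Rightarrow> 'b) \<Rightarrow> 'a sgraph \<Rightarrow> 'b sgraph \<Rightarrow> ('a + 'b) sgraph" where
  "clique_sum K \<phi> \<psi> G H =
     \<lparr>verts = Inl ` verts G \<union> glue K \<phi> \<psi> ` verts H,
      edges = (`) Inl ` edges G \<union> (`) (glue K \<phi> \<psi>) ` edges H\<rparr>"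

definition cone :: "'a sgraph \<Rightarrow> 'a option sgraph" where
  "cone G = \<lparr>verts = insert None (Some ` verts G),
             edges = (`) Some ` edges G \<union> {{None, Some v} | v. v \<in> verts G}\<rparr>"

text \<open>The class is closed under isomorphism, hence it is enough to describe its members with
  vertices in \<open>nat\<close>. The finite set \<open>K\<close> below may be empty.\<close>

inductive_set graph_class :: "nat sgraph set" where
  series_parallel: "graph G \<Longrightarrow> series_parallel G \<Longrightarrow> G \<in> graph_class"
| chordal: "graph G \<Longrightarrow> chordal G \<Longrightarrow> G \<in> graph_class"
| clique_sum: "G \<in> graph_class \<Longrightarrow> H \<in> graph_class \<Longrightarrow> finite (K :: nat set) \<Longrightarrow>
    graph_hom \<phi> (complete_graph K) G \<Longrightarrow> inj_on \<phi> K \<Longrightarrow>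
    graph_hom \<psi> (complete_graph K) H \<Longrightarrow> inj_on \<psi> K \<Longrightarrow>
    graph_iso (clique_sum K \<phi> \<psi> G H) S \<Longrightarrow> S \<in> graph_class"
| cone: "G \<in> graph_class \<Longrightarrow> graph_iso (cone G) S \<Longrightarrow> S \<in> graph_class"


section \<open>Partially specified matrices and the conical distance\<close>

text \<open>Matrices with rows and columns indexed by a finite set \<open>V\<close> are functions
  \<open>'a \<Rightarrow> 'a \<Rightarrow> real\<close>, of which only the entries in \<open>V \<times> V\<close> are relevant.\<close>

definition psd_on :: "'a set \<Rightarrow> ('a \<Rightarrow> 'a \<Rightarrow> real) \<Rightarrow> bool" where
  "psd_on V A \<longleftrightarrow> (\<forall>i\<in>V. \<forall>j\<in>V. A i j = A j i) \<and>
     (\<forall>x :: 'a \<Rightarrow> real. (\<Sum>i\<in>V. \<Sum>j\<in>V. x i * A i j * x j) \<ge> 0)"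

text \<open>A partially specified symmetric matrix has one coordinate for each vertex (the diagonal
  entries) and one for each edge (the specified off-diagonal entries).\<close>

type_synonym 'a partial_matrix = "'a + 'a set \<Rightarrow> real"

definition Sym :: "'a sgraph \<Rightarrow> 'a partial_matrix set" where
  "Sym G = (verts G <+> edges G) \<rightarrow>\<^sub>E UNIV"

text \<open>Only meaningful for specified entries, i.e. for \<open>i = j\<close> a vertex or \<open>{i, j}\<close> an edge.\<close>

definition entry :: "'a partial_matrix \<Rightarrow> 'a \<Rightarrow> 'a \<Rightarrow> real" where
  "entry A i j = (if i = j then A (Inl i) else A (Inr {i, j}))"

definition tr :: "'a sgraph \<Rightarrow> 'a partial_matrix \<Rightarrow> real" where
  "tr G A = (\<Sum>i\<in>verts G. entry A i i)"

definition id_partial :: "'a sgraph \<Rightarrow> 'a partial_matrix" where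
  "id_partial G = (\<lambda>p\<in>verts G <+> edges G. case p of Inl i \<Rightarrow> 1 | Inr e \<Rightarrow> 0)"

definition add_scaled ::
    "'a sgraph \<Rightarrow> 'a partial_matrix \<Rightarrow> real \<Rightarrow> 'a partial_matrix \<Rightarrow> 'a partial_matrix" where
  "add_scaled G A c B = (\<lambda>p\<in>verts G <+> edges G. A p + c * B p)"

definition Sigma_cone :: "'a sgraph \<Rightarrow> 'a partial_matrix set" where
  "Sigma_cone G = {A \<in> Sym G. \<exists>B. psd_on (verts G) B \<and>
     (\<forall>i\<in>verts G. \<forall>j\<in>verts G. i = j \<or> {i, j} \<in> edges G \<longrightarrow> B i j = entry A i j)}"

definition P_cone :: "'a sgraph \<Rightarrow> 'a partial_matrix set" where
  "P_cone G = {A \<in> Sym G. \<forall>K. is_maximal_clique G K \<longrightarrow> psd_on K (entry A)}"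

definition P_bar :: "'a sgraph \<Rightarrow> 'a partial_matrix set" where
  "P_bar G = {A \<in> P_cone G. tr G A = 1}"

definition conical_distance :: "'a sgraph \<Rightarrow> real" where
  "conical_distance G = (LEAST \<epsilon>. \<epsilon> \<ge> 0 \<and>
     (\<forall>M\<in>P_bar G. add_scaled G M \<epsilon> (id_partial G) \<in> Sigma_cone G))"

end

theory Submission imports Defs "HOL-Analysis.Convex" begin

text \<open>Call a matrix completable on a vertex set if the entries specified there extend to a PSD matrix.
  The upper bound rests on a completion theorem for a graph that is chordal or has no \<open>K\<^sub>4\<close> minor:
  a matrix in \<open>P_cone\<close> is completable as soon as it is completable on every induced cycle of length at
  least \<open>4\<close>. Indeed, a vertex set that is neither a clique nor an induced cycle is cut either by a clique,
  along which completions can be glued, or, without \<open>K\<^sub>4\<close> minor, into three parts by two vertices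
  \<open>u\<close>, \<open>w\<close>; in the latter case the values which the three parts allow at the position \<open>(u, w)\<close> form
  intervals that meet pairwise, hence have a common point. On a cycle of length \<open>k\<close>, a matrix with unit diagonal and edge
  entries \<open>c\<^sub>i\<close> is completable if the angles \<open>arccos \<bar>c\<^sub>i\<bar>\<close> add up to at least \<open>\<pi>\<close>, and a
  convexity argument shows that this holds after adding \<open>\<epsilon>\<^sub>k = (1 / cos (\<pi> / k) - 1) / k\<close> times the
  trace to the diagonal. Clique sums preserve such an upper bound by gluing, and cones by Schur complements at the apex.

  For the lower bound take the matrix with entries \<open>1 / g\<close> on a shortest induced cycle, with one edge
  entry negated. In a completion of this matrix plus \<open>\<epsilon>\<close> times the identity, consecutive vectors
  enclose the angle \<open>\<theta> = arccos (1 / (1 + g \<epsilon>))\<close> except for one pair at angle \<open>\<pi> - \<theta>\<close>, so that the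
  triangle inequality on the sphere gives \<open>g \<theta> \<ge> \<pi>\<close>.\<close>

section \<open>Positive semidefinite matrices\<close>

text \<open>Two points \<open>u\<close>, \<open>w\<close> that are not adjacent make a bad
  separator: completions of the two sides may disagree at the unspecified position
  \<open>(u, w)\<close>. Helly's theorem on the line helps only when there are three parts, because
  it asks for common values of two parts at a time, and these come from completing the union of two
  parts, which is smaller than the whole. A cycle falls into only two arcs at such a pair; this is
  why cycles remain as the irreducible case and need angles.

  The constant solves \<open>(1 / k) / (1 / k + \<epsilon>) = cos (\<pi> / k)\<close>. For a cycle
  with constant diagonal \<open>1 / k\<close> and edge entries of the same absolute value, the shift
  by this \<epsilon> makes every angle equal to \<open>\<pi> / k\<close>, so that the angles add up
  to exactly \<pi>. Jensen's inequality shows that this is the worst case for the upper bound, and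
  the extremal matrix of the lower bound has the same diagonal.\<close>

definition quad :: "'a set \<Rightarrow> ('a \<Rightarrow> 'a \<Rightarrow> real) \<Rightarrow> ('a \<Rightarrow> real) \<Rightarrow> real" where
  "quad V A x = (\<Sum>i\<in>V. \<Sum>j\<in>V. x i * A i j * x j)"

lemma psd_onI:
  assumes "\<And>i j. i \<in> V \<Longrightarrow> j \<in> V \<Longrightarrow> A i j = A j i" "\<And>x. quad V A x \<ge> 0"
  shows "psd_on V A"
  using assms unfolding psd_on_def quad_def by blast

lemma psd_on_sym: "psd_on V A \<Longrightarrow> i \<in> V \<Longrightarrow> j \<in> V \<Longrightarrow> A i j = A j i"
  unfolding psd_on_def by blast

lemma psd_on_quad: "psd_on V A \<Longrightarrow> quad V A x \<ge> 0"
  unfolding psd_on_def quad_def by blast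

lemma quad_cong:
  assumes "\<And>i j. i \<in> V \<Longrightarrow> j \<in> V \<Longrightarrow> A i j = B i j"
  shows "quad V A x = quad V B x"
  unfolding quad_def using assms by (intro sum.cong) auto

lemma psd_on_cong:
  assumes "\<And>i j. i \<in> V \<Longrightarrow> j \<in> V \<Longrightarrow> A i j = B i j"
  shows "psd_on V A \<longleftrightarrow> psd_on V B"
proof -
  have "quad V A = quad V B" using quad_cong[of V A B] assms by blast
  thus ?thesis unfolding psd_on_def quad_def[symmetric] using assms by auto
qed

lemma quad_zero_outside:
  assumes "finite V" "W \<subseteq> V" "\<And>i. i \<in> V - W \<Longrightarrow> x i = 0"
  shows "quad V A x = quad W A x"
proof -
  have "quad V A x = (\<Sum>i\<in>W. \<Sum>j\<in>V. x i * A i j * x j)"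
    unfolding quad_def using assms by (intro sum.mono_neutral_right) auto
  also have "\<dots> = quad W A x"
    unfolding quad_def using assms by (intro sum.cong refl sum.mono_neutral_right) auto
  finally show ?thesis .
qed

lemma psd_on_subset:
  assumes "psd_on V A" "finite V" "W \<subseteq> V"
  shows "psd_on W A"
proof (rule psd_onI)
  show "A i j = A j i" if "i \<in> W" "j \<in> W" for i j
    using psd_on_sym[OF assms(1)] that assms(3) by blast
  fix x :: "'a \<Rightarrow> real"
  let ?y = "\<lambda>i. if i \<in> W then x i else 0"
  have "quad W A x = quad W A ?y" unfolding quad_def by (intro sum.cong) auto
  also have "\<dots> = quad V A ?y" using assms by (intro quad_zero_outside[symmetric]) auto
  finally show "quad W A x \<ge> 0" using psd_on_quad[OF assms(1)] by simp
qed

section \<open>Schur complements and small blocks\<close>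

lemma quad_insert:
  assumes "finite V" "s \<notin> V" "\<And>i. i \<in> V \<Longrightarrow> A s i = A i s"
  shows "quad (insert s V) A x = A s s * (x s)\<^sup>2 + 2 * x s * (\<Sum>i\<in>V. A i s * x i) + quad V A x"
proof -
  have *: "(\<Sum>i\<in>V. x s * A s i * x i) = x s * (\<Sum>i\<in>V. A i s * x i)"
    using assms(3) unfolding sum_distrib_left by (intro sum.cong) (auto simp: mult_ac)
  have **: "(\<Sum>i\<in>V. x i * A i s * x s) = x s * (\<Sum>i\<in>V. A i s * x i)"
    unfolding sum_distrib_left by (intro sum.cong) (auto simp: mult_ac)
  have "quad (insert s V) A x = x s * A s s * x s + (\<Sum>i\<in>V. x s * A s i * x i)
    + ((\<Sum>i\<in>V. x i * A i s * x s) + quad V A x)"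
    unfolding quad_def using assms(1,2) by (simp add: sum.distrib)
  thus ?thesis unfolding * ** by (simp add: power2_eq_square)
qed

lemma quad_add_scaled:
  "quad V (\<lambda>i j. a * A i j + b * B i j) x = a * quad V A x + b * quad V B x"
  unfolding quad_def sum_distrib_left sum.distrib[symmetric]
  by (intro sum.cong refl) (simp add: algebra_simps)

lemma quad_rank_one: "quad V (\<lambda>i j. c i * c j) x = (\<Sum>i\<in>V. c i * x i)\<^sup>2"
  unfolding quad_def power2_eq_square sum_product by (intro sum.cong refl) simp

lemma quad_schur:
  "quad V (\<lambda>i j. A i j - A i s * A j s / A s s) x
     = quad V A x - (\<Sum>i\<in>V. A i s * x i)\<^sup>2 / A s s"
proof -
  have "quad V (\<lambda>i j. A i j - A i s * A j s / A s s) x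
    = quad V (\<lambda>i j. 1 * A i j + (- 1 / A s s) * (A i s * A j s)) x"
    by (intro quad_cong) simp
  thus ?thesis unfolding quad_add_scaled quad_rank_one by simp
qed

text \<open>Completing the square in the coordinate \<open>s\<close> writes the form as
  \<open>A s s * (x s + q / A s s)\<^sup>2\<close> plus the form of the complement. The complement
  reads only the column of \<open>s\<close>, so the symmetry with its row is assumed
  separately.\<close>

lemma psd_on_schur:
  assumes "finite V" "s \<notin> V" "A s s > 0" "\<And>i. i \<in> V \<Longrightarrow> A s i = A i s"
  shows "psd_on (insert s V) A \<longleftrightarrow> psd_on V (\<lambda>i j. A i j - A i s * A j s / A s s)"
proof
  assume L: "psd_on (insert s V) A"
  show "psd_on V (\<lambda>i j. A i j - A i s * A j s / A s s)"
  proof (rule psd_onI)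
    show "A i j - A i s * A j s / A s s = A j i - A j s * A i s / A s s" if "i \<in> V" "j \<in> V" for i j
      using psd_on_sym[OF L, of i j] that by simp
    fix x :: "'a \<Rightarrow> real"
    define q where "q = (\<Sum>i\<in>V. A i s * x i)"
    \<comment> \<open>The minimiser in the coordinate \<open>s\<close>, at which the completed
      square vanishes.\<close>
    let ?y = "x(s := - q / A s s)"
    have "(\<Sum>i\<in>V. A i s * ?y i) = q" unfolding q_def using assms(2) by (intro sum.cong) auto
    moreover have "quad V A ?y = quad V A x"
      unfolding quad_def using assms(2) by (intro sum.cong refl) auto
    ultimately have "quad (insert s V) A ?y
      = A s s * (- q / A s s)\<^sup>2 + 2 * (- q / A s s) * q + quad V A x"
      using quad_insert[of V s A ?y] assms by simp
    also have "\<dots> = quad V A x - q\<^sup>2 / A s s"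
      using assms(3) by (simp add: power2_eq_square field_simps)
    finally show "quad V (\<lambda>i j. A i j - A i s * A j s / A s s) x \<ge> 0"
      unfolding quad_schur q_def using psd_on_quad[OF L] by metis
  qed
next
  assume R: "psd_on V (\<lambda>i j. A i j - A i s * A j s / A s s)"
  show "psd_on (insert s V) A"
  proof (rule psd_onI)
    show "A i j = A j i" if "i \<in> insert s V" "j \<in> insert s V" for i j
    proof (cases "i = s \<or> j = s")
      case True thus ?thesis using assms(4) that by auto
    next
      case False thus ?thesis using psd_on_sym[OF R, of i j] that by (simp add: mult.commute)
    qed
    fix x :: "'a \<Rightarrow> real"
    define q where "q = (\<Sum>i\<in>V. A i s * x i)"
    have "quad V A x - q\<^sup>2 / A s s \<ge> 0" using psd_on_quad[OF R, of x] unfolding quad_schur q_def .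
    moreover have "quad (insert s V) A x = A s s * (x s + q / A s s)\<^sup>2 + (quad V A x - q\<^sup>2 / A s s)"
      using quad_insert[of V s A x] assms unfolding q_def[symmetric]
      by (simp add: power2_eq_square field_simps)
    ultimately show "quad (insert s V) A x \<ge> 0" using assms(3) by (simp add: add_nonneg_nonneg)
  qed
qed

lemma psd_on_diag: "psd_on V A \<Longrightarrow> finite V \<Longrightarrow> i \<in> V \<Longrightarrow> A i i \<ge> 0"
  using psd_on_quad[OF psd_on_subset[of V A "{i}"], of "\<lambda>_. 1"] by (simp add: quad_def)

lemma psd_on_pair:
  assumes "psd_on V A" "finite V" "i \<in> V" "j \<in> V" "i \<noteq> j"
  shows "(A i j)\<^sup>2 \<le> A i i * A j j"
proof -
  have P: "psd_on {i, j} A" using assms by (intro psd_on_subset[OF assms(1)]) auto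
  have s: "A j i = A i j" using psd_on_sym[OF assms(1,4,3)] .
  have q: "0 \<le> A i i * a\<^sup>2 + 2 * a * A i j * b + A j j * b\<^sup>2" for a b
    using psd_on_quad[OF P, of "\<lambda>l. if l = i then a else b"] assms(5) s
    unfolding quad_def by (simp add: power2_eq_square algebra_simps)
  have d: "A i i \<ge> 0" "A j j \<ge> 0" using psd_on_diag[OF assms(1,2)] assms(3,4) by auto
  show ?thesis
  proof (cases "A j j = 0")
    case True
    have "A i j = 0"
    proof (rule ccontr)
      assume n: "A i j \<noteq> 0"
      \<comment> \<open>With \<open>A j j = 0\<close> the form is affine in the coordinate of
        \<open>j\<close>; this argument makes it equal to \<open>- 1\<close>.\<close>
      have "0 \<le> A i i + 2 * A i j * (- (A i i + 1) / (2 * A i j))" using q[of 1 "- (A i i + 1) / (2 * A i j)"] True by simp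
      also have "\<dots> = - 1" using n by (simp add: field_simps)
      finally show False by simp
    qed
    thus ?thesis using d by simp
  next
    case False
    hence p: "A j j > 0" using d by simp
    \<comment> \<open>The vector \<open>(A j j, - A i j)\<close> turns the form into
      \<open>A j j\<close> times the determinant.\<close>
    have "0 \<le> A j j * (A i i * A j j - (A i j)\<^sup>2)" using q[of "A j j" "- A i j"]
      by (simp add: power2_eq_square algebra_simps)
    thus ?thesis using p by (simp add: zero_le_mult_iff)
  qed
qed

lemma psd_on_pairI:
  assumes "i \<noteq> j" "A i i \<ge> 0" "A j j \<ge> 0" "A i j = A j i" "(A i j)\<^sup>2 \<le> A i i * A j j"
  shows "psd_on {i, j} A"
proof (rule psd_onI)
  show "A p q = A q p" if "p \<in> {i, j}" "q \<in> {i, j}" for p q using that assms by auto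
  fix x :: "'a \<Rightarrow> real"
  have e: "quad {i, j} A x = A i i * (x i)\<^sup>2 + 2 * x i * A i j * x j + A j j * (x j)\<^sup>2"
    using assms unfolding quad_def by (simp add: power2_eq_square algebra_simps)
  have "\<bar>A i j\<bar> \<le> sqrt (A i i) * sqrt (A j j)"
    using assms by (metis real_sqrt_abs real_sqrt_le_mono real_sqrt_mult)
  hence "\<bar>x i * A i j * x j\<bar> \<le> (sqrt (A i i) * \<bar>x i\<bar>) * (sqrt (A j j) * \<bar>x j\<bar>)"
    using mult_right_mono[of "\<bar>A i j\<bar>" "sqrt (A i i) * sqrt (A j j)" "\<bar>x i\<bar> * \<bar>x j\<bar>"]
    by (simp add: abs_mult mult_ac)
  moreover have "0 \<le> (sqrt (A i i) * \<bar>x i\<bar> - sqrt (A j j) * \<bar>x j\<bar>)\<^sup>2" by simp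
  ultimately show "quad {i, j} A x \<ge> 0" unfolding e using assms(2,3)
    by (simp add: power2_diff power_mult_distrib)
qed

lemma psd_on_zero_row:
  assumes "psd_on V A" "finite V" "i \<in> V" "j \<in> V" "A j j = 0"
  shows "A i j = 0"
  using psd_on_pair[OF assms(1-4)] assms(5) by (cases "i = j") auto

lemma psd_on_insert_zero:
  assumes "finite V" "s \<notin> V" "A s s = 0" "\<And>i. i \<in> V \<Longrightarrow> A s i = 0" "\<And>i. i \<in> V \<Longrightarrow> A i s = 0" "psd_on V A"
  shows "psd_on (insert s V) A"
proof (rule psd_onI)
  show "A i j = A j i" if "i \<in> insert s V" "j \<in> insert s V" for i j
    using that assms psd_on_sym[OF assms(6)] by auto
  show "quad (insert s V) A x \<ge> 0" for x
    using quad_insert[of V s A x] assms psd_on_quad[OF assms(6)] by simp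
qed

lemma psd_on_extend_zero:
  assumes "finite V" "W \<subseteq> V" "psd_on W A"
    and "\<And>i j. i \<in> V \<Longrightarrow> j \<in> V \<Longrightarrow> i \<notin> W \<or> j \<notin> W \<Longrightarrow> A i j = 0"
  shows "psd_on V A"
proof (rule psd_onI)
  show "A i j = A j i" if "i \<in> V" "j \<in> V" for i j
    using assms(4)[OF that] assms(4)[OF that(2,1)] psd_on_sym[OF assms(3), of i j] by (cases "i \<in> W \<and> j \<in> W") auto
  fix x :: "'a \<Rightarrow> real"
  have "quad V A x = (\<Sum>i\<in>W. \<Sum>j\<in>V. x i * A i j * x j)"
    unfolding quad_def using assms(1,2,4) by (intro sum.mono_neutral_right) auto
  also have "\<dots> = quad W A x"
    unfolding quad_def using assms(1,2,4) by (intro sum.cong refl sum.mono_neutral_right) auto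
  finally show "quad V A x \<ge> 0" using psd_on_quad[OF assms(3)] by simp
qed

lemma psd_on_empty: "psd_on {} A"
  by (simp add: psd_on_def)

lemma psd_on_single: "0 \<le> A i i \<Longrightarrow> psd_on {i} A"
proof (rule psd_onI)
  assume "0 \<le> A i i"
  moreover have "quad {i} A x = A i i * (x i)\<^sup>2" for x unfolding quad_def by (simp add: power2_eq_square)
  ultimately show "0 \<le> quad {i} A x" for x by simp
qed auto

lemma quad_Un_disjoint:
  assumes "finite V" "finite W" "V \<inter> W = {}"
    and "\<And>i j. i \<in> V \<Longrightarrow> j \<in> W \<Longrightarrow> C i j = 0 \<and> C j i = 0"
  shows "quad (V \<union> W) C x = quad V C x + quad W C x"
proof -
  have "(\<Sum>j\<in>V \<union> W. x i * C i j * x j) = (\<Sum>j\<in>V. x i * C i j * x j)" if "i \<in> V" for i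
    using assms that by (intro sum.mono_neutral_right) auto
  moreover have "(\<Sum>j\<in>V \<union> W. x i * C i j * x j) = (\<Sum>j\<in>W. x i * C i j * x j)" if "i \<in> W" for i
    using assms that by (intro sum.mono_neutral_right) auto
  ultimately show ?thesis unfolding quad_def sum.union_disjoint[OF assms(1-3)] by simp
qed

text \<open>The overlap is removed one index at a time: the Schur complements of \<open>A\<close>
  and \<open>B\<close> at a common index \<open>s\<close> agree on what remains of the overlap,
  because \<open>A\<close> and \<open>B\<close> do. With empty overlap the block sum with zero cross
  entries works.\<close>

lemma psd_amalgamation:
  assumes "finite V" "finite W" "psd_on V A" "psd_on W B"
    and "\<And>i j. i \<in> V \<inter> W \<Longrightarrow> j \<in> V \<inter> W \<Longrightarrow> A i j = B i j"
  shows "\<exists>C. psd_on (V \<union> W) C \<and> (\<forall>i\<in>V. \<forall>j\<in>V. C i j = A i j) \<and> (\<forall>i\<in>W. \<forall>j\<in>W. C i j = B i j)"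
  using assms
proof (induction "card (V \<inter> W)" arbitrary: V W A B)
  case 0
  hence dj: "V \<inter> W = {}" by simp
  define C where "C i j = (if i \<in> V \<and> j \<in> V then A i j else if i \<in> W \<and> j \<in> W then B i j else 0)" for i j
  have V: "C i j = A i j" if "i \<in> V" "j \<in> V" for i j using that by (simp add: C_def)
  have W: "C i j = B i j" if "i \<in> W" "j \<in> W" for i j using that dj by (auto simp: C_def)
  have pV: "psd_on V C" using psd_on_cong[of V C A] V 0 by blast
  have pW: "psd_on W C" using psd_on_cong[of W C B] W 0 by blast
  have Z: "C i j = 0 \<and> C j i = 0" if "i \<in> V" "j \<in> W" for i j using that dj by (auto simp: C_def)
  have "psd_on (V \<union> W) C"
  proof (rule psd_onI)
    show "C i j = C j i" if "i \<in> V \<union> W" "j \<in> V \<union> W" for i j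
      using that Z psd_on_sym[OF pV, of i j] psd_on_sym[OF pW, of i j] by (metis UnE)
    show "quad (V \<union> W) C x \<ge> 0" for x
      using quad_Un_disjoint[of V W C x] 0 dj Z psd_on_quad[OF pV, of x] psd_on_quad[OF pW, of x] by simp
  qed
  thus ?case using V W by blast
next
  case (Suc n)
  from Suc(2) obtain s where s: "s \<in> V \<inter> W" by (metis card.empty ex_in_conv nat.distinct(1))
  define V' W' where "V' = V - {s}" and "W' = W - {s}"
  have V: "V = insert s V'" "s \<notin> V'" "finite V'" and W: "W = insert s W'" "s \<notin> W'" "finite W'"
    using s Suc(3,4) unfolding V'_def W'_def by auto
  have "V' \<inter> W' = V \<inter> W - {s}" unfolding V'_def W'_def by blast
  hence n: "n = card (V' \<inter> W')" using Suc(2,3) s by simp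
  have ss: "B s s = A s s" using Suc(7) s by simp
  have sA: "A s i = A i s" if "i \<in> V'" for i using psd_on_sym[OF Suc(5)] that V by blast
  have sB: "B s i = B i s" if "i \<in> W'" for i using psd_on_sym[OF Suc(6)] that W by blast
  have AB: "A i s = B i s" if "i \<in> V' \<inter> W'" for i using Suc(7) s that V W by blast
  \<comment> \<open>The column of \<open>s\<close> on both sides at once; on the overlap the two
    prescriptions coincide by \<open>AB\<close>.\<close>
  define c where "c i = (if i \<in> V' then A i s else B i s)" for i
  have cV: "c i = A i s" if "i \<in> V'" for i using that by (simp add: c_def)
  have cW: "c i = B i s" if "i \<in> W'" for i using that AB by (auto simp: c_def)
  show ?case
  proof (cases "A s s = 0")
    case True
    \<comment> \<open>A vanishing diagonal entry kills its row and column, so \<open>s\<close> is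
      put back as a zero row.\<close>
    have c0: "c i = 0" if "i \<in> V' \<union> W'" for i
      using that True ss psd_on_zero_row[OF Suc(5,3), of i s] psd_on_zero_row[OF Suc(6,4), of i s] V W
      unfolding c_def by auto
    have "psd_on V' A" "psd_on W' B" using psd_on_subset Suc(3-6) V W by blast+
    then obtain C' where C': "psd_on (V' \<union> W') C'" "\<forall>i\<in>V'. \<forall>j\<in>V'. C' i j = A i j"
        "\<forall>i\<in>W'. \<forall>j\<in>W'. C' i j = B i j"
      using Suc(1)[OF n V(3) W(3), of A B] Suc(7) V W by auto
    define C where "C i j = (if i = s \<or> j = s then 0 else C' i j)" for i j
    have "C i j = C' i j" if "i \<in> V' \<union> W'" "j \<in> V' \<union> W'" for i j
      using that V(2) W(2) unfolding C_def by auto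
    hence "psd_on (V' \<union> W') C" using C'(1) psd_on_cong by blast
    hence "psd_on (insert s (V' \<union> W')) C" using V W by (intro psd_on_insert_zero) (auto simp: C_def)
    moreover have "insert s (V' \<union> W') = V \<union> W" using V W by auto
    moreover have "C i j = A i j" if "i \<in> V" "j \<in> V" for i j
      using that C'(2) c0 cV sA True V unfolding C_def by auto
    moreover have "C i j = B i j" if "i \<in> W" "j \<in> W" for i j
      using that C'(3) c0 cW sB True ss W unfolding C_def by auto
    ultimately show ?thesis by auto
  next
    case False
    hence p: "A s s > 0" using psd_on_diag[OF Suc(5,3), of s] s by simp
    let ?A = "\<lambda>i j. A i j - A i s * A j s / A s s" and ?B = "\<lambda>i j. B i j - B i s * B j s / B s s"
    have "psd_on V' ?A" using psd_on_schur[of V' s A] V Suc(5) p sA by auto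
    moreover have "psd_on W' ?B" using psd_on_schur[of W' s B] W Suc(6) p ss sB by auto
    moreover have "?A i j = ?B i j" if "i \<in> V' \<inter> W'" "j \<in> V' \<inter> W'" for i j
      using Suc(7)[of i j] that AB ss V W by auto
    ultimately obtain C' where C': "psd_on (V' \<union> W') C'" "\<forall>i\<in>V'. \<forall>j\<in>V'. C' i j = ?A i j"
        "\<forall>i\<in>W'. \<forall>j\<in>W'. C' i j = ?B i j"
      using Suc(1)[OF n V(3) W(3), of ?A ?B] by auto
    \<comment> \<open>Adding \<open>c i * c j / A s s\<close> inverts the Schur complement: the
      complement of \<open>C\<close> at \<open>s\<close> is \<open>C'\<close>.\<close>
    define C where "C i j = (if i = s then if j = s then A s s else c j
       else if j = s then c i else C' i j + c i * c j / A s s)" for i j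
    have "C i j - C i s * C j s / C s s = C' i j" if "i \<in> V' \<union> W'" "j \<in> V' \<union> W'" for i j
      using that V(2) W(2) unfolding C_def by auto
    hence "psd_on (V' \<union> W') (\<lambda>i j. C i j - C i s * C j s / C s s)"
      using C'(1) psd_on_cong[of "V' \<union> W'" "\<lambda>i j. C i j - C i s * C j s / C s s" C'] by blast
    moreover have "finite (V' \<union> W')" "s \<notin> V' \<union> W'" using V W by auto
    moreover have "C s s > 0" using p by (simp add: C_def)
    moreover have "C s i = C i s" for i by (simp add: C_def)
    ultimately have "psd_on (insert s (V' \<union> W')) C" by (intro psd_on_schur[THEN iffD2])
    moreover have "insert s (V' \<union> W') = V \<union> W" using V W by auto
    moreover have "C i j = A i j" if "i \<in> V" "j \<in> V" for i j
      using that C'(2) cV sA V unfolding C_def by auto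
    moreover have "C i j = B i j" if "i \<in> W" "j \<in> W" for i j
      using that C'(3) cW sB ss W unfolding C_def by auto
    ultimately show ?thesis by auto
  qed
qed

lemma psd_on_convex:
  assumes "psd_on V A" "psd_on V B" "0 \<le> a" "0 \<le> b"
  shows "psd_on V (\<lambda>i j. a * A i j + b * B i j)"
proof (rule psd_onI)
  show "a * A i j + b * B i j = a * A j i + b * B j i" if "i \<in> V" "j \<in> V" for i j
    using psd_on_sym[OF assms(1) that] psd_on_sym[OF assms(2) that] by simp
  show "quad V (\<lambda>i j. a * A i j + b * B i j) x \<ge> 0" for x
    unfolding quad_add_scaled using assms psd_on_quad by (metis add_nonneg_nonneg mult_nonneg_nonneg)
qed

lemma psd_on_diagonal:
  assumes "finite V" "\<And>i. i \<in> V \<Longrightarrow> d i \<ge> 0"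
  shows "psd_on V (\<lambda>i j. if i = j then d i else 0)"
proof (rule psd_onI)
  fix x :: "'a \<Rightarrow> real"
  have "quad V (\<lambda>i j. if i = j then d i else 0) x = (\<Sum>i\<in>V. \<Sum>j\<in>V. if i = j then d i * (x i)\<^sup>2 else 0)"
    unfolding quad_def by (intro sum.cong refl) (simp add: power2_eq_square)
  also have "\<dots> = (\<Sum>i\<in>V. d i * (x i)\<^sup>2)" using assms(1) by simp
  finally show "quad V (\<lambda>i j. if i = j then d i else 0) x \<ge> 0" using assms by (simp add: sum_nonneg)
qed auto

lemma psd_on_add_diagonal:
  assumes "psd_on V A" "finite V" "0 \<le> c"
  shows "psd_on V (\<lambda>i j. A i j + (if i = j then c else 0))"
  using psd_on_convex[OF assms(1) psd_on_diagonal[of V "\<lambda>_. c"], of 1 1] assms by simp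

text \<open>Congruence by a diagonal matrix combined with a change of index set. It serves to flip
  signs, to normalise or restore a diagonal, and to move between positions on a cycle and
  vertices.\<close>

lemma psd_on_reindex_scale:
  assumes "psd_on V A" "inj_on f W" "f ` W = V"
  shows "psd_on W (\<lambda>i j. s i * s j * A (f i) (f j))"
proof (rule psd_onI)
  show "s i * s j * A (f i) (f j) = s j * s i * A (f j) (f i)" if "i \<in> W" "j \<in> W" for i j
    using psd_on_sym[OF assms(1), of "f i" "f j"] that assms(3) by auto
  fix x :: "'b \<Rightarrow> real"
  define y where "y v = s (inv_into W f v) * x (inv_into W f v)" for v
  have "quad V A y = quad W (\<lambda>i j. s i * s j * A (f i) (f j)) x"
    unfolding quad_def assms(3)[symmetric] sum.reindex[OF assms(2)] o_def
    by (intro sum.cong refl) (simp add: y_def inv_into_f_f[OF assms(2)])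
  thus "quad W (\<lambda>i j. s i * s j * A (f i) (f j)) x \<ge> 0" using psd_on_quad[OF assms(1), of y] by simp
qed

lemma psd_on_reindex:
  assumes "psd_on V A" "inj_on f W" "f ` W = V"
  shows "psd_on W (\<lambda>i j. A (f i) (f j))"
  using psd_on_reindex_scale[OF assms, of "\<lambda>_. 1"] by simp

text \<open>The Schur complement at \<open>i\<close> has size two, and the last inequality is its
  determinant condition. With \<open>A i j = cos a\<close> and \<open>A i l = cos b\<close> for
  angles in \<open>[0, \<pi>]\<close> it places \<open>A j l\<close> between
  \<open>cos (a + b)\<close> and \<open>cos (a - b)\<close>.\<close>

lemma psd_on_triple:
  assumes "i \<noteq> j" "j \<noteq> l" "i \<noteq> l" "A i i = 1" "A j j = 1" "A l l = 1"
    and "A j i = A i j" "A l i = A i l" "A l j = A j l"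
  shows "psd_on {i, j, l} A \<longleftrightarrow> \<bar>A i j\<bar> \<le> 1 \<and> \<bar>A i l\<bar> \<le> 1 \<and>
    (A j l - A i j * A i l)\<^sup>2 \<le> (1 - (A i j)\<^sup>2) * (1 - (A i l)\<^sup>2)" (is "?L \<longleftrightarrow> ?R")
proof -
  let ?B = "\<lambda>p q. A p q - A p i * A q i / A i i"
  have sch: "?L \<longleftrightarrow> psd_on {j, l} ?B" using assms by (intro psd_on_schur) auto
  have sq: "\<bar>a\<bar> \<le> 1 \<longleftrightarrow> 0 \<le> 1 - a\<^sup>2" for a :: real by (simp add: abs_square_le_1)
  show ?thesis
  proof
    assume ?L
    hence P: "psd_on {j, l} ?B" using sch by simp
    show ?R using psd_on_pair[OF P, of j l] psd_on_diag[OF P, of j] psd_on_diag[OF P, of l] assms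
      unfolding sq by (simp add: power2_eq_square)
  next
    assume ?R
    thus ?L unfolding sch sq using assms by (intro psd_on_pairI) (auto simp: power2_eq_square)
  qed
qed

section \<open>Induced cycles, paths and separators\<close>

text \<open>Numbering the vertices of an induced cycle turns its arcs into index intervals; the
  equivalence is what excludes chords.\<close>

definition cycle_map :: "'a sgraph \<Rightarrow> nat \<Rightarrow> (nat \<Rightarrow> 'a) \<Rightarrow> bool" where
  "cycle_map G k f \<longleftrightarrow> inj_on f {..<k} \<and> f ` {..<k} \<subseteq> verts G \<and>
     (\<forall>i<k. \<forall>j<k. {f i, f j} \<in> edges G \<longleftrightarrow> j = Suc i mod k \<or> i = Suc j mod k)"

definition adj_rel :: "'a sgraph \<Rightarrow> 'a set \<Rightarrow> ('a \<times> 'a) set" where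
  "adj_rel G W = {(x, y). x \<in> W \<and> y \<in> W \<and> {x, y} \<in> edges G}"

text \<open>For \<open>b\<close> in \<open>U\<close> this is the component of \<open>b\<close> in
  the subgraph induced on \<open>U\<close>.\<close>

definition reach :: "'a sgraph \<Rightarrow> 'a set \<Rightarrow> 'a \<Rightarrow> 'a set" where
  "reach G U b = {x. (b, x) \<in> (adj_rel G U)\<^sup>*}"

text \<open>In graph terms, \<open>(X, Y)\<close> is a separation of the subgraph induced on
  \<open>X \<union> Y\<close>, with separator \<open>X \<inter> Y\<close>.\<close>

definition no_cross_edges :: "'a sgraph \<Rightarrow> 'a set \<Rightarrow> 'a set \<Rightarrow> bool" where
  "no_cross_edges G X Y \<longleftrightarrow> (\<forall>u\<in>X - Y. \<forall>v\<in>Y - X. {u, v} \<notin> edges G)"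

lemma simple_graph_edgeD:
  assumes "simple_graph G" "{u, v} \<in> edges G"
  shows "u \<noteq> v" "u \<in> verts G" "v \<in> verts G"
proof -
  have "card {u, v} = 2" "{u, v} \<subseteq> verts G" using assms unfolding simple_graph_def by blast+
  thus "u \<noteq> v" "u \<in> verts G" "v \<in> verts G" by (auto simp: card_2_iff)
qed

lemma simple_graph_edgeE:
  assumes "simple_graph G" "e \<in> edges G"
  obtains u v where "e = {u, v}" "u \<noteq> v"
  using assms unfolding simple_graph_def by (auto simp: card_2_iff dest!: subsetD)

lemma has_induced_cycle_iff:
  assumes "simple_graph G" "3 \<le> k"
  shows "has_induced_cycle G k \<longleftrightarrow> (\<exists>f. cycle_map G k f)"
proof
  assume "has_induced_cycle G k"
  then obtain W f where W: "W \<subseteq> verts G" and b: "bij_betw f {..<k} W"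
    and e: "{e \<in> edges G. e \<subseteq> W} = (`) f ` {{i, Suc i mod k} | i. i < k}"
    unfolding has_induced_cycle_def graph_iso_def induced_subgraph_def cycle_graph_def by auto
  have inj: "inj_on f {..<k}" and im: "f ` {..<k} = W" using b by (auto simp: bij_betw_def)
  have "{f i, f j} \<in> edges G \<longleftrightarrow> j = Suc i mod k \<or> i = Suc j mod k" if ij: "i < k" "j < k" for i j
  proof -
    have "{f i, f j} \<in> edges G \<longleftrightarrow> {f i, f j} \<in> {e \<in> edges G. e \<subseteq> W}" using ij im by auto
    also have "\<dots> \<longleftrightarrow> (\<exists>m<k. f ` {i, j} = f ` {m, Suc m mod k})"
    proof -
      have "(`) f ` {{i, Suc i mod k} | i. i < k} = {f ` {i, Suc i mod k} | i. i < k}" by blast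
      thus ?thesis unfolding e by simp blast
    qed
    also have "\<dots> \<longleftrightarrow> (\<exists>m<k. {i, j} = {m, Suc m mod k})"
    proof -
      have "f ` {i, j} = f ` {m, Suc m mod k} \<longleftrightarrow> {i, j} = {m, Suc m mod k}" if "m < k" for m
        using ij that by (intro inj_on_image_eq_iff[OF inj]) auto
      thus ?thesis by blast
    qed
    also have "\<dots> \<longleftrightarrow> j = Suc i mod k \<or> i = Suc j mod k"
      using ij by (auto simp: doubleton_eq_iff)
    finally show ?thesis .
  qed
  thus "\<exists>f. cycle_map G k f" using inj im W unfolding cycle_map_def by auto
next
  assume "\<exists>f. cycle_map G k f"
  then obtain f where f: "inj_on f {..<k}" "f ` {..<k} \<subseteq> verts G"
    "\<And>i j. i < k \<Longrightarrow> j < k \<Longrightarrow> {f i, f j} \<in> edges G \<longleftrightarrow> j = Suc i mod k \<or> i = Suc j mod k"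
    unfolding cycle_map_def by blast
  let ?W = "f ` {..<k}"
  have "{e \<in> edges G. e \<subseteq> ?W} = (`) f ` {{i, Suc i mod k} | i. i < k}"
  proof (intro equalityI subsetI)
    fix e assume e: "e \<in> {e \<in> edges G. e \<subseteq> ?W}"
    hence "e \<in> edges G" by simp
    then obtain u v where uv: "e = {u, v}" by (rule simple_graph_edgeE[OF assms(1)])
    then obtain i j where ij: "i < k" "j < k" "u = f i" "v = f j" using e by auto
    hence "j = Suc i mod k \<or> i = Suc j mod k" using f(3) e uv by blast
    hence "{i, j} \<in> {{i, Suc i mod k} | i. i < k}" using ij by (auto simp: insert_commute)
    moreover have "e = f ` {i, j}" using uv ij by simp
    ultimately show "e \<in> (`) f ` {{i, Suc i mod k} | i. i < k}" by (rule rev_image_eqI)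
  next
    fix e assume "e \<in> (`) f ` {{i, Suc i mod k} | i. i < k}"
    then obtain i where i: "i < k" "e = {f i, f (Suc i mod k)}" by auto
    moreover have "Suc i mod k < k" using i by auto
    ultimately show "e \<in> {e \<in> edges G. e \<subseteq> ?W}" using f(3)[of i "Suc i mod k"] by auto
  qed
  thus "has_induced_cycle G k"
    unfolding has_induced_cycle_def graph_iso_def induced_subgraph_def cycle_graph_def
    using assms(2) f(1,2) by (intro conjI exI[of _ ?W] exI[of _ f]) (auto simp: bij_betw_def)
qed

lemma cycle_map_edge_iff:
  assumes "cycle_map G k f" "i < j" "j < k"
  shows "{f i, f j} \<in> edges G \<longleftrightarrow> j = Suc i \<or> i = 0 \<and> Suc j = k"
proof -
  have "{f i, f j} \<in> edges G \<longleftrightarrow> j = Suc i mod k \<or> i = Suc j mod k"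
    using assms unfolding cycle_map_def by auto
  also have "\<dots> \<longleftrightarrow> j = Suc i \<or> i = 0 \<and> Suc j = k"
    using assms(2,3) by (cases "Suc j = k") auto
  finally show ?thesis .
qed

lemma cycle_map_Suc: "cycle_map G k f \<Longrightarrow> Suc i < k \<Longrightarrow> {f i, f (Suc i)} \<in> edges G"
  using cycle_map_edge_iff[of G k f i "Suc i"] by simp

lemma cycle_map_last: "cycle_map G k f \<Longrightarrow> 2 \<le> k \<Longrightarrow> {f 0, f (k - 1)} \<in> edges G"
  using cycle_map_edge_iff[of G k f 0 "k - 1"] by simp

section \<open>Connected sets, components and walks\<close>

lemma connected_in_adj_rel:
  "connected_in G W \<longleftrightarrow> W \<noteq> {} \<and> (\<forall>u\<in>W. \<forall>v\<in>W. (u, v) \<in> (adj_rel G W)\<^sup>*)"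
  unfolding connected_in_def adj_rel_def ..

lemma adj_rel_mono: "V \<subseteq> W \<Longrightarrow> adj_rel G V \<subseteq> adj_rel G W"
  unfolding adj_rel_def by blast

lemma sym_adj_rel_rtrancl: "sym ((adj_rel G W)\<^sup>*)"
  by (intro sym_rtrancl symI) (auto simp: adj_rel_def insert_commute)

lemma connected_in_rootI:
  assumes "b \<in> W" "\<And>x. x \<in> W \<Longrightarrow> (b, x) \<in> (adj_rel G W)\<^sup>*"
  shows "connected_in G W"
  unfolding connected_in_adj_rel
proof (intro conjI ballI)
  show "W \<noteq> {}" using assms(1) by blast
  fix u v assume "u \<in> W" "v \<in> W"
  thus "(u, v) \<in> (adj_rel G W)\<^sup>*"
    using symD[OF sym_adj_rel_rtrancl assms(2)] assms(2) by (blast intro: rtrancl_trans)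
qed

lemma connected_in_singleton: "connected_in G {u}"
  by (rule connected_in_rootI[of u]) auto

lemma connected_in_Un:
  assumes "connected_in G A" "connected_in G B" "a \<in> A" "b \<in> B" "{a, b} \<in> edges G"
  shows "connected_in G (A \<union> B)"
proof (rule connected_in_rootI[of a])
  show "a \<in> A \<union> B" using assms by blast
  have A: "(a, x) \<in> (adj_rel G (A \<union> B))\<^sup>*" if "x \<in> A" for x
    using assms(1,3) that rtrancl_mono[OF adj_rel_mono[of A "A \<union> B" G]] unfolding connected_in_adj_rel by blast
  have B: "(b, x) \<in> (adj_rel G (A \<union> B))\<^sup>*" if "x \<in> B" for x
    using assms(2,4) that rtrancl_mono[OF adj_rel_mono[of B "A \<union> B" G]] unfolding connected_in_adj_rel by blast
  have "(a, b) \<in> adj_rel G (A \<union> B)" using assms unfolding adj_rel_def by blast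
  thus "(a, x) \<in> (adj_rel G (A \<union> B))\<^sup>*" if "x \<in> A \<union> B" for x
    using A B that by (metis UnE converse_rtrancl_into_rtrancl)
qed

lemma connected_in_segment:
  assumes "\<And>i. a \<le> i \<Longrightarrow> Suc i < b \<Longrightarrow> {f i, f (Suc i)} \<in> edges G" "a < b"
  shows "connected_in G (f ` {a..<b})"
  using assms(2,1)
proof (induction b)
  case (Suc b)
  show ?case
  proof (cases "a = b")
    case True thus ?thesis by (simp add: connected_in_singleton)
  next
    case False
    hence ab: "a < b" using Suc by simp
    then obtain c where c: "b = Suc c" using less_imp_Suc_add by blast
    have "connected_in G (f ` {a..<b} \<union> {f b})"
      using Suc ab c connected_in_singleton[of G "f b"] by (intro connected_in_Un[of _ _ _ "f c"]) auto
    moreover have "f ` {a..<b} \<union> {f b} = f ` {a..<Suc b}" using ab by (auto simp: less_Suc_eq)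
    ultimately show ?thesis by simp
  qed
qed simp

lemma reach_subset: "b \<in> U \<Longrightarrow> reach G U b \<subseteq> U"
proof
  fix x assume "b \<in> U" "x \<in> reach G U b"
  hence "(b, x) \<in> (adj_rel G U)\<^sup>*" by (simp add: reach_def)
  thus "x \<in> U" using \<open>b \<in> U\<close> by (induction) (auto simp: adj_rel_def)
qed

lemma reach_self: "b \<in> reach G U b"
  by (simp add: reach_def)

lemma reach_closed:
  assumes "b \<in> U" "x \<in> reach G U b" "y \<in> U" "{x, y} \<in> edges G"
  shows "y \<in> reach G U b"
proof -
  have "x \<in> U" using reach_subset[OF assms(1)] assms(2) by blast
  hence "(x, y) \<in> adj_rel G U" using assms(3,4) unfolding adj_rel_def by blast
  thus ?thesis using assms(2) unfolding reach_def by (simp add: rtrancl_into_rtrancl)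
qed

lemma connected_in_reach: "connected_in G (reach G U b)"
proof (rule connected_in_rootI[of b])
  show "b \<in> reach G U b" by (rule reach_self)
  fix x assume "x \<in> reach G U b"
  hence "(b, x) \<in> (adj_rel G U)\<^sup>*" by (simp add: reach_def)
  thus "(b, x) \<in> (adj_rel G (reach G U b))\<^sup>*"
  proof (induction)
    case (step y z)
    have "y \<in> reach G U b" "z \<in> reach G U b" unfolding reach_def using step by auto
    hence "(y, z) \<in> adj_rel G (reach G U b)" using step unfolding adj_rel_def by blast
    thus ?case using step.IH by (rule rtrancl_into_rtrancl[rotated])
  qed simp
qed

lemma connected_in_subset_reach:
  assumes "connected_in G A" "A \<subseteq> U" "b \<in> A"
  shows "A \<subseteq> reach G U b"
  using assms rtrancl_mono[OF adj_rel_mono[OF assms(2), of G]]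
  unfolding connected_in_adj_rel reach_def by blast

lemma connected_in_walk:
  assumes "connected_in G D" "d \<in> D" "e \<in> D"
  obtains n q where "q 0 = d" "q n = e" "\<And>i. i \<le> n \<Longrightarrow> q i \<in> D"
    "\<And>i. i < n \<Longrightarrow> {q i, q (Suc i)} \<in> edges G"
proof -
  have "(d, e) \<in> (adj_rel G D)\<^sup>*" using assms unfolding connected_in_adj_rel by blast
  then obtain n where "(d, e) \<in> adj_rel G D ^^ n" using rtrancl_imp_relpow by blast
  then obtain q where q: "q 0 = d" "q n = e" "\<And>i. i < n \<Longrightarrow> (q i, q (Suc i)) \<in> adj_rel G D"
    unfolding relpow_fun_conv by blast
  have "q i \<in> D" if "i \<le> n" for i
    using q(3)[of i] q(2) that assms(3) by (cases "i = n") (auto simp: adj_rel_def)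
  thus ?thesis using q that unfolding adj_rel_def by blast
qed

text \<open>A shortest walk from \<open>x\<close> to \<open>y\<close> through \<open>D\<close> is an
  induced path, since a chord or a repeated vertex would shorten it.\<close>

lemma induced_path:
  assumes "simple_graph G" "connected_in G D" "x \<notin> D" "y \<notin> D" "x \<noteq> y" "{x, y} \<notin> edges G"
    and "d \<in> D" "{x, d} \<in> edges G" "e \<in> D" "{y, e} \<in> edges G"
  obtains m p where "2 \<le> m" "p 0 = x" "p m = y" "\<And>i. 0 < i \<Longrightarrow> i < m \<Longrightarrow> p i \<in> D"
    "\<And>i j. i < j \<Longrightarrow> j \<le> m \<Longrightarrow> p i \<noteq> p j"
    "\<And>i j. i < j \<Longrightarrow> j \<le> m \<Longrightarrow> {p i, p j} \<in> edges G \<longleftrightarrow> j = Suc i"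
proof -
  define Q where "Q m p \<longleftrightarrow> p 0 = x \<and> p m = y \<and> (\<forall>i. 0 < i \<and> i < m \<longrightarrow> p i \<in> D) \<and>
    (\<forall>i<m. {p i, p (Suc i)} \<in> edges G)" for m p
  obtain n q where q: "q 0 = d" "q n = e" "\<And>i. i \<le> n \<Longrightarrow> q i \<in> D"
    "\<And>i. i < n \<Longrightarrow> {q i, q (Suc i)} \<in> edges G"
    using connected_in_walk[OF assms(2,7,9)] by metis
  let ?p = "\<lambda>i. if i = 0 then x else if i = n + 2 then y else q (i - 1)"
  have "{?p i, ?p (Suc i)} \<in> edges G" if "i < n + 2" for i
  proof -
    consider "i = 0" | "i = Suc n" | j where "i = Suc j" "j < n" using \<open>i < n + 2\<close> by (cases i) force+
    thus ?thesis using q assms by cases (auto simp: insert_commute)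
  qed
  hence "Q (n + 2) ?p" unfolding Q_def using q(3) by auto
  hence ex: "\<exists>m. \<exists>p. Q m p" by blast
  define m where "m = (LEAST m. \<exists>p. Q m p)"
  obtain p where p: "Q m p" using LeastI_ex[OF ex] unfolding m_def by blast
  have least: "m \<le> l" if "Q l r" for l r using that unfolding m_def by (intro Least_le) blast
  have p0: "p 0 = x" and pm: "p m = y" and pD: "\<And>i. 0 < i \<Longrightarrow> i < m \<Longrightarrow> p i \<in> D"
    and pe: "\<And>i. i < m \<Longrightarrow> {p i, p (Suc i)} \<in> edges G" using p unfolding Q_def by auto
  \<comment> \<open>The edge skips \<open>s\<close> vertices of the walk. A repetition
    \<open>p i = p j\<close> with \<open>j < m\<close> is covered as well, through the edge from
    \<open>p j\<close> to \<open>p (Suc j)\<close>.\<close>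
  have no_shortcut: False if s: "0 < s" "i + s < m" "{p i, p (Suc (i + s))} \<in> edges G" for i s
  proof -
    let ?r = "\<lambda>t. if t \<le> i then p t else p (t + s)"
    have "{?r t, ?r (Suc t)} \<in> edges G" if "t < m - s" for t
      using pe[of t] pe[of "t + s"] s that by (cases "t < i"; cases "t = i") auto
    hence "Q (m - s) ?r" unfolding Q_def using p0 pm pD s by auto
    thus False using least[of "m - s" ?r] s by simp
  qed
  have ne: "p i \<noteq> p j" if ij: "i < j" "j \<le> m" for i j
  proof
    assume eq: "p i = p j"
    show False
    proof (cases "j = m")
      case True
      thus False using eq pm p0 pD[of i] ij assms(4,5) by (cases "i = 0") auto
    next
      case False
      hence "{p i, p (Suc (i + (j - i)))} \<in> edges G" using pe[of j] eq ij by simp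
      thus False using no_shortcut[of "j - i" i] ij False by simp
    qed
  qed
  have "{p i, p j} \<in> edges G \<longleftrightarrow> j = Suc i" if ij: "i < j" "j \<le> m" for i j
  proof
    assume e: "{p i, p j} \<in> edges G"
    show "j = Suc i"
    proof (rule ccontr)
      assume "j \<noteq> Suc i"
      hence "Suc (i + (j - Suc i)) = j" "0 < j - Suc i" "i + (j - Suc i) < m" using ij by auto
      thus False using no_shortcut[of "j - Suc i" i] e by simp
    qed
  next
    assume "j = Suc i"
    thus "{p i, p j} \<in> edges G" using pe[of i] ij by simp
  qed
  moreover have "2 \<le> m"
  proof (rule ccontr)
    assume "\<not> 2 \<le> m"
    hence "m = 0 \<or> m = 1" by auto
    thus False using p0 pm pe[of 0] assms(5,6) by auto
  qed
  ultimately show ?thesis using that p0 pm pD ne by blast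
qed

text \<open>Dirac's argument: for a vertex \<open>a\<close> and a component \<open>D\<close> of the non-neighbours of \<open>a\<close>, the set of
  neighbours of \<open>D\<close> lies in the neighbourhood of \<open>a\<close>. Two non-adjacent members of it are joined by
  an induced path through \<open>D\<close>, which \<open>a\<close> closes to an induced cycle.\<close>

lemma clique_separator_or_induced_cycle:
  assumes "simple_graph G" "W \<subseteq> verts G" "\<not> is_clique G W"
  obtains (separator) X Y where "X \<subset> W" "Y \<subset> W" "X \<union> Y = W" "is_clique G (X \<inter> Y)" "no_cross_edges G X Y"
  | (cycle) k f where "4 \<le> k" "cycle_map G k f" "f ` {..<k} \<subseteq> W"
proof -
  obtain a b where ab: "a \<in> W" "b \<in> W" "a \<noteq> b" "{a, b} \<notin> edges G"
    using assms(2,3) unfolding is_clique_def by blast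
  define U where "U = {x \<in> W. x \<noteq> a \<and> {a, x} \<notin> edges G}"
  define D where "D = reach G U b"
  define S where "S = {x \<in> W. {a, x} \<in> edges G \<and> (\<exists>d\<in>D. {x, d} \<in> edges G)}"
  have bU: "b \<in> U" using ab unfolding U_def by blast
  have DU: "D \<subseteq> U" using reach_subset[OF bU] unfolding D_def .
  have bD: "b \<in> D" unfolding D_def by (rule reach_self)
  have SD: "S \<inter> D = {}" using DU unfolding S_def U_def by blast
  have aD: "a \<notin> D" using DU unfolding U_def by blast
  have aS: "a \<notin> S" using simple_graph_edgeD[OF assms(1)] unfolding S_def by blast
  have conD: "connected_in G D" unfolding D_def by (rule connected_in_reach)
  \<comment> \<open>A vertex of \<open>W\<close> outside \<open>D\<close> but adjacent to
    \<open>D\<close> differs from \<open>a\<close> and cannot lie in \<open>U\<close>, since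
    \<open>D\<close> is a component of \<open>U\<close>; so it is a neighbour of \<open>a\<close>
    and belongs to \<open>S\<close>.\<close>
  have nc: "no_cross_edges G (D \<union> S) (W - D)"
    unfolding no_cross_edges_def
  proof (intro ballI notI)
    fix u v assume u: "u \<in> D \<union> S - (W - D)" and v: "v \<in> W - D - (D \<union> S)" and e: "{u, v} \<in> edges G"
    have uD: "u \<in> D" using u S_def by blast
    have "v \<noteq> a" using uD e DU unfolding U_def by (auto simp: insert_commute)
    moreover have "v \<notin> U" using reach_closed[OF bU _ _ e] uD v unfolding D_def by blast
    ultimately have "{a, v} \<in> edges G" using v unfolding U_def by blast
    hence "v \<in> S" using v uD e unfolding S_def by (auto simp: insert_commute)
    thus False using v by blast
  qed
  show ?thesis
  proof (cases "is_clique G S")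
    case True
    have "(D \<union> S) \<inter> (W - D) = S" using SD S_def by blast
    moreover have "D \<union> S \<subset> W" using DU aD aS ab(1) unfolding U_def S_def by blast
    moreover have "W - D \<subset> W" using bD ab by blast
    moreover have "D \<union> S \<union> (W - D) = W" using DU unfolding U_def S_def by blast
    ultimately show ?thesis using separator[of "D \<union> S" "W - D"] True nc by simp
  next
    case False
    then obtain x y where xy: "x \<in> S" "y \<in> S" "x \<noteq> y" "{x, y} \<notin> edges G"
      using assms(2) unfolding is_clique_def S_def by blast
    then obtain d e where de: "d \<in> D" "{x, d} \<in> edges G" "e \<in> D" "{y, e} \<in> edges G"
      and a: "{a, x} \<in> edges G" "{a, y} \<in> edges G" unfolding S_def by blast
    have xyD: "x \<notin> D" "y \<notin> D" using xy SD by blast+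
    obtain m p where m: "2 \<le> m" and p0: "p 0 = x" and pm: "p m = y"
      and pD: "\<And>i. 0 < i \<Longrightarrow> i < m \<Longrightarrow> p i \<in> D"
      and ne: "\<And>i j. i < j \<Longrightarrow> j \<le> m \<Longrightarrow> p i \<noteq> p j"
      and pe: "\<And>i j. i < j \<Longrightarrow> j \<le> m \<Longrightarrow> {p i, p j} \<in> edges G \<longleftrightarrow> j = Suc i"
      using induced_path[OF assms(1) conD xyD xy(3,4) de] by metis
    \<comment> \<open>The path occupies the positions \<open>0\<close> to \<open>m\<close> and
      \<open>a\<close> the position \<open>m + 1\<close>, hence the length
      \<open>m + 2\<close>.\<close>
    define f where "f i = (if i \<le> m then p i else a)" for i
    define k where "k = m + 2"
    have pDS: "p i \<in> D \<union> S" if "i \<le> m" for i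
      using that p0 pm pD[of i] xy by (cases "i = 0"; cases "i = m") auto
    have pa: "{a, p i} \<in> edges G \<longleftrightarrow> i = 0 \<or> i = m" if "i \<le> m" for i
    proof (cases "i = 0 \<or> i = m")
      case False
      hence "p i \<in> U" using pD[of i] that DU by auto
      thus ?thesis using False unfolding U_def by blast
    qed (use a p0 pm in auto)
    have fne: "f i \<noteq> f j" if "i < j" "j < k" for i j
      using that ne[of i j] pDS[of i] aD aS unfolding f_def k_def by auto
    have "inj_on f {..<k}"
      by (rule linorder_inj_onI) (use fne in auto)
    have fW: "f ` {..<k} \<subseteq> W"
      using pDS DU ab(1) unfolding f_def S_def U_def by auto
    have fe: "{f i, f j} \<in> edges G \<longleftrightarrow> j = Suc i mod k \<or> i = Suc j mod k" if ij: "i < j" "j < k" for i j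
    proof (cases "j = m + 1")
      case True
      hence "{f i, f j} \<in> edges G \<longleftrightarrow> i = 0 \<or> i = m"
        using pa[of i] ij unfolding f_def k_def by (simp add: insert_commute)
      thus ?thesis using ij True unfolding k_def by auto
    next
      case False
      thus ?thesis using pe[of i j] ij unfolding f_def k_def by auto
    qed
    moreover have "{f i, f i} \<notin> edges G" for i using simple_graph_edgeD[OF assms(1)] by blast
    moreover have "i \<noteq> Suc i mod k" if "i < k" for i using that m unfolding k_def by (cases "Suc i = m + 2") auto
    ultimately have "{f i, f j} \<in> edges G \<longleftrightarrow> j = Suc i mod k \<or> i = Suc j mod k" if "i < k" "j < k" for i j
    proof (cases i j rule: linorder_cases)
      case greater
      thus ?thesis using fe[of j i] that by (simp add: insert_commute disj_commute)
    qed (use fe that \<open>\<And>i. {f i, f i} \<notin> edges G\<close> \<open>\<And>i. i < k \<Longrightarrow> i \<noteq> Suc i mod k\<close> in auto)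
    hence "cycle_map G k f"
      unfolding cycle_map_def using assms(2) fW \<open>inj_on f {..<k}\<close> by auto
    thus ?thesis using cycle[of k f] fW m unfolding k_def by simp
  qed
qed

section \<open>Decomposition without \<open>K\<^sub>4\<close> minors\<close>

lemma K4_minorI:
  assumes "connected_in G P" "connected_in G Q" "connected_in G R" "connected_in G S"
    and "P \<union> Q \<union> R \<union> S \<subseteq> verts G"
    and "P \<inter> Q = {}" "P \<inter> R = {}" "P \<inter> S = {}" "Q \<inter> R = {}" "Q \<inter> S = {}" "R \<inter> S = {}"
    and "\<exists>u\<in>P. \<exists>v\<in>Q. {u, v} \<in> edges G" "\<exists>u\<in>P. \<exists>v\<in>R. {u, v} \<in> edges G"
    and "\<exists>u\<in>P. \<exists>v\<in>S. {u, v} \<in> edges G" "\<exists>u\<in>Q. \<exists>v\<in>R. {u, v} \<in> edges G"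
    and "\<exists>u\<in>Q. \<exists>v\<in>S. {u, v} \<in> edges G" "\<exists>u\<in>R. \<exists>v\<in>S. {u, v} \<in> edges G"
  shows "is_minor (complete_graph {..<4::nat}) G"
proof -
  define B where "B n = (if n = 0 then P else if n = 1 then Q else if n = 2 then R else S)" for n :: nat
  have B: "B 0 = P" "B 1 = Q" "B 2 = R" "B 3 = S" by (simp_all add: B_def)
  have four: "{..<4::nat} = {0, 1, 2, 3}" by auto
  have ord: "B x \<inter> B y = {} \<and> (\<exists>u\<in>B x. \<exists>v\<in>B y. {u, v} \<in> edges G)" if "x < y" "y < 4" for x y
  proof -
    have "(x, y) \<in> {(0, 1), (0, 2), (0, 3), (1, 2), (1, 3), (2, 3)}" using that by auto
    thus ?thesis using assms(6-17) B by auto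
  qed
  have all: "B x \<inter> B y = {} \<and> (\<exists>u\<in>B x. \<exists>v\<in>B y. {u, v} \<in> edges G)" if "x \<noteq> y" "x < 4" "y < 4" for x y
    using ord[of x y] ord[of y x] that by (metis inf_commute insert_commute linorder_neqE_nat)
  have con: "B x \<subseteq> verts G \<and> connected_in G (B x)" if "x < 4" for x
    using assms(1-5) unfolding B_def by auto
  have V: "verts (complete_graph {..<4::nat}) = {..<4}" by (simp add: complete_graph_def)
  have ne: "x \<noteq> y" if "{x, y} \<in> edges (complete_graph {..<4::nat})" for x y
    using that unfolding complete_graph_def by auto
  show ?thesis unfolding is_minor_def V
  proof (intro exI[of _ B] conjI ballI impI)
    show "B x \<subseteq> verts G" "connected_in G (B x)" if "x \<in> {..<4}" for x using con[of x] that by simp_all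
    show "B x \<inter> B y = {}" if "x \<in> {..<4}" "y \<in> {..<4}" "x \<noteq> y" for x y using all[of x y] that by simp
    show "\<exists>u\<in>B x. \<exists>v\<in>B y. {u, v} \<in> edges G"
      if "x \<in> {..<4}" "y \<in> {..<4}" "{x, y} \<in> edges (complete_graph {..<4})" for x y
      using all[of x y] ne[of x y] that by simp
  qed
qed

text \<open>Case distinction for sets of cycle positions: those to which a component off the cycle
  attaches, and those that lie in a given clique. The ordered pair in the last case fits
  \<open>cycle_map_edge_iff\<close>.\<close>

lemma three_indices:
  assumes "\<not> (\<exists>i j l. i < j \<and> j < l \<and> i \<in> I \<and> j \<in> I \<and> l \<in> (I :: nat set))"
  obtains "I = {}" | i where "I = {i}" | i j where "i < j" "I = {i, j}"
proof (cases "I = {}")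
  case False
  define i where "i = (LEAST i. i \<in> I)"
  have i: "i \<in> I" unfolding i_def using False by (meson LeastI ex_in_conv)
  have le: "i \<le> j" if "j \<in> I" for j unfolding i_def using that by (rule Least_le)
  show ?thesis
  proof (cases "I = {i}")
    case False
    then obtain j where j: "j \<in> I" "j \<noteq> i" using i by blast
    hence ij: "i < j" using le[of j] by simp
    have "l = i \<or> l = j" if l: "l \<in> I" for l
    proof (rule ccontr)
      assume "\<not> (l = i \<or> l = j)"
      hence "i < l" "l < j \<or> j < l" using le[OF l] by auto
      thus False using assms i j(1) ij l by blast
    qed
    hence "I = {i, j}" using i j by blast
    thus ?thesis using that(3) ij by blast
  qed (use that in blast)
qed (use that in blast)

text \<open>A component \<open>D\<close> off the cycle attaches to at most two cycle vertices, for otherwise \<open>D\<close> and three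
  arcs of the cycle form a \<open>K\<^sub>4\<close> minor. If it attaches to two non-adjacent vertices, these separate
  the two arcs between them from each other as well, again for want of a \<open>K\<^sub>4\<close> minor.\<close>

lemma K4_minor_free_decomposition:
  assumes G: "simple_graph G" "W \<subseteq> verts G" "\<not> is_minor (complete_graph {..<4::nat}) G"
    and f: "4 \<le> k" "cycle_map G k f" "f ` {..<k} \<subset> W"
  obtains (separator) X Y where "X \<subset> W" "Y \<subset> W" "X \<union> Y = W" "is_clique G (X \<inter> Y)" "no_cross_edges G X Y"
  | (triple) u w X Y Z where "X \<union> Y \<union> Z = W" "X \<inter> Y = {u, w}" "X \<inter> Z = {u, w}" "Y \<inter> Z = {u, w}"
      "X \<union> Y \<subset> W" "X \<union> Z \<subset> W" "Y \<union> Z \<subset> W"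
      "no_cross_edges G X Y" "no_cross_edges G X Z" "no_cross_edges G Y Z"
proof -
  have inj: "inj_on f {..<k}" using f(2) unfolding cycle_map_def by blast
  have fD: "f i \<noteq> f j" if "i \<noteq> j" "i < k" "j < k" for i j using inj that by (auto dest: inj_onD)
  define C where "C = f ` {..<k}"
  obtain z where z: "z \<in> W - C" using f(3) unfolding C_def by blast
  define D where "D = reach G (W - C) z"
  have DW: "D \<subseteq> W - C" using reach_subset[OF z] unfolding D_def .
  have zD: "z \<in> D" unfolding D_def by (rule reach_self)
  have conD: "connected_in G D" unfolding D_def by (rule connected_in_reach)
  define I where "I = {i. i < k \<and> (\<exists>d\<in>D. {f i, d} \<in> edges G)}"
  define N where "N = f ` I"
  have NC: "N \<subseteq> C" unfolding N_def I_def C_def by blast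
  have CW: "C \<subseteq> W" using f(3) unfolding C_def by blast
  have nbr: "v \<in> D \<union> N" if "d \<in> D" "v \<in> W" "{d, v} \<in> edges G" for d v
  proof (cases "v \<in> C")
    case True
    then obtain i where i: "i < k" "v = f i" unfolding C_def by blast
    hence "{f i, d} \<in> edges G" using that(3) by (simp add: insert_commute)
    thus ?thesis using i that(1) unfolding N_def I_def by blast
  next
    case False
    thus ?thesis using reach_closed[OF z _ _ that(3)] that(1,2) unfolding D_def by blast
  qed
  have seg: "connected_in G (f ` {a..<b})" if "a < b" "b \<le> k" for a b
    using that by (intro connected_in_segment cycle_map_Suc[OF f(2)]) auto
  have disj: "f ` S \<inter> f ` T = {}" if "S \<inter> T = {}" "S \<subseteq> {..<k}" "T \<subseteq> {..<k}" for S T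
    using inj_on_image_Int[OF inj that(2,3)] that(1) by simp
  have fDd: "f ` S \<inter> D = {}" if "S \<subseteq> {..<k}" for S using that DW unfolding C_def by blast
  \<comment> \<open>Cutting the cycle before \<open>j\<close> and before \<open>l\<close> gives
    three arcs that contain \<open>i\<close>, \<open>j\<close> and \<open>l\<close> respectively;
    the last one meets the first through the closing edge \<open>{f 0, f (k - 1)}\<close>.\<close>
  have no3: "\<not> (\<exists>i j l. i < j \<and> j < l \<and> i \<in> I \<and> j \<in> I \<and> l \<in> I)"
  proof
    assume "\<exists>i j l. i < j \<and> j < l \<and> i \<in> I \<and> j \<in> I \<and> l \<in> I"
    then obtain i j l where ijl: "i < j" "j < l" "i \<in> I" "j \<in> I" "l \<in> I" by blast
    have lk: "l < k" using ijl I_def by blast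
    have "{f (j - 1), f j} \<in> edges G" using cycle_map_Suc[OF f(2), of "j - 1"] ijl lk by simp
    hence e1: "\<exists>u\<in>f ` {0..<j}. \<exists>v\<in>f ` {j..<l}. {u, v} \<in> edges G"
      using ijl by (intro bexI[of _ "f (j - 1)"] bexI[of _ "f j"]) auto
    have "{f (l - 1), f l} \<in> edges G" using cycle_map_Suc[OF f(2), of "l - 1"] ijl lk by simp
    hence e2: "\<exists>u\<in>f ` {j..<l}. \<exists>v\<in>f ` {l..<k}. {u, v} \<in> edges G"
      using ijl lk by (intro bexI[of _ "f (l - 1)"] bexI[of _ "f l"]) auto
    have "{f 0, f (k - 1)} \<in> edges G" using cycle_map_last[OF f(2)] f(1) by simp
    hence e3: "\<exists>u\<in>f ` {0..<j}. \<exists>v\<in>f ` {l..<k}. {u, v} \<in> edges G"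
      using ijl lk by (intro bexI[of _ "f 0"] bexI[of _ "f (k - 1)"]) auto
    have toD: "\<exists>u\<in>f ` S. \<exists>v\<in>D. {u, v} \<in> edges G" if "t \<in> I" "t \<in> S" for t S
      using that unfolding I_def by blast
    have "is_minor (complete_graph {..<4::nat}) G"
    proof (rule K4_minorI[of G "f ` {0..<j}" "f ` {j..<l}" "f ` {l..<k}" D])
      show "connected_in G (f ` {0..<j})" "connected_in G (f ` {j..<l})" "connected_in G (f ` {l..<k})"
        using seg[of 0 j] seg[of j l] seg[of l k] ijl lk by auto
      show "connected_in G D" by (rule conD)
      show "f ` {0..<j} \<union> f ` {j..<l} \<union> f ` {l..<k} \<union> D \<subseteq> verts G"
      proof -
        have "f ` {0..<j} \<union> f ` {j..<l} \<union> f ` {l..<k} \<subseteq> C" using lk ijl unfolding C_def by auto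
        thus ?thesis using DW CW G(2) by blast
      qed
      show "f ` {0..<j} \<inter> f ` {j..<l} = {}" "f ` {0..<j} \<inter> f ` {l..<k} = {}" "f ` {j..<l} \<inter> f ` {l..<k} = {}"
        by (rule disj; use ijl lk in auto)+
      show "f ` {0..<j} \<inter> D = {}" "f ` {j..<l} \<inter> D = {}" "f ` {l..<k} \<inter> D = {}"
        by (rule fDd; use ijl lk in auto)+
      show "\<exists>u\<in>f ` {0..<j}. \<exists>v\<in>D. {u, v} \<in> edges G" using toD[of i] ijl by simp
      show "\<exists>u\<in>f ` {j..<l}. \<exists>v\<in>D. {u, v} \<in> edges G" using toD[of j] ijl by simp
      show "\<exists>u\<in>f ` {l..<k}. \<exists>v\<in>D. {u, v} \<in> edges G" using toD[of l] ijl lk by simp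
    qed (use e1 e2 e3 in simp_all)
    thus False using G(3) by simp
  qed
  have sep: ?thesis if cl: "is_clique G N" and ni: "N \<noteq> C"
  proof (rule separator[of "D \<union> N" "W - D"])
    show "D \<union> N \<subset> W" using DW NC CW ni by blast
    show "W - D \<subset> W" using zD DW by blast
    show "D \<union> N \<union> (W - D) = W" using DW NC CW by blast
    have "(D \<union> N) \<inter> (W - D) = N" using DW NC CW by blast
    thus "is_clique G ((D \<union> N) \<inter> (W - D))" using cl by simp
    show "no_cross_edges G (D \<union> N) (W - D)"
      unfolding no_cross_edges_def
    proof (intro ballI notI)
      fix x v assume "x \<in> D \<union> N - (W - D)" "v \<in> W - D - (D \<union> N)" "{x, v} \<in> edges G"
      thus False using nbr[of x v] NC CW DW by blast
    qed
  qed
  have cardC: "card C = k" unfolding C_def using card_image[OF inj] by simp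
  have small: "N \<noteq> C" if "N \<subseteq> {u, w}" for u w
  proof
    assume "N = C"
    hence "card C \<le> card {u, w}" using that by (intro card_mono) auto
    also have "\<dots> \<le> 2" by (simp add: card_insert_if)
    finally show False using cardC f(1) by simp
  qed
  show ?thesis
  proof (cases "is_clique G N")
    case True
    have "\<exists>u w. N \<subseteq> {u, w}" unfolding N_def by (rule three_indices[OF no3]) auto
    thus ?thesis using sep[OF True] small by blast
  next
    case ncl: False
    have "N \<subseteq> verts G" using NC CW G(2) by blast
    hence cl: "is_clique G N" if "\<And>x y. x \<in> N \<Longrightarrow> y \<in> N \<Longrightarrow> x \<noteq> y \<Longrightarrow> {x, y} \<in> edges G"
      using that unfolding is_clique_def by blast
    have "\<exists>i j. i < j \<and> I = {i, j}"
    proof (rule three_indices[OF no3])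
      show "\<exists>i j. i < j \<and> I = {i, j}" if "I = {}" using cl ncl that unfolding N_def by simp
      show "\<exists>i j. i < j \<and> I = {i, j}" if "I = {i}" for i using cl ncl that unfolding N_def by simp
    qed blast
    then obtain i j where ij: "i < j" "I = {i, j}" by blast
    have nadj: "{f i, f j} \<notin> edges G"
    proof
      assume e: "{f i, f j} \<in> edges G"
      hence e': "{f j, f i} \<in> edges G" by (simp add: insert_commute)
      have "is_clique G N" by (rule cl) (use e e' in \<open>auto simp: N_def ij\<close>)
      thus False using ncl by simp
    qed
    have jk: "j < k" and ik: "i < k" using ij I_def by blast+
    have ne1: "j \<noteq> Suc i" and ne2: "\<not> (i = 0 \<and> Suc j = k)"
      using cycle_map_edge_iff[OF f(2) ij(1) jk] nadj by auto
    define u w where "u = f i" and "w = f j"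
    have Nuw: "N = {u, w}" unfolding N_def u_def w_def ij by simp
    have uw: "u \<in> C" "w \<in> C" "u \<noteq> w" using NC Nuw fD[of i j] ij jk ik unfolding u_def w_def by auto
    \<comment> \<open>The two open arcs between \<open>u\<close> and \<open>w\<close>, of which
      \<open>Q\<close> wraps around the end of the numbering. Both are nonempty because
      \<open>u\<close> and \<open>w\<close> are not adjacent.\<close>
    define P where "P = f ` {Suc i..<j}"
    define Q where "Q = f ` ({Suc j..<k} \<union> {0..<i})"
    have conP: "connected_in G P" unfolding P_def using seg ij jk ne1 by auto
    have conQ: "connected_in G Q"
    proof (cases "i = 0")
      case True
      thus ?thesis unfolding Q_def using seg[of "Suc j" k] jk ne2 by auto
    next
      case i: False
      show ?thesis
      proof (cases "Suc j = k")
        case True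
        thus ?thesis unfolding Q_def using seg[of 0 i] ik i by auto
      next
        case False
        have "{f (k - 1), f 0} \<in> edges G" using cycle_map_last[OF f(2)] f(1) by (simp add: insert_commute)
        hence "connected_in G (f ` {Suc j..<k} \<union> f ` {0..<i})"
          using seg[of 0 i] seg[of "Suc j" k] jk ik i False
          by (intro connected_in_Un[of _ _ _ "f (k - 1)" "f 0"]) auto
        thus ?thesis unfolding Q_def image_Un .
      qed
    qed
    have PQ: "P \<inter> Q = {}" unfolding P_def Q_def using ij jk ik by (intro disj) auto
    have uP: "u \<notin> P" "w \<notin> P" "u \<notin> Q" "w \<notin> Q"
      unfolding u_def w_def P_def Q_def using fD ij jk ik by fastforce+
    have PC: "P \<subseteq> C" "Q \<subseteq> C" unfolding P_def Q_def C_def using ij jk by auto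
    \<comment> \<open>\<open>R\<close>, the component of \<open>P\<close> in \<open>T\<close>,
      becomes the second part. \<open>Q\<close> is removed from \<open>T\<close> in advance, and
      \<open>RQ\<close> shows afterwards that no edge joins \<open>R\<close> to it.\<close>
    define T where "T = W - D - {u, w} - Q"
    define b where "b = f (Suc i)"
    have bP: "b \<in> P" unfolding b_def P_def using ij ne1 by auto
    have PT: "P \<subseteq> T" unfolding T_def using PC DW CW uP PQ by blast
    have bT: "b \<in> T" using PT bP by blast
    define R where "R = reach G T b"
    have RT: "R \<subseteq> T" using reach_subset[OF bT] unfolding R_def .
    have PR: "P \<subseteq> R" unfolding R_def using connected_in_subset_reach[OF conP PT bP] .
    have conR: "connected_in G R" unfolding R_def by (rule connected_in_reach)
    have Rnbr: "v \<in> R \<union> {u, w} \<union> D" if "x \<in> R" "v \<in> W" "v \<notin> Q" "{x, v} \<in> edges G" for x v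
      using reach_closed[OF bT _ _ that(4)] that unfolding R_def T_def by blast
    have ui: "i \<in> I" "j \<in> I" using ij by auto
    have Qne: "Q \<noteq> {}" using conQ unfolding connected_in_def by blast
    \<comment> \<open>Otherwise \<open>{u} \<union> D\<close>, \<open>{w}\<close>, \<open>R\<close>
      and \<open>Q\<close> are branch sets of a \<open>K\<^sub>4\<close> minor: \<open>D\<close>
      links \<open>u\<close> to \<open>w\<close>, and each of \<open>u\<close>, \<open>w\<close> has
      neighbours in both arcs.\<close>
    have RQ: "{x, y} \<notin> edges G" if xy: "x \<in> R" "y \<in> Q" for x y
    proof
      assume e: "{x, y} \<in> edges G"
      obtain d where d: "d \<in> D" "{u, d} \<in> edges G" using ui(1) unfolding I_def u_def by blast
      have con1: "connected_in G ({u} \<union> D)"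
        using connected_in_Un[OF connected_in_singleton conD _ d] by blast
      have iP: "{u, f (Suc i)} \<in> edges G" "f (Suc i) \<in> P"
        using cycle_map_Suc[OF f(2), of i] ij jk bP unfolding u_def b_def by auto
      have jP: "{w, f (j - 1)} \<in> edges G" "f (j - 1) \<in> P"
        using cycle_map_Suc[OF f(2), of "j - 1"] ij jk ne1 unfolding w_def P_def by (auto simp: insert_commute)
      define a where "a = (if i = 0 then k - 1 else i - 1)"
      define c where "c = (if Suc j = k then 0 else Suc j)"
      have iQ: "{u, f a} \<in> edges G" "f a \<in> Q"
        using cycle_map_Suc[OF f(2), of "i - 1"] cycle_map_last[OF f(2)] ij jk f(1) ne2
        unfolding u_def a_def Q_def by (auto simp: insert_commute)
      have jQ: "{w, f c} \<in> edges G" "f c \<in> Q"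
        using cycle_map_Suc[OF f(2), of j] cycle_map_last[OF f(2)] ij jk f(1) ne2
        unfolding w_def c_def Q_def by (auto simp: insert_commute)
      have "is_minor (complete_graph {..<4::nat}) G"
      proof (rule K4_minorI[OF con1 connected_in_singleton[of G w] conR conQ])
        show "{u} \<union> D \<union> {w} \<union> R \<union> Q \<subseteq> verts G" using uw CW DW RT PC G(2) T_def by blast
        show "({u} \<union> D) \<inter> {w} = {}" "({u} \<union> D) \<inter> R = {}" "({u} \<union> D) \<inter> Q = {}" "{w} \<inter> R = {}"
          "{w} \<inter> Q = {}" "R \<inter> Q = {}" using uw DW RT PC uP T_def by blast+
        obtain d' where "d' \<in> D" "{w, d'} \<in> edges G" using ui(2) unfolding I_def w_def by blast
        thus "\<exists>x\<in>{u} \<union> D. \<exists>y\<in>{w}. {x, y} \<in> edges G" by (auto simp: insert_commute)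
        show "\<exists>x\<in>{u} \<union> D. \<exists>y\<in>R. {x, y} \<in> edges G" using iP PR by blast
        show "\<exists>x\<in>{u} \<union> D. \<exists>y\<in>Q. {x, y} \<in> edges G" using iQ by blast
        show "\<exists>x\<in>{w}. \<exists>y\<in>R. {x, y} \<in> edges G" using jP PR by blast
        show "\<exists>x\<in>{w}. \<exists>y\<in>Q. {x, y} \<in> edges G" using jQ by blast
        show "\<exists>x\<in>R. \<exists>y\<in>Q. {x, y} \<in> edges G" using xy e by blast
      qed
      thus False using G(3) by simp
    qed
    show ?thesis
    \<comment> \<open>The parts own \<open>z\<close>, \<open>b\<close> and a vertex of
      \<open>Q\<close> respectively, so that any two of them leave out a vertex of
      \<open>W\<close>.\<close>
    proof (rule triple[of "D \<union> {u, w}" "R \<union> {u, w}" "W - D - R" u w])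
      have uw': "u \<in> W - D - R" "w \<in> W - D - R" using uw CW DW RT T_def by blast+
      have DR: "D \<inter> R = {}" using RT T_def by blast
      have RW: "R \<subseteq> W" "D \<subseteq> W" using RT T_def DW by blast+
      have uwD: "u \<notin> D" "w \<notin> D" "u \<notin> R" "w \<notin> R" using uw' by blast+
      show "D \<union> {u, w} \<union> (R \<union> {u, w}) \<union> (W - D - R) = W" using uw' RW by blast
      show "(D \<union> {u, w}) \<inter> (R \<union> {u, w}) = {u, w}" using DR uwD by blast
      show "(D \<union> {u, w}) \<inter> (W - D - R) = {u, w}" using uw' by blast
      show "(R \<union> {u, w}) \<inter> (W - D - R) = {u, w}" using uw' by blast
      obtain q where q: "q \<in> Q" using Qne by blast
      hence "q \<in> W" "q \<notin> D" "q \<notin> R" "q \<noteq> u" "q \<noteq> w" using PC CW DW RT T_def uP by blast+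
      thus "D \<union> {u, w} \<union> (R \<union> {u, w}) \<subset> W" using RW uw' by blast
      have "b \<in> R" "b \<in> W" "b \<notin> D" "b \<noteq> u" "b \<noteq> w" using bP PR bT T_def by blast+
      thus "D \<union> {u, w} \<union> (W - D - R) \<subset> W" using RW uw' by blast
      show "R \<union> {u, w} \<union> (W - D - R) \<subset> W" using zD DR RW uw' by blast
      show "no_cross_edges G (D \<union> {u, w}) (R \<union> {u, w})"
        unfolding no_cross_edges_def
      proof (intro ballI notI)
        fix x v assume "x \<in> D \<union> {u, w} - (R \<union> {u, w})" "v \<in> R \<union> {u, w} - (D \<union> {u, w})" "{x, v} \<in> edges G"
        thus False using nbr[of x v] Nuw RW by blast
      qed
      show "no_cross_edges G (D \<union> {u, w}) (W - D - R)"
        unfolding no_cross_edges_def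
      proof (intro ballI notI)
        fix x v assume "x \<in> D \<union> {u, w} - (W - D - R)" "v \<in> W - D - R - (D \<union> {u, w})" "{x, v} \<in> edges G"
        thus False using nbr[of x v] Nuw uw' by blast
      qed
      show "no_cross_edges G (R \<union> {u, w}) (W - D - R)"
        unfolding no_cross_edges_def
      proof (intro ballI notI)
        fix x v assume a: "x \<in> R \<union> {u, w} - (W - D - R)" "v \<in> W - D - R - (R \<union> {u, w})" "{x, v} \<in> edges G"
        hence "x \<in> R" using uw' by blast
        thus False using Rnbr[of x v] RQ[of x v] a by blast
      qed
    qed
  qed
qed

section \<open>Completions\<close>

definition is_completion ::
    "'a sgraph \<Rightarrow> 'a set \<Rightarrow> ('a \<Rightarrow> 'a \<Rightarrow> real) \<Rightarrow> ('a \<Rightarrow> 'a \<Rightarrow> real) \<Rightarrow> bool" where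
  "is_completion G W A B \<longleftrightarrow> psd_on W B \<and>
     (\<forall>i\<in>W. \<forall>j\<in>W. i = j \<or> {i, j} \<in> edges G \<longrightarrow> B i j = A i j)"

definition completable :: "'a sgraph \<Rightarrow> 'a set \<Rightarrow> ('a \<Rightarrow> 'a \<Rightarrow> real) \<Rightarrow> bool" where
  "completable G W A \<longleftrightarrow> (\<exists>B. is_completion G W A B)"

text \<open>All cliques instead of the maximal ones, because a maximal clique of an induced subgraph
  need not be maximal in the whole graph. \<open>P_cone_clique_psd\<close> makes the link.\<close>

definition clique_psd :: "'a sgraph \<Rightarrow> ('a \<Rightarrow> 'a \<Rightarrow> real) \<Rightarrow> bool" where
  "clique_psd G A \<longleftrightarrow> (\<forall>K. is_clique G K \<longrightarrow> psd_on K A)"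

lemma is_completionD:
  assumes "is_completion G W A B"
  shows "psd_on W B" "i \<in> W \<Longrightarrow> B i i = A i i"
    "i \<in> W \<Longrightarrow> j \<in> W \<Longrightarrow> {i, j} \<in> edges G \<Longrightarrow> B i j = A i j"
  using assms unfolding is_completion_def by auto

lemma is_completionI:
  assumes "psd_on W B" "\<And>i. i \<in> W \<Longrightarrow> B i i = A i i"
    "\<And>i j. i \<in> W \<Longrightarrow> j \<in> W \<Longrightarrow> {i, j} \<in> edges G \<Longrightarrow> B i j = A i j"
  shows "is_completion G W A B"
  using assms unfolding is_completion_def by auto

lemma is_completion_subset:
  assumes "is_completion G W A B" "finite W" "V \<subseteq> W"
  shows "is_completion G V A B"
  using assms psd_on_subset[of W B V] unfolding is_completion_def by blast

lemma completableI: "is_completion G W A B \<Longrightarrow> completable G W A"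
  unfolding completable_def by (rule exI)

lemma completableE:
  assumes "completable G W A"
  obtains B where "is_completion G W A B"
  using assms unfolding completable_def by (elim exE)

lemma completable_of_psd: "psd_on W A \<Longrightarrow> completable G W A"
  unfolding completable_def is_completion_def by blast

text \<open>Every specified position of the union lies inside \<open>X\<close> or inside
  \<open>Y\<close>, so the amalgamated matrix is a completion. The second conclusion keeps track of
  the value at \<open>(u, w)\<close> when a third part is glued on.\<close>

lemma completion_amalgamation:
  assumes "finite X" "finite Y" "is_completion G X A B" "is_completion G Y A C" "no_cross_edges G X Y"
    and "\<And>i j. i \<in> X \<inter> Y \<Longrightarrow> j \<in> X \<inter> Y \<Longrightarrow> B i j = C i j"
  obtains D where "is_completion G (X \<union> Y) A D" "\<And>i j. i \<in> X \<Longrightarrow> j \<in> X \<Longrightarrow> D i j = B i j"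
proof -
  note B = is_completionD[OF assms(3)] and C = is_completionD[OF assms(4)]
  obtain D where D: "psd_on (X \<union> Y) D" "\<And>i j. i \<in> X \<Longrightarrow> j \<in> X \<Longrightarrow> D i j = B i j"
    "\<And>i j. i \<in> Y \<Longrightarrow> j \<in> Y \<Longrightarrow> D i j = C i j"
    using psd_amalgamation[OF assms(1,2) B(1) C(1) assms(6)] by auto
  have "is_completion G (X \<union> Y) A D"
  proof (rule is_completionI[OF D(1)])
    show "D i i = A i i" if "i \<in> X \<union> Y" for i
      using that D(2)[of i i] D(3)[of i i] B(2)[of i] C(2)[of i] by auto
    fix i j assume ij: "i \<in> X \<union> Y" "j \<in> X \<union> Y" "{i, j} \<in> edges G"
    have "{j, i} \<in> edges G" using ij(3) by (simp add: insert_commute)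
    hence "i \<in> X \<and> j \<in> X \<or> i \<in> Y \<and> j \<in> Y" using ij assms(5) unfolding no_cross_edges_def by blast
    thus "D i j = A i j" using D(2,3) B(3) C(3) ij(3) by auto
  qed
  thus ?thesis using D(2) by (rule that)
qed

text \<open>On a clique all entries are specified, so any two completions agree on the
  overlap.\<close>

lemma completable_separator:
  assumes "finite X" "finite Y" "completable G X A" "completable G Y A"
    and "is_clique G (X \<inter> Y)" "no_cross_edges G X Y"
  shows "completable G (X \<union> Y) A"
proof -
  obtain B where B: "is_completion G X A B" using assms(3) unfolding completable_def by blast
  obtain C where C: "is_completion G Y A C" using assms(4) unfolding completable_def by blast
  have "B i j = C i j" if "i \<in> X \<inter> Y" "j \<in> X \<inter> Y" for i j
  proof (cases "i = j")
    case False
    hence "{i, j} \<in> edges G" using assms(5) that unfolding is_clique_def by blast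
    thus ?thesis using is_completionD(3)[OF B, of i j] is_completionD(3)[OF C, of i j] that by simp
  qed (use is_completionD(2)[OF B, of i] is_completionD(2)[OF C, of i] that in simp)
  from completion_amalgamation[OF assms(1,2) B C assms(6) this]
  show ?thesis unfolding completable_def by blast
qed

text \<open>Of three points, one in each pairwise intersection, the median lies in all three
  sets.\<close>

lemma real_helly_three:
  fixes S T U :: "real set"
  assumes "convex S" "convex T" "convex U" "S \<inter> T \<noteq> {}" "S \<inter> U \<noteq> {}" "T \<inter> U \<noteq> {}"
  shows "S \<inter> T \<inter> U \<noteq> {}"
proof -
  obtain a b c where abc: "a \<in> S" "a \<in> T" "b \<in> S" "b \<in> U" "c \<in> T" "c \<in> U" using assms by blast
  have conv: "y \<in> X" if "convex X" "x \<in> X" "z \<in> X" "x \<le> y" "y \<le> z" for X :: "real set" and x y z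
  proof (cases "x = z")
    case False
    define t where "t = (y - x) / (z - x)"
    have "0 \<le> t" "t \<le> 1" using that False unfolding t_def by (auto simp: field_simps)
    hence "(1 - t) *\<^sub>R x + t *\<^sub>R z \<in> X" using that convexD_alt by blast
    moreover have "(1 - t) *\<^sub>R x + t *\<^sub>R z = x + t * (z - x)" by (simp add: algebra_simps)
    ultimately show ?thesis using False unfolding t_def by simp
  qed (use that in simp)
  consider "a \<le> b" "b \<le> c" | "a \<le> c" "c \<le> b" | "b \<le> a" "a \<le> c" | "b \<le> c" "c \<le> a"
    | "c \<le> a" "a \<le> b" | "c \<le> b" "b \<le> a" by linarith
  thus ?thesis
  proof cases
    case 1 thus ?thesis using conv[OF assms(2), of a c b] abc by blast
  next
    case 2 thus ?thesis using conv[OF assms(1), of a b c] abc by blast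
  next
    case 3 thus ?thesis using conv[OF assms(3), of b c a] abc by blast
  next
    case 4 thus ?thesis using conv[OF assms(1), of b a c] abc by blast
  next
    case 5 thus ?thesis using conv[OF assms(3), of c b a] abc by blast
  next
    case 6 thus ?thesis using conv[OF assms(2), of c a b] abc by blast
  qed
qed

text \<open>The values at \<open>(u, w)\<close> of the completions on each part form an interval, and by hypothesis
  these three intervals intersect pairwise.\<close>

lemma completable_triple:
  assumes "finite X" "finite Y" "finite Z"
    and "X \<inter> Y = {u, w}" "X \<inter> Z = {u, w}" "Y \<inter> Z = {u, w}"
    and "no_cross_edges G X Y" "no_cross_edges G X Z" "no_cross_edges G Y Z"
    and "completable G (X \<union> Y) A" "completable G (X \<union> Z) A" "completable G (Y \<union> Z) A"
  shows "completable G (X \<union> Y \<union> Z) A"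
proof -
  define V where "V S = {B u w | B. is_completion G S A B}" for S
  have conv: "convex (V S)" for S
  proof (rule convexI)
    fix x y s t :: real assume xy: "x \<in> V S" "y \<in> V S" "0 \<le> s" "0 \<le> t" "s + t = 1"
    from xy(1) obtain B where B: "x = B u w" "is_completion G S A B" unfolding V_def by blast
    from xy(2) obtain C where C: "y = C u w" "is_completion G S A C" unfolding V_def by blast
    have st: "s * a + t * a = a" for a using xy(5) by (metis distrib_right mult_1)
    have "is_completion G S A (\<lambda>i j. s * B i j + t * C i j)"
      using psd_on_convex[OF is_completionD(1)[OF B(2)] is_completionD(1)[OF C(2)] xy(3,4)]
      by (rule is_completionI) (simp_all add: is_completionD(2,3)[OF B(2)] is_completionD(2,3)[OF C(2)] st)
    hence "s * B u w + t * C u w \<in> V S" unfolding V_def mem_Collect_eq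
      by (intro exI[of _ "\<lambda>i j. s * B i j + t * C i j"] conjI refl)
    thus "s *\<^sub>R x + t *\<^sub>R y \<in> V S" using B(1) C(1) by simp
  qed
  \<comment> \<open>A completion of the union of two parts restricts to both and gives them a common
    value at \<open>(u, w)\<close>.\<close>
  have restr: "V S \<inter> V T \<noteq> {}" if ST: "finite S" "finite T" "completable G (S \<union> T) A" for S T
  proof -
    obtain B where B: "is_completion G (S \<union> T) A B" using ST(3) unfolding completable_def by blast
    have "is_completion G S A B" "is_completion G T A B"
      using ST by (auto intro: is_completion_subset[OF B])
    hence "B u w \<in> V S \<inter> V T" unfolding V_def by blast
    thus ?thesis by blast
  qed
  obtain t where t: "t \<in> V X" "t \<in> V Y" "t \<in> V Z"
    using real_helly_three[OF conv conv conv restr[OF _ _ assms(10)] restr[OF _ _ assms(11)] restr[OF _ _ assms(12)]]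
      assms(1-3) by blast
  obtain B where B: "t = B u w" "is_completion G X A B" using t(1) unfolding V_def by blast
  obtain C where C: "t = C u w" "is_completion G Y A C" using t(2) unfolding V_def by blast
  obtain D where D: "t = D u w" "is_completion G Z A D" using t(3) unfolding V_def by blast
  have m: "u \<in> X" "w \<in> X" "u \<in> Y" "w \<in> Y" "u \<in> Z" "w \<in> Z" using assms(4-6) by blast+
  have agree: "E i j = F i j"
    if "i \<in> {u, w}" "j \<in> {u, w}" "is_completion G S A E" "is_completion G T A F" "E u w = F u w"
      "u \<in> S" "w \<in> S" "u \<in> T" "w \<in> T" for E F S T i j
  proof -
    have "E w u = F w u"
      using psd_on_sym[OF is_completionD(1)[OF that(3)] that(7,6)]
        psd_on_sym[OF is_completionD(1)[OF that(4)] that(9,8)] that(5) by simp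
    thus ?thesis using that is_completionD(2)[OF that(3)] is_completionD(2)[OF that(4)] by auto
  qed
  have "B i j = C i j" if "i \<in> X \<inter> Y" "j \<in> X \<inter> Y" for i j
    using agree[OF _ _ B(2) C(2) _ m(1-4)] that B(1) C(1) unfolding assms(4) by simp
  from completion_amalgamation[OF assms(1,2) B(2) C(2) assms(7) this]
  obtain E where E: "is_completion G (X \<union> Y) A E" "\<And>i j. i \<in> X \<Longrightarrow> j \<in> X \<Longrightarrow> E i j = B i j" by blast
  have XYZ: "(X \<union> Y) \<inter> Z = {u, w}" using assms(5,6) by blast
  have "E u w = D u w" using E(2) m(1,2) B(1) D(1) by simp
  hence ED: "E i j = D i j" if "i \<in> (X \<union> Y) \<inter> Z" "j \<in> (X \<union> Y) \<inter> Z" for i j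
    using agree[OF _ _ E(1) D(2) _ _ _ m(5,6)] that m unfolding XYZ by simp
  have nc: "no_cross_edges G (X \<union> Y) Z" using assms(8,9) unfolding no_cross_edges_def by blast
  have "finite (X \<union> Y)" using assms(1,2) by simp
  from completion_amalgamation[OF this assms(3) E(1) D(2) nc ED]
  show ?thesis unfolding completable_def by blast
qed

text \<open>The induction runs over vertex sets of the fixed graph \<open>G\<close>, so the minor
  and chordality assumptions always refer to \<open>G\<close> itself. In the three-part case the
  induction hypothesis is applied to the unions of two parts.\<close>

theorem completable_if_cycles_completable:
  assumes G: "simple_graph G" "\<not> is_minor (complete_graph {..<4::nat}) G \<or> chordal G"
    and A: "clique_psd G A"
    and cyc: "\<And>k f. 4 \<le> k \<Longrightarrow> cycle_map G k f \<Longrightarrow> completable G (f ` {..<k}) A"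
    and W: "W \<subseteq> verts G"
  shows "completable G W A"
  using W
proof (induction "card W" arbitrary: W rule: less_induct)
  case less
  have finW: "finite W" using less(2) G(1) unfolding simple_graph_def by (auto intro: finite_subset)
  have IH: "completable G V A" if "V \<subset> W" for V
    using less psubset_card_mono[OF finW that] that by blast
  have sep: "completable G W A"
    if "X \<subset> W" "Y \<subset> W" "X \<union> Y = W" "is_clique G (X \<inter> Y)" "no_cross_edges G X Y" for X Y
  proof -
    have "finite X" "finite Y" using that finW by (auto intro: finite_subset)
    thus ?thesis using completable_separator[OF _ _ IH[OF that(1)] IH[OF that(2)] that(4,5)] that(3) by simp
  qed
  show ?case
  proof (cases "is_clique G W")
    case True
    thus ?thesis using A unfolding clique_psd_def by (blast intro: completable_of_psd)
  next
    case False
    show ?thesis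
    proof (rule clique_separator_or_induced_cycle[OF G(1) less(2) False], goal_cases)
      case (1 X Y)
      thus ?case by (rule sep)
    next
      case c: (2 k f)
      have "\<not> chordal G" unfolding chordal_def using c(1,2) has_induced_cycle_iff[OF G(1), of k] by auto
      hence noK4: "\<not> is_minor (complete_graph {..<4::nat}) G" using G(2) by blast
      show ?case
      proof (cases "f ` {..<k} = W")
        case True
        thus ?thesis using cyc[OF c(1,2)] by simp
      next
        case False
        hence f: "f ` {..<k} \<subset> W" using c(3) by blast
        show ?thesis
        proof (rule K4_minor_free_decomposition[OF G(1) less(2) noK4 c(1,2) f], goal_cases)
          case (1 X Y)
          thus ?case by (rule sep)
        next
          case t: (2 u w X Y Z)
          have "finite (X \<union> Y \<union> Z)" using t(1) finW by simp
          hence "completable G (X \<union> Y \<union> Z) A"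
            using completable_triple[OF _ _ _ t(2-4,8-10) IH[OF t(5)] IH[OF t(6)] IH[OF t(7)]] by simp
          thus ?case using t(1) by simp
        qed
      qed
    qed
  qed
qed

section \<open>Cycles\<close>

text \<open>The inequalities are those between the sides of a spherical triangle. They give
  \<open>cos (a + b) \<le> cos c \<le> cos (a - b)\<close>, the determinant condition of
  \<open>psd_on_triple\<close>; the bound on the perimeter takes over when \<open>a + b\<close>
  exceeds \<pi>.\<close>

lemma psd_on_spherical_triangle:
  assumes "i \<noteq> j" "j \<noteq> l" "i \<noteq> l" "A i i = 1" "A j j = 1" "A l l = 1"
    and "A j i = A i j" "A l i = A i l" "A l j = A j l"
    and "A i j = cos a" "A i l = cos b" "A j l = cos c"
    and "0 \<le> a" "a \<le> pi" "0 \<le> b" "b \<le> pi" "a \<le> b + c" "b \<le> a + c" "c \<le> a + b" "a + b + c \<le> 2 * pi"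
  shows "psd_on {i, j, l} A"
proof -
  have "cos c \<le> cos \<bar>a - b\<bar>" using assms by (intro cos_monotone_0_pi_le) auto
  also have "cos \<bar>a - b\<bar> = cos (a - b)" by simp
  finally have 1: "cos c \<le> cos a * cos b + sin a * sin b" by (simp add: cos_diff)
  have "cos (a + b) \<le> cos c"
  proof (cases "a + b \<le> pi")
    case True
    thus ?thesis using assms by (intro cos_monotone_0_pi_le) auto
  next
    case False
    have "cos (2 * pi - (a + b)) \<le> cos c" using assms False by (intro cos_monotone_0_pi_le) auto
    thus ?thesis by (simp add: cos_diff)
  qed
  hence 2: "cos a * cos b - sin a * sin b \<le> cos c" by (simp add: cos_add)
  have "\<bar>cos c - cos a * cos b\<bar> \<le> \<bar>sin a * sin b\<bar>" using 1 2 by linarith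
  hence "(cos c - cos a * cos b)\<^sup>2 \<le> (sin a * sin b)\<^sup>2" by (simp only: abs_le_square_iff)
  also have "\<dots> = (1 - (cos a)\<^sup>2) * (1 - (cos b)\<^sup>2)" by (simp add: power_mult_distrib sin_squared_eq)
  finally show ?thesis using psd_on_triple[of i j l A] assms by simp
qed

text \<open>If all path angles \<open>\<theta>\<^sub>i\<close> are at most \<open>\<pi>/2\<close>, the angle between the end vectors of a chain of unit
  vectors can be the total angle \<open>S\<close> (a planar chain, when \<open>S \<le> \<pi>/2\<close>) and every value between
  \<open>\<pi> - S\<close> and \<open>S\<close>.\<close>

lemma path_completion:
  fixes \<theta> :: "nat \<Rightarrow> real"
  assumes "\<And>i. 0 \<le> \<theta> i" "\<And>i. \<theta> i \<le> pi / 2" "1 \<le> n" "0 \<le> \<phi>" "\<phi> \<le> pi"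
    and "\<phi> = (\<Sum>i<n. \<theta> i) \<and> \<phi> \<le> pi / 2 \<or> pi - (\<Sum>i<n. \<theta> i) \<le> \<phi> \<and> \<phi> \<le> (\<Sum>i<n. \<theta> i)"
  shows "\<exists>B. psd_on {..n} B \<and> (\<forall>i\<le>n. B i i = 1) \<and> (\<forall>i<n. B i (Suc i) = cos (\<theta> i)) \<and> B 0 n = cos \<phi>"
  using assms(3-6)
proof (induction n arbitrary: \<phi> rule: nat_induct_at_least)
  case base
  have phi: "\<phi> = \<theta> 0" using base(3) assms(2)[of 0] by auto
  define B where "B i j = (if i = j then 1 else cos (\<theta> 0))" for i j :: nat
  have "psd_on {0, 1} B" by (intro psd_on_pairI) (auto simp: B_def abs_square_le_1)
  moreover have "{..1::nat} = {0, 1}" by auto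
  ultimately have "psd_on {..1} B" by simp
  moreover have "B 0 1 = cos \<phi>" "B i (Suc i) = cos (\<theta> i)" if "i < 1" for i
    using that phi by (simp_all add: B_def)
  moreover have "B i i = 1" for i by (simp add: B_def)
  ultimately show ?case by blast
next
  case (Suc n)
  define S where "S = (\<Sum>i<n. \<theta> i)"
  have S: "(\<Sum>i<Suc n. \<theta> i) = S + \<theta> n" by (simp add: S_def)
  have S0: "0 \<le> S" unfolding S_def using assms(1) by (intro sum_nonneg) auto
  note t = assms(1)[of n] assms(2)[of n]
  note phi = Suc.prems[unfolded S]
  \<comment> \<open>The angle \<open>\<psi>\<close> between the vectors \<open>0\<close> and
    \<open>n\<close> has to be attainable by the shorter chain and to form a spherical triangle with
    \<open>\<theta> n\<close> and \<open>\<phi>\<close>.\<close>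
  obtain \<psi> where psi: "0 \<le> \<psi>" "\<psi> \<le> pi" "\<psi> = S \<and> \<psi> \<le> pi / 2 \<or> pi - S \<le> \<psi> \<and> \<psi> \<le> S"
    "\<psi> \<le> \<theta> n + \<phi>" "\<theta> n \<le> \<psi> + \<phi>" "\<phi> \<le> \<psi> + \<theta> n" "\<psi> + \<theta> n + \<phi> \<le> 2 * pi"
  proof (cases "S \<le> pi / 2")
    case True
    have "0 \<le> S \<and> S \<le> pi \<and> S \<le> \<theta> n + \<phi> \<and> \<theta> n \<le> S + \<phi> \<and> \<phi> \<le> S + \<theta> n \<and> S + \<theta> n + \<phi> \<le> 2 * pi"
      using phi t S0 True by auto
    thus ?thesis using that[of S] True by blast
  next
    case False
    \<comment> \<open>The least value that the lower bounds on \<open>\<psi>\<close> permit; the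
      upper bounds are then checked for it.\<close>
    define \<psi> where "\<psi> = max (pi - S) \<bar>\<phi> - \<theta> n\<bar>"
    have "0 \<le> \<psi> \<and> \<psi> \<le> pi \<and> (pi - S \<le> \<psi> \<and> \<psi> \<le> S) \<and> \<psi> \<le> \<theta> n + \<phi> \<and> \<theta> n \<le> \<psi> + \<phi> \<and> \<phi> \<le> \<psi> + \<theta> n
      \<and> \<psi> + \<theta> n + \<phi> \<le> 2 * pi"
      using phi t False unfolding \<psi>_def by auto
    thus ?thesis using that[of \<psi>] by blast
  qed
  obtain B where B: "psd_on {..n} B" "\<forall>i\<le>n. B i i = 1" "\<forall>i<n. B i (Suc i) = cos (\<theta> i)" "B 0 n = cos \<psi>"
    using Suc.IH[OF psi(1,2)] psi(3) unfolding S_def by blast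
  have Bn: "B n 0 = cos \<psi>" using psd_on_sym[OF B(1), of n 0] B(4) by simp
  define T where "T i j = (if i = j then 1 else if {i, j} = {0, n} then cos \<psi>
    else if {i, j} = {n, Suc n} then cos (\<theta> n) else cos \<phi>)" for i j :: nat
  have n0: "n \<noteq> 0" using Suc.hyps by simp
  have T: "T i i = 1" "T 0 n = cos \<psi>" "T n 0 = cos \<psi>" "T n (Suc n) = cos (\<theta> n)" "T (Suc n) n = cos (\<theta> n)"
    "T 0 (Suc n) = cos \<phi>" "T (Suc n) 0 = cos \<phi>" for i
    using n0 by (auto simp: T_def doubleton_eq_iff)
  have pT: "psd_on {n, 0, Suc n} T"
    using n0 T psi t phi by (intro psd_on_spherical_triangle[of _ _ _ _ \<psi> "\<theta> n" \<phi>]) auto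
  have int: "{..n} \<inter> {n, 0, Suc n} = {0, n}" by auto
  have ag: "B i j = T i j" if "i \<in> {..n} \<inter> {n, 0, Suc n}" "j \<in> {..n} \<inter> {n, 0, Suc n}" for i j
    using that T B Bn unfolding int by auto
  obtain C where C: "psd_on ({..n} \<union> {n, 0, Suc n}) C" "\<And>i j. i \<in> {..n} \<Longrightarrow> j \<in> {..n} \<Longrightarrow> C i j = B i j"
    "\<And>i j. i \<in> {n, 0, Suc n} \<Longrightarrow> j \<in> {n, 0, Suc n} \<Longrightarrow> C i j = T i j"
    using psd_amalgamation[OF _ _ B(1) pT ag] by auto
  have "{..n} \<union> {n, 0, Suc n} = {..Suc n}" by auto
  moreover have "C i i = 1" if "i \<le> Suc n" for i
    using that C(2)[of i i] C(3)[of i i] B(2) T by (cases "i = Suc n") auto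
  moreover have "C i (Suc i) = cos (\<theta> i)" if "i < Suc n" for i
    using that C(2)[of i "Suc i"] C(3)[of i "Suc i"] B(3) T by (cases "i = n") auto
  moreover have "C 0 (Suc n) = cos \<phi>" using C(3)[of 0 "Suc n"] T by simp
  ultimately show ?case using C(1) by auto
qed

text \<open>Flipping signs of vectors makes the path entries nonnegative, so that the path angles
  are at most \<open>pi / 2\<close> as \<open>path_completion\<close> demands, and moves the
  accumulated sign to the closing entry \<open>t\<close>. Whatever its sign, \<open>arccos t\<close>
  lies between \<open>arccos \<bar>t\<bar>\<close> and \<open>pi - arccos \<bar>t\<bar>\<close>, and
  the angle condition puts this range between \<open>pi - S\<close> and \<open>S\<close>, where
  \<open>S\<close> is the sum of the path angles.\<close>

lemma unit_cycle_completion: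
  fixes c :: "nat \<Rightarrow> real"
  assumes "2 \<le> k" "\<And>i. i < k \<Longrightarrow> \<bar>c i\<bar> \<le> 1" "pi \<le> (\<Sum>i<k. arccos \<bar>c i\<bar>)"
  shows "\<exists>B. psd_on {..<k} B \<and> (\<forall>i<k. B i i = 1) \<and> (\<forall>i. Suc i < k \<longrightarrow> B i (Suc i) = c i) \<and> B 0 (k - 1) = c (k - 1)"
proof -
  define n where "n = k - 1"
  have k: "k = Suc n" and n1: "1 \<le> n" using assms(1) unfolding n_def by auto
  \<comment> \<open>Zero beyond the path, since \<open>path_completion\<close> asks for angle bounds
    at every index.\<close>
  define \<theta> where "\<theta> i = (if i < n then arccos \<bar>c i\<bar> else 0)" for i
  have ac: "0 \<le> arccos \<bar>c i\<bar> \<and> arccos \<bar>c i\<bar> \<le> pi / 2" if "i < k" for i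
    using assms(2)[OF that] arccos_lbound[of "\<bar>c i\<bar>"] arccos_le_pi2[of "\<bar>c i\<bar>"] by auto
  have th: "0 \<le> \<theta> i" "\<theta> i \<le> pi / 2" for i using ac[of i] unfolding \<theta>_def k by auto
  have cth: "cos (\<theta> i) = \<bar>c i\<bar>" if "i < n" for i
    using that assms(2)[of i] unfolding \<theta>_def k by (simp add: cos_arccos)
  \<comment> \<open>The product of the first \<open>i\<close> signs, so that
    \<open>s i * s (Suc i)\<close> is the sign of \<open>c i\<close>, with zero counted as
    positive.\<close>
  define s where "s i = (\<Prod>l<i. if c l < 0 then - 1 else 1 :: real)" for i
  have s2: "s i * s i = 1" for i
    unfolding s_def prod.distrib[symmetric] by (intro prod.neutral) auto
  have sS: "s i * s (Suc i) = (if c i < 0 then - 1 else 1)" for i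
    using s2[of i] unfolding s_def by (simp add: mult.assoc[symmetric] split: if_splits)
  have s0: "s 0 = 1" by (simp add: s_def)
  have s1: "\<bar>s i\<bar> = 1" for i using s2[of i] by (metis abs_mult_self_eq abs_1 power2_eq_square power2_eq_1_iff abs_minus_cancel)
  define t where "t = s n * c n"
  have tabs: "\<bar>t\<bar> = \<bar>c n\<bar>" unfolding t_def abs_mult using s1 by simp
  have t1: "\<bar>t\<bar> \<le> 1" using tabs assms(2)[of n] k by simp
  have sum: "pi \<le> (\<Sum>i<n. \<theta> i) + arccos \<bar>t\<bar>"
  proof -
    have "(\<Sum>i<k. arccos \<bar>c i\<bar>) = (\<Sum>i<n. \<theta> i) + arccos \<bar>t\<bar>"
      unfolding k tabs by (simp add: \<theta>_def)
    thus ?thesis using assms(3) by simp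
  qed
  have "arccos \<bar>t\<bar> \<le> arccos t \<and> arccos t \<le> pi - arccos \<bar>t\<bar>"
    using t1 arccos_minus[of t] arccos_le_pi2[of "\<bar>t\<bar>"] by (cases "0 \<le> t") auto
  hence "pi - (\<Sum>i<n. \<theta> i) \<le> arccos t \<and> arccos t \<le> (\<Sum>i<n. \<theta> i)" using sum by linarith
  then obtain B where B: "psd_on {..n} B" "\<forall>i\<le>n. B i i = 1" "\<forall>i<n. B i (Suc i) = cos (\<theta> i)" "B 0 n = cos (arccos t)"
    using path_completion[where \<theta> = \<theta> and \<phi> = "arccos t", OF th n1] arccos_lbound[of t] arccos_ubound[of t] t1 by auto
  define C where "C i j = s i * s j * B i j" for i j
  have "psd_on {..n} C" unfolding C_def using psd_on_reindex_scale[OF B(1), of id "{..n}" s] by simp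
  moreover have "{..n} = {..<k}" unfolding k by auto
  moreover have "C i i = 1" if "i < k" for i using that B(2) s2 unfolding C_def k by simp
  moreover have "C i (Suc i) = c i" if "Suc i < k" for i
    using that B(3) cth[of i] sS[of i] unfolding C_def k by auto
  moreover have "C 0 n = c n"
  proof -
    have "C 0 n = s n * (s n * c n)" using B(4) t1 s0 unfolding C_def t_def by (simp add: cos_arccos_abs)
    thus ?thesis using s2[of n] by (simp add: mult.assoc[symmetric])
  qed
  ultimately show ?thesis unfolding n_def by auto
qed

text \<open>The derivative is \<open>- d / ((s + d) * sqrt (2 * s * d + d\<^sup>2))\<close>, and its
  denominator grows with \<open>s\<close>.\<close>

lemma convex_on_arccos_ratio:
  assumes "0 < d"
  shows "convex_on {0..} (\<lambda>s. arccos (s / (s + d)))"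
proof (rule convex_on_realI)
  fix s :: real assume s: "s \<in> {0..}"
  have p: "0 < s + d" using s assms by simp
  have q: "-1 < s / (s + d)" "s / (s + d) < 1" using s assms p by (auto simp: field_simps)
  have "1 - (s / (s + d))\<^sup>2 = ((s + d)\<^sup>2 - s\<^sup>2) / (s + d)\<^sup>2" using p by (simp add: field_simps)
  hence r: "sqrt (1 - (s / (s + d))\<^sup>2) = sqrt ((s + d)\<^sup>2 - s\<^sup>2) / (s + d)"
    using p by (simp add: real_sqrt_divide)
  have "0 < (s + d)\<^sup>2 - s\<^sup>2" using s assms by (simp add: power2_eq_square algebra_simps add_pos_nonneg)
  hence w: "0 < sqrt ((s + d)\<^sup>2 - s\<^sup>2)" by simp
  have "((\<lambda>s. s / (s + d)) has_real_derivative d / (s + d)\<^sup>2) (at s)"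
    using p by (auto intro!: derivative_eq_intros simp: power2_eq_square)
  from DERIV_chain2[OF DERIV_arccos[OF q] this]
  have "((\<lambda>s. arccos (s / (s + d))) has_real_derivative
    inverse (- sqrt (1 - (s / (s + d))\<^sup>2)) * (d / (s + d)\<^sup>2)) (at s)" .
  also have "inverse (- sqrt (1 - (s / (s + d))\<^sup>2)) * (d / (s + d)\<^sup>2)
    = - (d / ((s + d) * sqrt ((s + d)\<^sup>2 - s\<^sup>2)))"
  proof -
    have "inverse (- (v / q)) * (d / q\<^sup>2) = - (d / (q * v))" if "0 < v" "0 < q" for v q :: real
      using that by (simp add: field_simps power2_eq_square)
    from this[OF w p] show ?thesis unfolding r .
  qed
  finally show "((\<lambda>s. arccos (s / (s + d))) has_real_derivative
    - (d / ((s + d) * sqrt ((s + d)\<^sup>2 - s\<^sup>2)))) (at s)" .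
next
  fix x y :: real assume xy: "x \<in> {0..}" "y \<in> {0..}" "x \<le> y"
  have e: "(z + d)\<^sup>2 - z\<^sup>2 = 2 * z * d + d\<^sup>2" for z by (simp add: power2_eq_square algebra_simps)
  have "(x + d) * sqrt (2 * x * d + d\<^sup>2) \<le> (y + d) * sqrt (2 * y * d + d\<^sup>2)"
    using xy assms by (intro mult_mono real_sqrt_le_mono) auto
  moreover have "0 < (x + d) * sqrt (2 * x * d + d\<^sup>2)"
    using xy assms by (intro mult_pos_pos) (auto simp: add_nonneg_pos)
  ultimately show "- (d / ((x + d) * sqrt ((x + d)\<^sup>2 - x\<^sup>2))) \<le> - (d / ((y + d) * sqrt ((y + d)\<^sup>2 - y\<^sup>2)))"
    unfolding e using assms by (simp add: divide_left_mono)
qed simp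

definition cycle_eps :: "nat \<Rightarrow> real" where
  "cycle_eps k = 1 / real k * (1 / cos (pi / real k) - 1)"

lemma cos_pi_div:
  assumes "3 \<le> k"
  shows "0 < cos (pi / real k)" "cos (pi / real k) < 1"
proof -
  have "pi / real k < pi / 2" using assms pi_gt_zero by (intro divide_strict_left_mono) auto
  moreover have "0 < pi / real k" using assms pi_gt_zero by simp
  moreover have "pi / 2 \<le> pi" using pi_gt_zero by simp
  ultimately have "0 < pi / real k" "pi / real k < pi / 2" "pi / real k \<le> pi" by linarith+
  thus "0 < cos (pi / real k)" "cos (pi / real k) < 1"
    using cos_gt_zero[of "pi / real k"] cos_monotone_0_pi[of 0 "pi / real k"] by simp_all
qed

lemma cycle_eps_pos: "3 \<le> k \<Longrightarrow> 0 < cycle_eps k"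
  unfolding cycle_eps_def using cos_pi_div[of k] by (auto simp: field_simps)

text \<open>Both factors decrease in the length, so among all induced cycles the shortest makes the
  largest demand.\<close>

lemma cycle_eps_antimono:
  assumes "3 \<le> g" "g \<le> k"
  shows "cycle_eps k \<le> cycle_eps g"
proof -
  have "cos (pi / real g) \<le> cos (pi / real k)"
    using assms pi_gt_zero by (intro cos_monotone_0_pi_le) (auto simp: field_simps)
  hence "1 / cos (pi / real k) \<le> 1 / cos (pi / real g)"
    using cos_pi_div[OF assms(1)] by (intro divide_left_mono) auto
  moreover have "1 / real k \<le> 1 / real g" using assms by (intro divide_left_mono) auto
  moreover have "1 \<le> 1 / cos (pi / real k)" using cos_pi_div[of k] assms by (simp add: field_simps)
  ultimately show ?thesis unfolding cycle_eps_def by (intro mult_mono) auto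
qed

text \<open>By AM-GM each angle is at least \<open>h(s\<^sub>i)\<close> for the mean \<open>s\<^sub>i\<close> of two consecutive diagonal entries, where
  \<open>h(s) = arccos (s / (s + d))\<close> is convex, so that Jensen's inequality reduces the claim to the case
  of constant diagonal.\<close>

lemma sum_arccos_ge_pi:
  fixes m :: "nat \<Rightarrow> real"
  assumes "3 \<le> k" "\<And>i. 0 \<le> m i" "0 < (\<Sum>i<k. m i)" "d = cycle_eps k * (\<Sum>i<k. m i)"
    and "\<And>i. i < k \<Longrightarrow> (a i)\<^sup>2 \<le> m i * m (Suc i mod k)"
  shows "pi \<le> (\<Sum>i<k. arccos \<bar>a i / (sqrt (m i + d) * sqrt (m (Suc i mod k) + d))\<bar>)"
proof -
  define \<tau> where "\<tau> = (\<Sum>i<k. m i)"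
  have d: "0 < d" using assms(3,4) cycle_eps_pos[OF assms(1)] by simp
  have k0: "0 < real k" using assms(1) by simp
  define s where "s i = (m i + m (Suc i mod k)) / 2" for i
  define h where "h x = arccos (x / (x + d))" for x
  have s0: "0 \<le> s i" for i unfolding s_def using assms(2) by simp
  have "(\<Sum>i<k. m (Suc i mod k)) = \<tau>"
  proof -
    obtain n where n: "k = Suc n" using assms(1) by (cases k) auto
    have "(\<Sum>i<k. m (Suc i mod k)) = (\<Sum>i<n. m (Suc i)) + m 0" unfolding n by simp
    also have "\<dots> = \<tau>" unfolding \<tau>_def n sum.lessThan_Suc_shift by simp
    finally show ?thesis .
  qed
  hence sums: "(\<Sum>i<k. s i) = \<tau>" unfolding s_def \<tau>_def by (simp add: sum_divide_distrib[symmetric] sum.distrib)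
  have step: "h (s i) \<le> arccos \<bar>a i / (sqrt (m i + d) * sqrt (m (Suc i mod k) + d))\<bar>" if i: "i < k" for i
  proof -
    let ?x = "m i" and ?y = "m (Suc i mod k)"
    have xy: "0 \<le> ?x" "0 \<le> ?y" using assms(2) by auto
    have "?x * ?y \<le> (s i)\<^sup>2"
    proof -
      have "(s i)\<^sup>2 - ?x * ?y = ((?x - ?y) / 2)\<^sup>2" unfolding s_def by (simp add: power2_eq_square field_simps)
      thus ?thesis by (metis diff_ge_0_iff_ge zero_le_power2)
    qed
    \<comment> \<open>Since \<open>?x + ?y = 2 * s i\<close>, the same \<open>c\<close> occurs in
      \<open>(?x + d) * (?y + d) = ?x * ?y + c\<close> and in
      \<open>(s i + d)\<^sup>2 = (s i)\<^sup>2 + c\<close>. AM-GM thus carries over to the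
      quotients, because \<open>t / (t + c)\<close> grows with \<open>t\<close>.\<close>
    define c where "c = 2 * s i * d + d\<^sup>2"
    have "?x * ?y * c \<le> (s i)\<^sup>2 * c"
      using s0[of i] d \<open>?x * ?y \<le> (s i)\<^sup>2\<close> unfolding c_def by (intro mult_right_mono) auto
    moreover have e1: "(?x + d) * (?y + d) = ?x * ?y + c"
      unfolding c_def s_def by (simp add: power2_eq_square field_simps)
    moreover have e2: "(s i + d)\<^sup>2 = (s i)\<^sup>2 + c" unfolding c_def by (simp add: power2_eq_square algebra_simps)
    ultimately have "?x * ?y * (s i + d)\<^sup>2 \<le> (s i)\<^sup>2 * ((?x + d) * (?y + d))"
      unfolding e1 e2 by (simp add: algebra_simps)
    hence "(a i)\<^sup>2 * (s i + d)\<^sup>2 \<le> (s i)\<^sup>2 * ((?x + d) * (?y + d))"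
      using mult_right_mono[OF assms(5)[OF i], of "(s i + d)\<^sup>2"] by simp
    moreover have "0 < ?x + d" "0 < ?y + d" "0 < s i + d" using xy d s0[of i] by auto
    ultimately have "(a i)\<^sup>2 / ((?x + d) * (?y + d)) \<le> (s i)\<^sup>2 / (s i + d)\<^sup>2"
      by (simp add: divide_le_eq pos_le_divide_eq mult.commute)
    hence "(a i / (sqrt (?x + d) * sqrt (?y + d)))\<^sup>2 \<le> (s i / (s i + d))\<^sup>2"
      using xy d by (simp add: power_divide power_mult_distrib)
    hence "\<bar>a i / (sqrt (?x + d) * sqrt (?y + d))\<bar> \<le> \<bar>s i / (s i + d)\<bar>" by (simp only: abs_le_square_iff)
    also have "\<dots> = s i / (s i + d)" using s0[of i] d by simp
    finally have "\<bar>a i / (sqrt (?x + d) * sqrt (?y + d))\<bar> \<le> s i / (s i + d)" .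
    moreover have "s i / (s i + d) \<le> 1" using s0[of i] d by simp
    moreover have "- 1 \<le> \<bar>a i / (sqrt (?x + d) * sqrt (?y + d))\<bar>" by (rule order_trans[OF _ abs_ge_zero]) simp
    ultimately show ?thesis unfolding h_def by (intro arccos_le_arccos)
  qed
  \<comment> \<open>This is the equation that fixes \<open>cycle_eps k\<close>.\<close>
  have "h (\<tau> / real k) = pi / real k"
  proof -
    have t: "0 < \<tau>" using assms(3) unfolding \<tau>_def .
    have "\<tau> / real k + d = (\<tau> / real k) / cos (pi / real k)"
      unfolding assms(4) \<tau>_def[symmetric] cycle_eps_def using k0 cos_pi_div(1)[OF assms(1)] by (simp add: field_simps)
    hence "\<tau> / real k / (\<tau> / real k + d) = cos (pi / real k)"
      using t k0 cos_pi_div(1)[OF assms(1)] by simp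
    moreover have "pi / real k \<le> pi" using k0 assms(1) pi_gt_zero by (simp add: field_simps)
    ultimately show ?thesis unfolding h_def using k0 by (simp add: arccos_cos)
  qed
  moreover have "{..<k} \<noteq> {}" using assms(1) by (simp add: lessThan_empty_iff)
  with convex_on_arccos_ratio[OF d] s0 k0
  have "h (\<Sum>i<k. (1 / real k) *\<^sub>R s i) \<le> (\<Sum>i<k. 1 / real k * h (s i))"
    unfolding h_def
    by (intro convex_on_sum[of _ "{0..}"]) auto
  moreover have "(\<Sum>i<k. (1 / real k) *\<^sub>R s i) = \<tau> / real k"
    using sums by (simp add: sum_divide_distrib[symmetric])
  ultimately have "pi / real k \<le> (\<Sum>i<k. h (s i)) / real k"
    using k0 by (auto simp: sum_divide_distrib[symmetric])
  hence "pi \<le> (\<Sum>i<k. h (s i))" using k0 by (simp add: divide_le_cancel)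
  also have "\<dots> \<le> (\<Sum>i<k. arccos \<bar>a i / (sqrt (m i + d) * sqrt (m (Suc i mod k) + d))\<bar>)"
    using step by (intro sum_mono) auto
  finally show ?thesis .
qed

section \<open>Shifted partial matrices on an induced cycle\<close>

lemma clique_psdD: "clique_psd G A \<Longrightarrow> is_clique G K \<Longrightarrow> psd_on K A"
  unfolding clique_psd_def by simp

lemma is_clique_subset: "is_clique G K \<Longrightarrow> K \<subseteq> verts G"
  unfolding is_clique_def by simp

lemma is_clique_finite: "simple_graph G \<Longrightarrow> is_clique G K \<Longrightarrow> finite K"
  unfolding simple_graph_def using is_clique_subset finite_subset by metis

lemma clique_psd_edge:
  assumes "simple_graph G" "clique_psd G A" "{u, v} \<in> edges G"
  shows "A u v = A v u" "(A u v)\<^sup>2 \<le> A u u * A v v"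
proof -
  note uv = simple_graph_edgeD[OF assms(1,3)]
  have "is_clique G {u, v}" unfolding is_clique_def using uv assms(3) by (auto simp: insert_commute)
  hence P: "psd_on {u, v} A" using assms(2) unfolding clique_psd_def by blast
  show "A u v = A v u" "(A u v)\<^sup>2 \<le> A u u * A v v"
    using psd_on_sym[OF P, of u v] psd_on_pair[OF P, of u v] uv by auto
qed

lemma clique_psd_diag:
  assumes "clique_psd G A" "u \<in> verts G"
  shows "0 \<le> A u u"
proof -
  have "psd_on {u} A" using assms unfolding clique_psd_def is_clique_def by blast
  thus ?thesis using psd_on_diag[of "{u}" A u] by simp
qed

lemma completable_add_diagonal:
  assumes "finite W" "completable G W (\<lambda>i j. A i j + (if i = j then d i else 0))"
    and "\<And>i. i \<in> W \<Longrightarrow> d i \<le> e i"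
  shows "completable G W (\<lambda>i j. A i j + (if i = j then e i else 0))"
proof -
  obtain B where B: "is_completion G W (\<lambda>i j. A i j + (if i = j then d i else 0)) B"
    using assms(2) unfolding completable_def by blast
  have "psd_on W (\<lambda>i j. if i = j then e i - d i else 0)"
    using assms(1,3) by (intro psd_on_diagonal) auto
  from psd_on_convex[OF is_completionD(1)[OF B] this, of 1 1]
  have "psd_on W (\<lambda>i j. B i j + (if i = j then e i - d i else 0))" by simp
  hence "is_completion G W (\<lambda>i j. A i j + (if i = j then e i else 0))
      (\<lambda>i j. B i j + (if i = j then e i - d i else 0))"
    using is_completionD(2,3)[OF B] by (intro is_completionI) auto
  thus ?thesis unfolding completable_def by blast
qed

text \<open>Scaling rows and columns by \<open>1 / sqrt (m i + d)\<close> gives a unit diagonal;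
  \<open>sum_arccos_ge_pi\<close> provides the angle condition, and scaling back turns the unit
  completion into one of the shifted matrix.\<close>

lemma completable_cycle:
  assumes G: "simple_graph G" and A: "clique_psd G A" and k: "4 \<le> k" and f: "cycle_map G k f"
  shows "completable G (f ` {..<k})
    (\<lambda>i j. A i j + (if i = j then cycle_eps k * (\<Sum>v\<in>f ` {..<k}. A v v) else 0))"
proof -
  define d where "d = cycle_eps k * (\<Sum>v\<in>f ` {..<k}. A v v)"
  have inj: "inj_on f {..<k}" and fV: "f ` {..<k} \<subseteq> verts G" using f unfolding cycle_map_def by blast+
  have md: "Suc i mod k < k" for i using k by simp
  \<comment> \<open>Zero outside the cycle positions, because \<open>sum_arccos_ge_pi\<close>
    assumes \<open>0 \<le> m i\<close> for every \<open>i\<close>.\<close>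
  define m where "m i = (if i < k then A (f i) (f i) else 0)" for i
  have m0: "0 \<le> m i" for i using clique_psd_diag[OF A, of "f i"] fV unfolding m_def by auto
  have sm: "(\<Sum>v\<in>f ` {..<k}. A v v) = (\<Sum>i<k. m i)"
    unfolding sum.reindex[OF inj] m_def by simp
  have edge: "{f i, f (Suc i mod k)} \<in> edges G" if "i < k" for i
    using f that md unfolding cycle_map_def by blast
  define a where "a i = A (f i) (f (Suc i mod k))" for i
  have a2: "(a i)\<^sup>2 \<le> m i * m (Suc i mod k)" if "i < k" for i
    using clique_psd_edge(2)[OF G A edge[OF that]] that md unfolding a_def m_def by simp
  have sm0: "0 \<le> (\<Sum>i<k. m i)" using m0 by (intro sum_nonneg) auto
  show ?thesis unfolding d_def[symmetric]
  proof (cases "(\<Sum>i<k. m i) = 0")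
    case True
    \<comment> \<open>With trace zero no normalisation is possible, but then all entries specified
      on the cycle vanish and the zero matrix is a completion.\<close>
    hence z: "m i = 0" if "i < k" for i using that m0 by (simp add: sum_nonneg_eq_0_iff)
    have d0: "d = 0" unfolding d_def sm True by simp
    have dz: "A v v = 0" if "v \<in> f ` {..<k}" for v using that z unfolding m_def by auto
    have ez: "A u v = 0" if "{u, v} \<in> edges G" "u \<in> f ` {..<k}" for u v
      using clique_psd_edge(2)[OF G A that(1)] dz[OF that(2)] by simp
    have "psd_on (f ` {..<k}) (\<lambda>i j. if i = j then 0 else 0)" by (intro psd_on_diagonal) auto
    hence "is_completion G (f ` {..<k}) (\<lambda>i j. A i j + (if i = j then d else 0)) (\<lambda>i j. 0)"
      using dz ez d0 by (intro is_completionI) auto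
    thus "completable G (f ` {..<k}) (\<lambda>i j. A i j + (if i = j then d else 0))" unfolding completable_def by blast
  next
    case False
    hence smp: "0 < (\<Sum>i<k. m i)" using sm0 by simp
    have d0: "0 < d" unfolding d_def sm using cycle_eps_pos[of k] k smp by simp
    define q where "q i = sqrt (m i + d)" for i
    have qp: "0 < q i" "q i * q i = m i + d" for i unfolding q_def using m0[of i] d0 by simp_all
    define c where "c i = a i / (q i * q (Suc i mod k))" for i
    have pi: "pi \<le> (\<Sum>i<k. arccos \<bar>c i\<bar>)"
      unfolding c_def q_def using sum_arccos_ge_pi[of k m d a] k m0 smp a2 d_def sm by simp
    have c1: "\<bar>c i\<bar> \<le> 1" if "i < k" for i
    proof -
      have "(a i)\<^sup>2 \<le> (m i + d) * (m (Suc i mod k) + d)"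
      proof -
        have "m i * m (Suc i mod k) \<le> (m i + d) * (m (Suc i mod k) + d)"
          using m0 d0 by (intro mult_mono) (auto intro: add_nonneg_nonneg)
        thus ?thesis using a2[OF that] by simp
      qed
      also have "\<dots> = (q i * q (Suc i mod k))\<^sup>2" unfolding qp(2)[symmetric] by (simp add: power2_eq_square)
      finally have "\<bar>a i\<bar> \<le> \<bar>q i * q (Suc i mod k)\<bar>" by (simp only: abs_le_square_iff)
      thus ?thesis unfolding c_def using qp(1)[of i] qp(1)[of "Suc i mod k"]
        by (simp add: abs_mult divide_le_eq)
    qed
    obtain B where B: "psd_on {..<k} B" "\<forall>i<k. B i i = 1" "\<forall>i. Suc i < k \<longrightarrow> B i (Suc i) = c i" "B 0 (k - 1) = c (k - 1)"
      using unit_cycle_completion[of k c] k c1 pi by auto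
    have Bn: "B i (Suc i mod k) = c i" if "i < k" for i
    proof (cases "Suc i = k")
      case True
      hence "i = k - 1" "Suc i mod k = 0" by auto
      thus ?thesis using B(4) psd_on_sym[OF B(1), of i 0] that by simp
    next
      case False
      thus ?thesis using B(3) that by simp
    qed
    define r where "r = the_inv_into {..<k} f"
    have rf: "r (f i) = i" if "i < k" for i unfolding r_def using the_inv_into_f_f[OF inj] that by simp
    define C where "C u v = q (r u) * q (r v) * B (r u) (r v)" for u v
    have "inj_on r (f ` {..<k})" using rf by (auto intro!: inj_onI)
    moreover have "r ` f ` {..<k} = {..<k}" using rf by (auto simp: image_image)
    ultimately have pC: "psd_on (f ` {..<k}) C" unfolding C_def
      using psd_on_reindex_scale[OF B(1), of r "f ` {..<k}" "\<lambda>u. q (r u)"] by simp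
    have Cn: "C (f i) (f (Suc i mod k)) = A (f i) (f (Suc i mod k))" if "i < k" for i
      unfolding C_def rf[OF that] rf[OF md] Bn[OF that] c_def a_def using qp(1)[of i] qp(1)[of "Suc i mod k"] by simp
    have "is_completion G (f ` {..<k}) (\<lambda>i j. A i j + (if i = j then d else 0)) C"
    proof (rule is_completionI[OF pC])
      show "C u u = A u u + (if u = u then d else 0)" if "u \<in> f ` {..<k}" for u
        using that rf B(2) qp(2) unfolding C_def m_def by auto
      fix u v assume uv: "u \<in> f ` {..<k}" "v \<in> f ` {..<k}" "{u, v} \<in> edges G"
      then obtain i j where ij: "i < k" "j < k" "u = f i" "v = f j" by auto
      have ne: "u \<noteq> v" using simple_graph_edgeD[OF G uv(3)] by blast
      have "j = Suc i mod k \<or> i = Suc j mod k" using f uv(3) ij unfolding cycle_map_def by blast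
      hence "C u v = A u v"
      proof
        assume "j = Suc i mod k"
        thus ?thesis using Cn[OF ij(1)] ij by simp
      next
        assume "i = Suc j mod k"
        hence "C v u = A v u" using Cn[OF ij(2)] ij by simp
        thus ?thesis using psd_on_sym[OF pC uv(1,2)] clique_psd_edge(1)[OF G A uv(3)] by simp
      qed
      thus "C u v = A u v + (if u = v then d else 0)" using ne by simp
    qed
    thus "completable G (f ` {..<k}) (\<lambda>i j. A i j + (if i = j then d else 0))" unfolding completable_def by blast
  qed
qed

section \<open>Clique sums and cones\<close>

text \<open>A shift proportional to the trace makes the bound homogeneous, so that it applies to
  restrictions and Schur complements, whose trace is no longer normalised.\<close>

definition eps_bound :: "'a sgraph \<Rightarrow> real \<Rightarrow> bool" where
  "eps_bound G e \<longleftrightarrow> (\<forall>A. clique_psd G A \<longrightarrow>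
     completable G (verts G) (\<lambda>i j. A i j + (if i = j then e * (\<Sum>v\<in>verts G. A v v) else 0)))"

text \<open>The property carried through the generation of \<open>graph_class\<close>. The bound is
  demanded for every \<open>e\<close> that dominates the induced cycles, not just for the best one,
  so that a piece with longer cycles, or with none, can be used with the \<open>e\<close> of the
  whole graph.\<close>

definition cycle_determined :: "'a sgraph \<Rightarrow> bool" where
  "cycle_determined G \<longleftrightarrow> simple_graph G \<and>
     (\<forall>e\<ge>0. (\<forall>k\<ge>4. \<forall>f. cycle_map G k f \<longrightarrow> cycle_eps k \<le> e) \<longrightarrow> eps_bound G e)"

definition induced_embedding :: "('a \<Rightarrow> 'b) \<Rightarrow> 'a sgraph \<Rightarrow> 'b sgraph \<Rightarrow> bool" where
  "induced_embedding f G S \<longleftrightarrow> inj_on f (verts G) \<and> f ` verts G \<subseteq> verts S \<and>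
     (\<forall>u\<in>verts G. \<forall>v\<in>verts G. {f u, f v} \<in> edges S \<longleftrightarrow> {u, v} \<in> edges G)"

lemma induced_embeddingD:
  assumes "induced_embedding f G S"
  shows "inj_on f (verts G)" "f ` verts G \<subseteq> verts S"
    "u \<in> verts G \<Longrightarrow> v \<in> verts G \<Longrightarrow> {f u, f v} \<in> edges S \<longleftrightarrow> {u, v} \<in> edges G"
  using assms unfolding induced_embedding_def by simp_all

lemma eps_boundD:
  "eps_bound G e \<Longrightarrow> clique_psd G A \<Longrightarrow>
    completable G (verts G) (\<lambda>i j. A i j + (if i = j then e * (\<Sum>v\<in>verts G. A v v) else 0))"
  unfolding eps_bound_def by simp

lemma clique_psd_add_diagonal:
  assumes "simple_graph G" "clique_psd G A" "0 \<le> c"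
  shows "clique_psd G (\<lambda>i j. A i j + (if i = j then c else 0))"
  unfolding clique_psd_def
proof (intro allI impI)
  fix K assume K: "is_clique G K"
  show "psd_on K (\<lambda>i j. A i j + (if i = j then c else 0))"
    by (rule psd_on_add_diagonal[OF clique_psdD[OF assms(2) K] is_clique_finite[OF assms(1) K] assms(3)])
qed

lemma sum_diag_mono:
  assumes "simple_graph G" "clique_psd G A" "W \<subseteq> verts G"
  shows "(\<Sum>v\<in>W. A v v) \<le> (\<Sum>v\<in>verts G. A v v)"
  using assms clique_psd_diag[OF assms(2)] unfolding simple_graph_def by (intro sum_mono2) auto

lemma sum_diag_nonneg:
  assumes "clique_psd G A"
  shows "0 \<le> (\<Sum>v\<in>verts G. A v v)"
  using clique_psd_diag[OF assms] by (intro sum_nonneg) auto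

text \<open>A single shift \<open>e * ?T\<close> serves all induced cycles at once: it is at least
  \<open>cycle_eps k\<close> times the trace over any of them, the diagonal being
  nonnegative.\<close>

lemma cycle_determined_if_K4_minor_free_or_chordal:
  assumes "simple_graph G" "series_parallel G \<or> chordal G"
  shows "cycle_determined G"
  unfolding cycle_determined_def eps_bound_def
proof (intro conjI allI impI)
  show "simple_graph G" by fact
  fix e A assume e: "0 \<le> e" "\<forall>k\<ge>4. \<forall>f. cycle_map G k f \<longrightarrow> cycle_eps k \<le> e" and A: "clique_psd G A"
  let ?T = "\<Sum>v\<in>verts G. A v v"
  show "completable G (verts G) (\<lambda>i j. A i j + (if i = j then e * ?T else 0))"
  proof (rule completable_if_cycles_completable[OF assms(1)])
    show "\<not> is_minor (complete_graph {..<4::nat}) G \<or> chordal G"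
      using assms(2) unfolding series_parallel_def .
    show "clique_psd G (\<lambda>i j. A i j + (if i = j then e * ?T else 0))"
      using clique_psd_add_diagonal[OF assms(1) A] e(1) sum_diag_nonneg[OF A] by simp
    fix k f assume k: "4 \<le> k" and f: "cycle_map G k f"
    have fV: "f ` {..<k} \<subseteq> verts G" using f unfolding cycle_map_def by blast
    have "0 \<le> (\<Sum>v\<in>f ` {..<k}. A v v)" using clique_psd_diag[OF A] fV by (intro sum_nonneg) auto
    hence "cycle_eps k * (\<Sum>v\<in>f ` {..<k}. A v v) \<le> e * ?T"
      using e k f sum_diag_mono[OF assms(1) A fV] by (intro mult_mono) auto
    thus "completable G (f ` {..<k}) (\<lambda>i j. A i j + (if i = j then e * ?T else 0))"
      using completable_add_diagonal[OF _ completable_cycle[OF assms(1) A k f], of "\<lambda>_. e * ?T"] by simp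
  qed simp
qed

lemma cycle_map_embedding:
  assumes "induced_embedding f G S" "cycle_map G k h"
  shows "cycle_map S k (f \<circ> h)"
proof -
  have inj: "inj_on h {..<k}" and hV: "h ` {..<k} \<subseteq> verts G" using assms(2) unfolding cycle_map_def by simp_all
  have h: "h i \<in> verts G" if "i < k" for i using hV that by auto
  have "inj_on (f \<circ> h) {..<k}"
    by (rule comp_inj_on[OF inj inj_on_subset[OF induced_embeddingD(1)[OF assms(1)] hV]])
  moreover have "(f \<circ> h) ` {..<k} \<subseteq> verts S"
    using induced_embeddingD(2)[OF assms(1)] h by auto
  moreover have "{(f \<circ> h) i, (f \<circ> h) j} \<in> edges S \<longleftrightarrow> j = Suc i mod k \<or> i = Suc j mod k" if "i < k" "j < k" for i j
    using induced_embeddingD(3)[OF assms(1) h[OF that(1)] h[OF that(2)]] assms(2) that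
    unfolding cycle_map_def by simp
  ultimately show ?thesis unfolding cycle_map_def by simp
qed

lemma clique_embedding:
  assumes "induced_embedding f G S" "is_clique G K"
  shows "is_clique S (f ` K)"
  unfolding is_clique_def
proof (intro conjI ballI impI)
  show "f ` K \<subseteq> verts S" using assms unfolding induced_embedding_def is_clique_def by blast
  fix x y assume "x \<in> f ` K" "y \<in> f ` K" "x \<noteq> y"
  then obtain u v where uv: "u \<in> K" "v \<in> K" "x = f u" "y = f v" "u \<noteq> v" by blast
  hence "{u, v} \<in> edges G" "u \<in> verts G" "v \<in> verts G" using assms(2) unfolding is_clique_def by blast+
  thus "{x, y} \<in> edges S" using assms(1) uv unfolding induced_embedding_def by simp
qed

lemma clique_psd_embedding:
  assumes "induced_embedding f G S" "clique_psd S A"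
  shows "clique_psd G (\<lambda>u v. A (f u) (f v))"
  unfolding clique_psd_def
proof (intro allI impI)
  fix K assume K: "is_clique G K"
  have "inj_on f K" using inj_on_subset[OF induced_embeddingD(1)[OF assms(1)] is_clique_subset[OF K]] .
  thus "psd_on K (\<lambda>u v. A (f u) (f v))"
    by (rule psd_on_reindex[OF clique_psdD[OF assms(2) clique_embedding[OF assms(1) K]] _ refl])
qed

lemma completable_embedding:
  assumes f: "induced_embedding f G S" and "completable G (verts G) (\<lambda>u v. A (f u) (f v))"
  shows "completable S (f ` verts G) A"
proof -
  obtain B where B: "is_completion G (verts G) (\<lambda>u v. A (f u) (f v)) B"
    using assms(2) by (rule completableE)
  define r where "r = the_inv_into (verts G) f"
  note inj = induced_embeddingD(1)[OF f]
  have rf: "r (f u) = u" if "u \<in> verts G" for u unfolding r_def using the_inv_into_f_f[OF inj that] .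
  have "inj_on r (f ` verts G)" using rf by (auto intro!: inj_onI)
  moreover have "r ` f ` verts G = verts G" using rf by (auto simp: image_image)
  ultimately have P: "psd_on (f ` verts G) (\<lambda>x y. B (r x) (r y))"
    using psd_on_reindex[OF is_completionD(1)[OF B]] by simp
  have "is_completion S (f ` verts G) A (\<lambda>x y. B (r x) (r y))"
  proof (rule is_completionI[OF P])
    show "B (r x) (r x) = A x x" if "x \<in> f ` verts G" for x
      using that rf is_completionD(2)[OF B] by auto
    fix x y assume xy: "x \<in> f ` verts G" "y \<in> f ` verts G" "{x, y} \<in> edges S"
    then obtain u v where uv: "u \<in> verts G" "v \<in> verts G" "x = f u" "y = f v" by blast
    hence "{u, v} \<in> edges G" using induced_embeddingD(3)[OF f uv(1,2)] xy(3) by simp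
    thus "B (r x) (r y) = A x y" using is_completionD(3)[OF B uv(1,2)] uv rf by simp
  qed
  thus ?thesis by (rule completableI)
qed

text \<open>The trace over the embedded part is at most the whole trace, and a larger shift
  preserves completability.\<close>

lemma completable_eps_embedding:
  assumes "induced_embedding f G S" "simple_graph S" "clique_psd S A" "eps_bound G e" "0 \<le> e"
  shows "completable S (f ` verts G) (\<lambda>i j. A i j + (if i = j then e * (\<Sum>v\<in>verts S. A v v) else 0))"
proof -
  note inj = induced_embeddingD(1)[OF assms(1)] and sub = induced_embeddingD(2)[OF assms(1)]
  have fin: "finite (f ` verts G)" using assms(2) finite_subset[OF sub] unfolding simple_graph_def by simp
  let ?t = "\<Sum>v\<in>verts G. A (f v) (f v)"
  have "completable G (verts G) (\<lambda>i j. A (f i) (f j) + (if i = j then e * ?t else 0))"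
    by (rule eps_boundD[OF assms(4) clique_psd_embedding[OF assms(1,3)]])
  moreover have "A (f i) (f j) + (if i = j then e * ?t else 0) = A (f i) (f j) + (if f i = f j then e * ?t else 0)"
    if "i \<in> verts G" "j \<in> verts G" for i j using inj that by (auto dest: inj_onD)
  ultimately have "completable G (verts G) (\<lambda>i j. A (f i) (f j) + (if f i = f j then e * ?t else 0))"
    unfolding completable_def is_completion_def by simp
  from completable_embedding[OF assms(1), where A = "\<lambda>x y. A x y + (if x = y then e * ?t else 0)", OF this]
  have "completable S (f ` verts G) (\<lambda>i j. A i j + (if i = j then e * ?t else 0))" .
  moreover have "?t \<le> (\<Sum>v\<in>verts S. A v v)"
    using sum_diag_mono[OF assms(2,3) sub] by (simp add: sum.reindex[OF inj])
  hence "e * ?t \<le> e * (\<Sum>v\<in>verts S. A v v)" using assms(5) by (rule mult_left_mono)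
  ultimately show ?thesis using fin completable_add_diagonal[of "f ` verts G" S A "\<lambda>_. e * ?t" "\<lambda>_. e * (\<Sum>v\<in>verts S. A v v)"]
    by simp
qed

lemma cycle_determined_embedding:
  assumes "cycle_determined G" "induced_embedding f G S" "0 \<le> e"
    and "\<forall>k\<ge>4. \<forall>h. cycle_map S k h \<longrightarrow> cycle_eps k \<le> e"
  shows "eps_bound G e"
proof -
  have "\<forall>k\<ge>4. \<forall>h. cycle_map G k h \<longrightarrow> cycle_eps k \<le> e"
    using assms(4) cycle_map_embedding[OF assms(2)] by blast
  thus ?thesis using assms(1,3) unfolding cycle_determined_def by simp
qed

lemma graph_iso_embedding:
  assumes "simple_graph G" "graph_iso G H"
  obtains f where "induced_embedding f G H" "f ` verts G = verts H" "simple_graph H"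
proof -
  obtain f where f: "inj_on f (verts G)" "f ` verts G = verts H" "edges H = (`) f ` edges G"
    using assms(2) unfolding graph_iso_def bij_betw_def by blast
  have sub: "e \<subseteq> verts G \<and> card e = 2" if "e \<in> edges G" for e
    using assms(1) that unfolding simple_graph_def by blast
  have "{f u, f v} \<in> edges H \<longleftrightarrow> {u, v} \<in> edges G" if uv: "u \<in> verts G" "v \<in> verts G" for u v
  proof
    assume "{f u, f v} \<in> edges H"
    then obtain e where e: "e \<in> edges G" "f ` {u, v} = f ` e" unfolding f(3) by auto
    have "{u, v} = e" using e(2) uv sub[OF e(1)] by (subst (asm) inj_on_image_eq_iff[OF f(1)]) auto
    thus "{u, v} \<in> edges G" using e(1) by simp
  next
    assume "{u, v} \<in> edges G"
    hence "f ` {u, v} \<in> edges H" unfolding f(3) by blast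
    thus "{f u, f v} \<in> edges H" by simp
  qed
  hence "induced_embedding f G H" using f unfolding induced_embedding_def by blast
  moreover have "simple_graph H"
  proof -
    have "f ` e \<subseteq> verts H \<and> card (f ` e) = 2" if "e \<in> edges G" for e
      using sub[OF that] image_mono[of e "verts G" f] card_image[OF inj_on_subset[OF f(1)], of e]
      unfolding f(2) by simp
    moreover have "finite (verts H)" using assms(1) f(2) unfolding simple_graph_def by (metis finite_imageI)
    ultimately show ?thesis unfolding simple_graph_def f(3) by blast
  qed
  ultimately show ?thesis using that f(2) by blast
qed

lemma cycle_determined_iso:
  assumes "cycle_determined G" "graph_iso G H"
  shows "cycle_determined H"
proof -
  have "simple_graph G" using assms(1) unfolding cycle_determined_def by blast
  then obtain f where f: "induced_embedding f G H" "f ` verts G = verts H" and H: "simple_graph H"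
    using graph_iso_embedding assms(2) by blast
  show ?thesis unfolding cycle_determined_def eps_bound_def
  proof (intro conjI allI impI)
    fix e A assume e: "0 \<le> e" "\<forall>k\<ge>4. \<forall>f. cycle_map H k f \<longrightarrow> cycle_eps k \<le> e" and A: "clique_psd H A"
    show "completable H (verts H) (\<lambda>i j. A i j + (if i = j then e * (\<Sum>v\<in>verts H. A v v) else 0))"
      using completable_eps_embedding[OF f(1) H A cycle_determined_embedding[OF assms(1) f(1) e] e(1)]
      unfolding f(2) .
  qed (rule H)
qed

lemma complete_graph_hom_edge:
  assumes "graph_hom f (complete_graph K) G" "x \<in> K" "y \<in> K" "x \<noteq> y"
  shows "{f x, f y} \<in> edges G"
proof -
  have "{x, y} \<in> edges (complete_graph K)" using assms by (simp add: complete_graph_def)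
  hence "f ` {x, y} \<in> edges G" using assms(1) unfolding graph_hom_def by blast
  thus ?thesis by simp
qed

text \<open>Both summands are induced subgraphs of the sum: an edge of one summand between
  identified vertices is also present in the other, because \<open>K\<close> is complete and its
  maps are homomorphisms. The summands meet in a clique, so \<open>completable_separator\<close>
  applies.\<close>

lemma cycle_determined_clique_sum:
  fixes G :: "'a sgraph" and H :: "'b sgraph"
  assumes G: "cycle_determined G" and H: "cycle_determined H"
    and phi: "graph_hom \<phi> (complete_graph K) G" "inj_on \<phi> K"
    and psi: "graph_hom \<psi> (complete_graph K) H" "inj_on \<psi> K"
  shows "cycle_determined (clique_sum K \<phi> \<psi> G H)"
proof -
  define S where "S = clique_sum K \<phi> \<psi> G H"
  define g where "g = glue K \<phi> \<psi>"
  have SV: "verts S = Inl ` verts G \<union> g ` verts H" and SE: "edges S = (`) Inl ` edges G \<union> (`) g ` edges H"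
    unfolding S_def g_def clique_sum_def by simp_all
  have sG: "simple_graph G" and sH: "simple_graph H" using G H unfolding cycle_determined_def by blast+
  have GE: "e \<subseteq> verts G \<and> card e = 2" if "e \<in> edges G" for e using sG that unfolding simple_graph_def by blast
  have HE: "e \<subseteq> verts H \<and> card e = 2" if "e \<in> edges H" for e using sH that unfolding simple_graph_def by blast
  have phiV: "\<phi> x \<in> verts G" if "x \<in> K" for x
    using phi(1) that unfolding graph_hom_def complete_graph_def by auto
  have psiV: "\<psi> x \<in> verts H" if "x \<in> K" for x
    using psi(1) that unfolding graph_hom_def complete_graph_def by auto
  have gK: "g (\<psi> x) = Inl (\<phi> x)" if "x \<in> K" for x
    using that psi(2) unfolding g_def glue_def by simp
  have gR: "g y = Inr y" if "y \<notin> \<psi> ` K" for y using that unfolding g_def glue_def by simp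
  have g_Inl: "\<exists>x\<in>K. y = \<psi> x \<and> u = \<phi> x" if "g y = Inl u" for y u
  proof -
    have "y \<in> \<psi> ` K" using that gR by force
    thus ?thesis using that gK by auto
  qed
  have g_inj: "inj g"
  proof (rule injI)
    fix y z assume eq: "g y = g z"
    show "y = z"
    proof (cases "g y")
      case (Inl u)
      thus ?thesis using g_Inl[of y u] g_Inl[of z u] eq phi(2) by (metis inj_onD)
    next
      case (Inr u)
      hence "y \<notin> \<psi> ` K" "z \<notin> \<psi> ` K" using gK eq by auto
      thus ?thesis using eq gR by simp
    qed
  qed
  have embG: "induced_embedding Inl G S"
    unfolding induced_embedding_def
  proof (intro conjI ballI)
    fix u v :: 'a assume uv: "u \<in> verts G" "v \<in> verts G"
    show "{Inl u, Inl v} \<in> edges S \<longleftrightarrow> {u, v} \<in> edges G"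
    proof
      assume "{u, v} \<in> edges G"
      hence "Inl ` {u, v} \<in> edges S" unfolding SE by blast
      thus "{Inl u, Inl v} \<in> edges S" by simp
    next
      assume "{Inl u, Inl v} \<in> edges S"
      then consider e where "e \<in> edges G" "{Inl u, Inl v} = (Inl ` e :: ('a + 'b) set)"
        | e where "e \<in> edges H" "{Inl u, Inl v} = g ` e" unfolding SE by blast
      thus "{u, v} \<in> edges G"
      proof cases
        case (1 e)
        hence "(Inl :: 'a \<Rightarrow> 'a + 'b) ` {u, v} = Inl ` e" by simp
        hence "{u, v} = e" by (subst (asm) inj_image_eq_iff) simp_all
        thus ?thesis using 1 by simp
      next
        case (2 e)
        obtain y z where yz: "e = {y, z}" "y \<noteq> z" using simple_graph_edgeE[OF sH 2(1)] .
        hence "g y \<noteq> g z" using g_inj by (auto dest: injD)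
        hence "g y = Inl u \<and> g z = Inl v \<or> g y = Inl v \<and> g z = Inl u" using 2(2) yz by (auto simp: doubleton_eq_iff)
        then obtain p q where pq: "g y = Inl p" "g z = Inl q" "{p, q} = {u, v}" by blast
        obtain a b where ab: "a \<in> K" "y = \<psi> a" "p = \<phi> a" "b \<in> K" "z = \<psi> b" "q = \<phi> b"
          using g_Inl[OF pq(1)] g_Inl[OF pq(2)] by blast
        have "a \<noteq> b" using ab yz(2) by blast
        thus ?thesis using complete_graph_hom_edge[OF phi(1) ab(1,4)] ab pq(3) by simp
      qed
    qed
  qed (auto simp: SV)
  have embH: "induced_embedding g H S"
    unfolding induced_embedding_def
  proof (intro conjI ballI)
    fix u v :: 'b assume uv: "u \<in> verts H" "v \<in> verts H"
    show "{g u, g v} \<in> edges S \<longleftrightarrow> {u, v} \<in> edges H"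
    proof
      assume "{u, v} \<in> edges H"
      hence "g ` {u, v} \<in> edges S" unfolding SE by blast
      thus "{g u, g v} \<in> edges S" by simp
    next
      assume "{g u, g v} \<in> edges S"
      then consider e where "e \<in> edges G" "{g u, g v} = Inl ` e"
        | e where "e \<in> edges H" "{g u, g v} = g ` e" unfolding SE by blast
      thus "{u, v} \<in> edges H"
      proof cases
        case (1 e)
        obtain y z where yz: "e = {y, z}" "y \<noteq> z" using simple_graph_edgeE[OF sG 1(1)] .
        hence "g u = Inl y \<and> g v = Inl z \<or> g u = Inl z \<and> g v = Inl y" using 1(2) by (auto simp: doubleton_eq_iff)
        then obtain p q where pq: "g u = Inl p" "g v = Inl q" "p \<noteq> q" using yz(2) by blast
        obtain a b where ab: "a \<in> K" "u = \<psi> a" "p = \<phi> a" "b \<in> K" "v = \<psi> b" "q = \<phi> b"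
          using g_Inl[OF pq(1)] g_Inl[OF pq(2)] by blast
        have "a \<noteq> b" using ab pq(3) by blast
        thus ?thesis using complete_graph_hom_edge[OF psi(1) ab(1,4)] ab by simp
      next
        case (2 e)
        hence "g ` {u, v} = g ` e" by simp
        hence "{u, v} = e" by (subst (asm) inj_image_eq_iff[OF g_inj])
        thus ?thesis using 2 by simp
      qed
    qed
  qed (use g_inj in \<open>auto simp: SV intro: inj_on_subset\<close>)
  have sS: "simple_graph S"
  proof -
    have "(Inl :: 'a \<Rightarrow> 'a + 'b) ` e \<subseteq> verts S \<and> card ((Inl :: 'a \<Rightarrow> 'a + 'b) ` e) = 2" if "e \<in> edges G" for e
      using GE[OF that] SV by (auto simp: card_image)
    moreover have "g ` e \<subseteq> verts S \<and> card (g ` e) = 2" if "e \<in> edges H" for e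
      using HE[OF that] SV card_image[OF inj_on_subset[OF g_inj], of e] by auto
    moreover have "finite (verts S)" using sG sH unfolding SV simple_graph_def by simp
    ultimately show ?thesis unfolding simple_graph_def SE by blast
  qed
  have int: "Inl ` verts G \<inter> g ` verts H = Inl ` \<phi> ` K"
  proof (intro equalityI subsetI)
    fix w assume "w \<in> Inl ` verts G \<inter> g ` verts H"
    then obtain u y where "w = Inl u" "w = g y" by blast
    thus "w \<in> Inl ` \<phi> ` K" using g_Inl[of y u] by auto
  next
    fix w :: "'a + 'b" assume "w \<in> Inl ` \<phi> ` K"
    then obtain x where x: "x \<in> K" "w = Inl (\<phi> x)" by blast
    hence "w = g (\<psi> x)" using gK by simp
    thus "w \<in> Inl ` verts G \<inter> g ` verts H" using x phiV psiV by blast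
  qed
  have "is_clique G (\<phi> ` K)"
    unfolding is_clique_def using phiV complete_graph_hom_edge[OF phi(1)] by blast
  hence cl: "is_clique S (Inl ` verts G \<inter> g ` verts H)"
    unfolding int by (rule clique_embedding[OF embG])
  have nc: "no_cross_edges S (Inl ` verts G) (g ` verts H)"
    unfolding no_cross_edges_def
  proof (intro ballI notI)
    fix u v assume u: "u \<in> Inl ` verts G - g ` verts H" and v: "v \<in> g ` verts H - Inl ` verts G"
      and e: "{u, v} \<in> edges S"
    have "{u, v} \<subseteq> Inl ` verts G \<or> {u, v} \<subseteq> g ` verts H" using e GE HE unfolding SE by blast
    thus False using u v by blast
  qed
  have "cycle_determined S"
    unfolding cycle_determined_def eps_bound_def
  proof (intro conjI allI impI)
    fix e A assume e: "0 \<le> e" "\<forall>k\<ge>4. \<forall>f. cycle_map S k f \<longrightarrow> cycle_eps k \<le> e" and A: "clique_psd S A"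
    show "completable S (verts S) (\<lambda>i j. A i j + (if i = j then e * (\<Sum>v\<in>verts S. A v v) else 0))"
      using completable_separator[OF _ _
          completable_eps_embedding[OF embG sS A cycle_determined_embedding[OF G embG e] e(1)]
          completable_eps_embedding[OF embH sS A cycle_determined_embedding[OF H embH e] e(1)] cl nc]
        sG sH unfolding SV[symmetric] simple_graph_def by simp
  qed (rule sS)
  thus ?thesis unfolding S_def .
qed

text \<open>Taking Schur complements at the apex reduces the cone over \<open>G\<close> to \<open>G\<close>. If the apex has diagonal
  entry \<open>0\<close>, its row vanishes on edges and the convention \<open>x / 0 = 0\<close> makes the same formulas work.\<close>

lemma cycle_determined_cone:
  fixes G :: "'a sgraph"
  assumes G: "cycle_determined G"
  shows "cycle_determined (Defs.cone G)"
proof -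
  let ?C = "Defs.cone G"
  have CV: "verts ?C = insert None (Some ` verts G)"
    and CE: "edges ?C = (`) Some ` edges G \<union> {{None, Some v} | v. v \<in> verts G}"
    unfolding Defs.cone_def by simp_all
  have sG: "simple_graph G" using G unfolding cycle_determined_def by blast
  have fG: "finite (verts G)" using sG unfolding simple_graph_def by blast
  have GE: "e \<subseteq> verts G \<and> card e = 2" if "e \<in> edges G" for e using sG that unfolding simple_graph_def by blast
  have apex: "{None, Some v} \<in> edges ?C" if "v \<in> verts G" for v using that unfolding CE by blast
  have emb: "induced_embedding Some G ?C"
    unfolding induced_embedding_def
  proof (intro conjI ballI)
    fix u v assume "u \<in> verts G" "v \<in> verts G"
    show "{Some u, Some v} \<in> edges ?C \<longleftrightarrow> {u, v} \<in> edges G"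
    proof
      assume "{u, v} \<in> edges G"
      hence "Some ` {u, v} \<in> edges ?C" unfolding CE by blast
      thus "{Some u, Some v} \<in> edges ?C" by simp
    next
      assume "{Some u, Some v} \<in> edges ?C"
      then obtain e where e: "e \<in> edges G" "Some ` {u, v} = Some ` e" unfolding CE by auto
      hence "{u, v} = e" by (subst (asm) inj_image_eq_iff) simp_all
      thus "{u, v} \<in> edges G" using e by simp
    qed
  qed (auto simp: CV)
  have sC: "simple_graph ?C"
  proof -
    have "Some ` e \<subseteq> verts ?C \<and> card (Some ` e) = 2" if "e \<in> edges G" for e
      using GE[OF that] CV by (auto simp: card_image)
    moreover have "{None, Some v} \<subseteq> verts ?C \<and> card {None, Some v} = 2" if "v \<in> verts G" for v
      using that CV by auto
    ultimately show ?thesis unfolding simple_graph_def CE using fG CV by auto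
  qed
  show ?thesis
    unfolding cycle_determined_def eps_bound_def
  proof (intro conjI allI impI)
    fix e A assume e: "0 \<le> e" "\<forall>k\<ge>4. \<forall>f. cycle_map ?C k f \<longrightarrow> cycle_eps k \<le> e" and A: "clique_psd ?C A"
    have bG: "eps_bound G e" by (rule cycle_determined_embedding[OF G emb e])
    define a where "a = A None None"
    define c where "c v = A v None" for v
    have a0: "0 \<le> a" unfolding a_def using clique_psd_diag[OF A] CV by simp
    have sym: "A None (Some v) = c (Some v)" if "v \<in> verts G" for v
      unfolding c_def using clique_psd_edge(1)[OF sC A apex[OF that]] .
    have zero: "c (Some v) = 0" if "v \<in> verts G" "a = 0" for v
      using clique_psd_edge(2)[OF sC A apex[OF that(1)]] that sym[OF that(1)] unfolding a_def by simp
    define A' where "A' i j = A i j - c i * c j / a" for i j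
    have cl': "clique_psd G (\<lambda>u v. A' (Some u) (Some v))"
      unfolding clique_psd_def
    proof (intro allI impI)
      fix K assume K: "is_clique G K"
      have KV: "K \<subseteq> verts G" using K unfolding is_clique_def by blast
      have fK: "finite (Some ` K)" using KV fG by (simp add: finite_subset)
      have "is_clique ?C (Some ` K)" by (rule clique_embedding[OF emb K])
      hence "is_clique ?C (insert None (Some ` K))"
        unfolding is_clique_def CV using apex KV by (auto simp: insert_commute)
      hence P: "psd_on (insert None (Some ` K)) A" by (rule clique_psdD[OF A])
      have "psd_on (Some ` K) A'"
      proof (cases "a = 0")
        case True
        have "psd_on (Some ` K) A" using fK by (intro psd_on_subset[OF P]) auto
        moreover have "A' i j = A i j" for i j using True by (simp add: A'_def)
        ultimately show ?thesis using psd_on_cong[of "Some ` K" A' A] by simp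
      next
        case False
        have "psd_on (Some ` K) (\<lambda>i j. A i j - A i None * A j None / A None None)"
          using fK a0 False sym KV P unfolding a_def c_def
          by (intro psd_on_schur[THEN iffD1]) auto
        thus ?thesis unfolding A'_def a_def c_def .
      qed
      thus "psd_on K (\<lambda>u v. A' (Some u) (Some v))"
        using psd_on_reindex[where A = A' and f = Some and W = K, OF _ _ refl] by simp
    qed
    let ?d = "e * (\<Sum>v\<in>verts ?C. A v v)"
    let ?t = "\<Sum>v\<in>verts G. A' (Some v) (Some v)"
    \<comment> \<open>The Schur complement only lowers the diagonal, so the shift required for
      \<open>G\<close> does not exceed the one allowed in the cone.\<close>
    have "?t \<le> (\<Sum>v\<in>verts G. A (Some v) (Some v))"
      using a0 by (intro sum_mono) (simp add: A'_def)
    also have "\<dots> \<le> (\<Sum>v\<in>verts ?C. A v v)" using a0 fG unfolding CV a_def by (simp add: sum.reindex)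
    finally have "e * ?t \<le> ?d" using e(1) by (rule mult_left_mono)
    moreover have "completable G (verts G) (\<lambda>u v. A' (Some u) (Some v) + (if u = v then e * ?t else 0))"
      by (rule eps_boundD[OF bG cl'])
    ultimately have "completable G (verts G) (\<lambda>u v. A' (Some u) (Some v) + (if u = v then ?d else 0))"
      using completable_add_diagonal[OF fG, of G "\<lambda>u v. A' (Some u) (Some v)" "\<lambda>_. e * ?t" "\<lambda>_. ?d"] by simp
    hence "completable ?C (Some ` verts G) (\<lambda>i j. A' i j + (if i = j then ?d else 0))"
      by (intro completable_embedding[OF emb]) simp
    then obtain B where B: "is_completion ?C (Some ` verts G) (\<lambda>i j. A' i j + (if i = j then ?d else 0)) B"
      by (rule completableE)
    \<comment> \<open>\<open>D\<close> reverses the Schur complement and leaves the apex entry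
      unshifted; \<open>completable_add_diagonal\<close> supplies the shift there at the
      end.\<close>
    define D where "D i j = (if i = None then if j = None then a else c j else if j = None then c i else B i j + c i * c j / a)" for i j
    have fS: "finite (Some ` verts G)" using fG by simp
    have "psd_on (insert None (Some ` verts G)) D"
    proof (cases "a = 0")
      case True
      have "D i j = B i j" if "i \<in> Some ` verts G" "j \<in> Some ` verts G" for i j
        using that True by (auto simp: D_def)
      hence "psd_on (Some ` verts G) D" using is_completionD(1)[OF B] psd_on_cong[of "Some ` verts G" D B] by simp
      thus ?thesis using fS True zero by (intro psd_on_insert_zero) (auto simp: D_def)
    next
      case False
      have "D i j - D i None * D j None / D None None = B i j" if "i \<in> Some ` verts G" "j \<in> Some ` verts G" for i j
        using that by (auto simp: D_def)
      hence "psd_on (Some ` verts G) (\<lambda>i j. D i j - D i None * D j None / D None None)"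
        using is_completionD(1)[OF B] psd_on_cong[of "Some ` verts G" "\<lambda>i j. D i j - D i None * D j None / D None None" B] by simp
      thus ?thesis using fS False a0 by (intro psd_on_schur[THEN iffD2]) (auto simp: D_def)
    qed
    hence P: "psd_on (verts ?C) D" unfolding CV .
    have "is_completion ?C (verts ?C) (\<lambda>i j. A i j + (if i = j then if i = None then 0 else ?d else 0)) D"
    proof (rule is_completionI[OF P])
      show "D i i = A i i + (if i = i then if i = None then 0 else ?d else 0)" if "i \<in> verts ?C" for i
        using that is_completionD(2)[OF B, of i] unfolding D_def CV A'_def a_def by auto
      fix i j assume ij: "i \<in> verts ?C" "j \<in> verts ?C" "{i, j} \<in> edges ?C"
      have ne: "i \<noteq> j" using simple_graph_edgeD[OF sC ij(3)] by blast
      show "D i j = A i j + (if i = j then if i = None then 0 else ?d else 0)"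
      proof (cases "i = None \<or> j = None")
        case True
        thus ?thesis using ne ij(1,2) sym unfolding D_def CV c_def by auto
      next
        case False
        hence "i \<in> Some ` verts G" "j \<in> Some ` verts G" using ij(1,2) CV by auto
        from is_completionD(3)[OF B this ij(3)] show ?thesis using ne False unfolding D_def A'_def by auto
      qed
    qed
    hence "completable ?C (verts ?C) (\<lambda>i j. A i j + (if i = j then if i = None then 0 else ?d else 0))"
      by (rule completableI)
    moreover have "0 \<le> ?d" using e(1) sum_diag_nonneg[OF A] by simp
    moreover have "finite (verts ?C)" using fG CV by simp
    ultimately show "completable ?C (verts ?C) (\<lambda>i j. A i j + (if i = j then ?d else 0))"
      using completable_add_diagonal[of "verts ?C" ?C A "\<lambda>i. if i = None then 0 else ?d" "\<lambda>_. ?d"] by simp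
  qed (rule sC)
qed

theorem graph_class_cycle_determined: "G \<in> graph_class \<Longrightarrow> cycle_determined G"
proof (induction rule: graph_class.induct)
  case (series_parallel G)
  thus ?case by (intro cycle_determined_if_K4_minor_free_or_chordal) (auto simp: graph_def)
next
  case (chordal G)
  thus ?case by (intro cycle_determined_if_K4_minor_free_or_chordal) (auto simp: graph_def)
next
  case (clique_sum G H K \<phi> \<psi> S)
  thus ?case by (blast intro: cycle_determined_iso cycle_determined_clique_sum)
next
  case (cone G S)
  thus ?case by (blast intro: cycle_determined_iso cycle_determined_cone)
qed

section \<open>The conical distance\<close>

text \<open>Triangle inequality on the sphere: the angle between the vectors \<open>0\<close> and
  \<open>Suc j\<close> is at most the angle between \<open>0\<close> and \<open>j\<close> plus
  \<open>\<theta>\<close>. The bound by \<pi> keeps all angles in the range where the cosine is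
  monotone.\<close>

lemma cos_mult_le_of_unit_chain:
  fixes B :: "nat \<Rightarrow> nat \<Rightarrow> real"
  assumes "psd_on {..<n} B" "\<And>i. i < n \<Longrightarrow> B i i = 1" "\<And>i. Suc i < n \<Longrightarrow> B i (Suc i) = cos \<theta>"
    and "0 \<le> \<theta>" "j < n" "real j * \<theta> \<le> pi"
  shows "cos (real j * \<theta>) \<le> B 0 j"
  using assms(5,6)
proof (induction j)
  case 0
  thus ?case using assms(2)[of 0] by simp
next
  case (Suc j)
  show ?case
  proof (cases "j = 0")
    case True
    thus ?thesis using assms(3)[of 0] Suc.prems by simp
  next
    case False
    have jt: "real j * \<theta> + \<theta> \<le> pi" using Suc.prems by (simp add: algebra_simps)
    hence IH: "cos (real j * \<theta>) \<le> B 0 j" using Suc assms(4) by simp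
    have sub: "{j, 0, Suc j} \<subseteq> {..<n}" using Suc.prems by auto
    have P: "psd_on {j, 0, Suc j} B" by (rule psd_on_subset[OF assms(1) _ sub]) simp
    have s: "B j 0 = B 0 j" "B (Suc j) j = B j (Suc j)" "B (Suc j) 0 = B 0 (Suc j)"
      using psd_on_sym[OF P] by auto
    \<comment> \<open>In \<open>psd_on_triple\<close> the index \<open>j\<close> takes the first
      place, so that the Schur complement is formed at the middle vector.\<close>
    have t: "\<bar>B 0 j\<bar> \<le> 1" "(B 0 (Suc j) - B 0 j * cos \<theta>)\<^sup>2 \<le> (1 - (B 0 j)\<^sup>2) * (1 - (cos \<theta>)\<^sup>2)"
      using psd_on_triple[of j 0 "Suc j" B] P s assms(2,3) False Suc.prems by simp_all
    define \<phi> where "\<phi> = arccos (B 0 j)"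
    have phi: "0 \<le> \<phi>" "cos \<phi> = B 0 j" unfolding \<phi>_def
      using t(1) by (auto intro!: arccos_lbound simp: cos_arccos_abs)
    have "\<phi> \<le> real j * \<theta>"
    proof -
      have "\<phi> \<le> arccos (cos (real j * \<theta>))" unfolding \<phi>_def using IH t(1) by (intro arccos_le_arccos) auto
      also have "\<dots> = real j * \<theta>" using assms(4) jt by (intro arccos_cos) auto
      finally show ?thesis .
    qed
    hence "cos (real j * \<theta> + \<theta>) \<le> cos (\<phi> + \<theta>)"
      using phi(1) assms(4) jt by (intro cos_monotone_0_pi_le) auto
    also have "\<dots> = B 0 j * cos \<theta> - sin \<phi> * sin \<theta>" unfolding cos_add phi(2) ..
    also have "\<dots> \<le> B 0 (Suc j)"
    proof -
      have "(B 0 (Suc j) - B 0 j * cos \<theta>)\<^sup>2 \<le> (sin \<phi> * sin \<theta>)\<^sup>2"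
        using t(2) unfolding phi(2)[symmetric] by (simp add: power_mult_distrib sin_squared_eq)
      hence "\<bar>B 0 (Suc j) - B 0 j * cos \<theta>\<bar> \<le> \<bar>sin \<phi> * sin \<theta>\<bar>" by (simp only: abs_le_square_iff)
      moreover have "0 \<le> sin \<phi> * sin \<theta>"
        using phi(1) assms(4) jt \<open>\<phi> \<le> real j * \<theta>\<close> by (intro mult_nonneg_nonneg sin_ge_zero) (auto simp: add_increasing add_increasing2)
      ultimately show ?thesis by linarith
    qed
    finally show ?thesis by (simp add: algebra_simps)
  qed
qed

text \<open>With \<open>\<theta> = arccos x\<close> and \<open>n * \<theta> < pi\<close>, the
  \<open>n - 1\<close> path edges would leave an angle of at most \<open>(n - 1) * \<theta>\<close>
  between the end vectors, less than the angle \<open>pi - \<theta>\<close> that the negated closing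
  entry demands.\<close>

lemma frustrated_unit_cycle_bound:
  fixes B :: "nat \<Rightarrow> nat \<Rightarrow> real"
  assumes "2 \<le> n" "psd_on {..<n} B" "\<And>i. i < n \<Longrightarrow> B i i = 1" "\<And>i. Suc i < n \<Longrightarrow> B i (Suc i) = x"
    and "B 0 (n - 1) = - x" "0 \<le> x" "x \<le> 1"
  shows "x \<le> cos (pi / real n)"
proof -
  define \<theta> where "\<theta> = arccos x"
  have th: "0 \<le> \<theta>" "\<theta> \<le> pi" "cos \<theta> = x"
    unfolding \<theta>_def using assms(6,7) by (auto intro!: arccos_lbound arccos_ubound)
  have "pi \<le> real n * \<theta>"
  proof (rule ccontr)
    assume "\<not> pi \<le> real n * \<theta>"
    moreover have "real (n - 1) * \<theta> = real n * \<theta> - \<theta>" using assms(1) by (simp add: of_nat_diff algebra_simps)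
    ultimately have l: "real (n - 1) * \<theta> < pi - \<theta>" by simp
    have "cos (real (n - 1) * \<theta>) \<le> B 0 (n - 1)"
      using assms(1,4) th l by (intro cos_mult_le_of_unit_chain[OF assms(2,3)]) auto
    also have "\<dots> = cos (pi - \<theta>)" using assms(5) th(3) by simp
    also have "\<dots> < cos (real (n - 1) * \<theta>)" using l th by (intro cos_monotone_0_pi) auto
    finally show False by simp
  qed
  hence "pi / real n \<le> \<theta>" using assms(1) by (simp add: field_simps)
  hence "cos \<theta> \<le> cos (pi / real n)" using th assms(1) by (intro cos_monotone_0_pi_le) auto
  thus ?thesis using th(3) by simp
qed

section \<open>Feasible shifts and the extremal matrix\<close>

definition feasible :: "'a sgraph \<Rightarrow> real \<Rightarrow> bool" where
  "feasible G e \<longleftrightarrow> (\<forall>M\<in>P_bar G. add_scaled G M e (id_partial G) \<in> Sigma_cone G)"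

lemma entry_add_scaled_id:
  assumes "simple_graph G" "i \<in> verts G" "i = j \<or> {i, j} \<in> edges G"
  shows "entry (add_scaled G M e (id_partial G)) i j = entry M i j + (if i = j then e else 0)"
  using assms simple_graph_edgeD[OF assms(1)]
  unfolding entry_def add_scaled_def id_partial_def by auto

lemma add_scaled_Sym: "add_scaled G M e N \<in> Sym G"
  unfolding add_scaled_def Sym_def by simp

lemma Sigma_cone_iff:
  "A \<in> Sigma_cone G \<longleftrightarrow> A \<in> Sym G \<and> completable G (verts G) (entry A)"
  unfolding Sigma_cone_def completable_def is_completion_def by simp

text \<open>A clique of a finite graph lies in a maximal one, and positive semidefiniteness passes
  to principal submatrices.\<close>

lemma P_cone_clique_psd:
  assumes "simple_graph G" "M \<in> P_cone G"
  shows "clique_psd G (entry M)"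
  unfolding clique_psd_def
proof (intro allI impI)
  fix K assume K: "is_clique G K"
  have "finite {K. is_clique G K}"
    by (rule finite_subset[of _ "Pow (verts G)"]) (use assms(1) in \<open>auto simp: is_clique_def simple_graph_def\<close>)
  moreover have "K \<in> {K. is_clique G K}" using K by simp
  ultimately have "\<exists>L\<in>{K. is_clique G K}. K \<subseteq> L \<and> (\<forall>L'\<in>{K. is_clique G K}. L \<subseteq> L' \<longrightarrow> L = L')"
    by (rule finite_has_maximal2)
  then obtain L where L: "is_clique G L" "K \<subseteq> L" "\<forall>L'\<in>{K. is_clique G K}. L \<subseteq> L' \<longrightarrow> L = L'"
    by (elim bexE conjE) simp
  hence "is_maximal_clique G L" unfolding is_maximal_clique_def by auto
  hence "psd_on L (entry M)" using assms(2) unfolding P_cone_def by simp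
  thus "psd_on K (entry M)" by (rule psd_on_subset[OF _ is_clique_finite[OF assms(1) L(1)] L(2)])
qed

lemma feasible_if_eps_bound:
  assumes "simple_graph G" "eps_bound G e"
  shows "feasible G e"
  unfolding feasible_def
proof
  fix M assume M: "M \<in> P_bar G"
  have t: "(\<Sum>v\<in>verts G. entry M v v) = 1" using M unfolding P_bar_def tr_def by simp
  have "clique_psd G (entry M)" using M P_cone_clique_psd[OF assms(1)] unfolding P_bar_def by simp
  from eps_boundD[OF assms(2) this]
  have "completable G (verts G) (\<lambda>i j. entry M i j + (if i = j then e else 0))"
    unfolding t mult_1_right .
  then obtain B where B: "is_completion G (verts G) (\<lambda>i j. entry M i j + (if i = j then e else 0)) B"
    by (rule completableE)
  have "is_completion G (verts G) (entry (add_scaled G M e (id_partial G))) B"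
    by (rule is_completionI[OF is_completionD(1)[OF B]])
      (use is_completionD(2,3)[OF B] entry_add_scaled_id[OF assms(1)] in simp_all)
  thus "add_scaled G M e (id_partial G) \<in> Sigma_cone G"
    unfolding Sigma_cone_iff using add_scaled_Sym completableI by blast
qed

text \<open>The extremal matrix is constant on the induced cycle, except for the sign of one edge.\<close>

lemma cycle_eps_le_if_feasible:
  assumes G: "simple_graph G" and k: "4 \<le> k" and f: "cycle_map G k f" and e: "0 \<le> e" "feasible G e"
  shows "cycle_eps k \<le> e"
proof -
  have inj: "inj_on f {..<k}" and fV: "f ` {..<k} \<subseteq> verts G" using f unfolding cycle_map_def by simp_all
  have fG: "finite (verts G)" using G unfolding simple_graph_def by simp
  have k0: "0 < real k" using k by simp
  define r where "r = 1 / real k"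
  have r: "0 < r" unfolding r_def using k0 by simp
  define C where "C = f ` {..<k}"
  define last where "last = {f 0, f (k - 1)}"
  define M where "M = (\<lambda>p\<in>verts G <+> edges G. case p of Inl i \<Rightarrow> if i \<in> C then r else 0
    | Inr d \<Rightarrow> if d = last then - r else if d \<subseteq> C then r else 0)"
  have lC: "last \<subseteq> C" unfolding last_def C_def using k by auto
  have Md: "entry M i i = (if i \<in> C then r else 0)" if "i \<in> verts G" for i
    using that unfolding entry_def M_def by auto
  have Me: "entry M i j = (if {i, j} = last then - r else if {i, j} \<subseteq> C then r else 0)" if "{i, j} \<in> edges G" for i j
    using that simple_graph_edgeD[OF G that] unfolding entry_def M_def by auto
  have MSym: "M \<in> Sym G" unfolding M_def Sym_def by simp
  \<comment> \<open>A clique meets an induced cycle of length at least \<open>4\<close> in at most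
    two vertices. Only blocks of size up to two with entries \<open>r\<close> or \<open>- r\<close>
    occur, where the sign of the edge entry is harmless.\<close>
  have pairs: "psd_on (K \<inter> C) (entry M)" if K: "is_clique G K" for K
  proof -
    define J where "J = {i. i < k \<and> f i \<in> K}"
    have J: "K \<inter> C = f ` J" unfolding J_def C_def by auto
    have KV: "K \<subseteq> verts G" by (rule is_clique_subset[OF K])
    have adj: "j = Suc i \<or> i = 0 \<and> Suc j = k" if "i < j" "i \<in> J" "j \<in> J" for i j
    proof -
      have "f i \<noteq> f j" using inj that unfolding J_def by (auto dest: inj_onD)
      hence "{f i, f j} \<in> edges G" using K that unfolding is_clique_def J_def by blast
      thus ?thesis using cycle_map_edge_iff[OF f that(1)] that(3) unfolding J_def by simp
    qed
    have "\<not> (\<exists>i j l. i < j \<and> j < l \<and> i \<in> J \<and> j \<in> J \<and> l \<in> J)"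
    proof
      assume "\<exists>i j l. i < j \<and> j < l \<and> i \<in> J \<and> j \<in> J \<and> l \<in> J"
      then obtain i j l where ijl: "i < j" "j < l" "i \<in> J" "j \<in> J" "l \<in> J" by blast
      have "l < k" using ijl(5) unfolding J_def by simp
      thus False using adj[of i j] adj[of j l] adj[of i l] ijl k by auto
    qed
    thus ?thesis
    proof (cases rule: three_indices)
      case 1
      thus ?thesis unfolding J by (simp add: psd_on_empty)
    next
      case (2 i)
      hence "f i \<in> verts G" using KV unfolding J_def by blast
      thus ?thesis unfolding J 2 using Md[of "f i"] r by (auto intro!: psd_on_single)
    next
      case (3 i j)
      hence ij: "i \<in> J" "j \<in> J" by auto
      have V: "f i \<in> verts G" "f j \<in> verts G" "f i \<in> C" "f j \<in> C" "f i \<noteq> f j" "f i \<in> K" "f j \<in> K"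
        using ij KV inj 3(1) unfolding J_def C_def by (auto dest: inj_onD)
      have E: "{f i, f j} \<in> edges G" "{f j, f i} \<in> edges G" using K V unfolding is_clique_def by (auto simp: insert_commute)
      have "psd_on {f i, f j} (entry M)"
        using V r Md[OF V(1)] Md[OF V(2)] Me[OF E(1)] Me[OF E(2)]
        by (intro psd_on_pairI) (auto simp: power2_eq_square insert_commute)
      thus ?thesis unfolding J 3(2) by simp
    qed
  qed
  have "M \<in> P_cone G"
    unfolding P_cone_def
  proof (intro CollectI conjI allI impI)
    show "M \<in> Sym G" by fact
    fix K assume "is_maximal_clique G K"
    hence K: "is_clique G K" unfolding is_maximal_clique_def by simp
    show "psd_on K (entry M)"
    proof (rule psd_on_extend_zero[OF is_clique_finite[OF G K] _ pairs[OF K]])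
      fix i j assume ij: "i \<in> K" "j \<in> K" "i \<notin> K \<inter> C \<or> j \<notin> K \<inter> C"
      show "entry M i j = 0"
      proof (cases "i = j")
        case True
        thus ?thesis using Md[of i] ij is_clique_subset[OF K] by auto
      next
        case False
        hence "{i, j} \<in> edges G" using K ij unfolding is_clique_def by blast
        moreover have "{i, j} \<noteq> last" "\<not> {i, j} \<subseteq> C" using ij lC by auto
        ultimately show ?thesis using Me[of i j] by (simp only: if_False)
      qed
    qed simp
  qed
  moreover have "tr G M = 1"
  proof -
    have "tr G M = (\<Sum>i\<in>verts G. if i \<in> C then r else 0)" unfolding tr_def using Md by (intro sum.cong) auto
    also have "\<dots> = (\<Sum>i\<in>C. r)" using fV fG unfolding C_def by (intro sum.mono_neutral_cong_right) auto
    also have "\<dots> = 1" unfolding C_def r_def using card_image[OF inj] k0 by simp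
    finally show ?thesis .
  qed
  ultimately have "add_scaled G M e (id_partial G) \<in> Sigma_cone G"
    using e(2) unfolding feasible_def P_bar_def by simp
  hence "completable G (verts G) (entry (add_scaled G M e (id_partial G)))" unfolding Sigma_cone_iff ..
  then obtain B where B: "is_completion G (verts G) (entry (add_scaled G M e (id_partial G))) B"
    by (rule completableE)
  have V: "f i \<in> verts G" "f i \<in> C" if "i < k" for i using that fV unfolding C_def by auto
  have Bd: "B (f i) (f i) = r + e" if "i < k" for i
    using is_completionD(2)[OF B V(1)[OF that]] entry_add_scaled_id[OF G V(1)[OF that], of "f i" M e] Md V that by simp
  have Be: "B (f i) (f j) = entry M (f i) (f j)" if "i < k" "j < k" "{f i, f j} \<in> edges G" for i j
    using is_completionD(3)[OF B V(1)[OF that(1)] V(1)[OF that(2)] that(3)]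
      entry_add_scaled_id[OF G V(1)[OF that(1)], of "f j" M e] simple_graph_edgeD(1)[OF G that(3)] that(3) by simp
  have Bs: "B (f i) (f (Suc i)) = r" if "Suc i < k" for i
  proof -
    have edge: "{f i, f (Suc i)} \<in> edges G" by (rule cycle_map_Suc[OF f that])
    have "{f i, f (Suc i)} \<noteq> last"
    proof
      assume "{f i, f (Suc i)} = last"
      hence "f ` {i, Suc i} = f ` {0, k - 1}" unfolding last_def by simp
      hence "{i, Suc i} = {0, k - 1}" using that by (subst (asm) inj_on_image_eq_iff[OF inj]) auto
      thus False using k by (auto simp: doubleton_eq_iff)
    qed
    thus ?thesis using Be[OF _ that edge] Me[OF edge] V that by simp
  qed
  have Bl: "B (f 0) (f (k - 1)) = - r"
  proof -
    have edge: "{f 0, f (k - 1)} \<in> edges G" using cycle_map_last[OF f] k by simp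
    thus ?thesis using Be[OF _ _ edge] Me[OF edge] k unfolding last_def by simp
  qed
  define q where "q = r + e"
  have q: "0 < q" unfolding q_def using r e(1) by simp
  have "psd_on C B" using is_completionD(1)[OF B] psd_on_subset[OF _ fG] fV unfolding C_def by blast
  hence "psd_on {..<k} (\<lambda>i j. (1 / sqrt q) * (1 / sqrt q) * B (f i) (f j))"
    using psd_on_reindex_scale[of C B f "{..<k}" "\<lambda>_. 1 / sqrt q"] inj unfolding C_def by simp
  moreover have "(1 / sqrt q) * (1 / sqrt q) = 1 / q" using q by simp
  ultimately have P: "psd_on {..<k} (\<lambda>i j. B (f i) (f j) / q)" by simp
  have "r / q \<le> cos (pi / real k)"
  proof (rule frustrated_unit_cycle_bound[OF _ P])
    show "r / q \<le> 1" "0 \<le> r / q" using r e(1) q unfolding q_def by simp_all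
  qed (use k Bd Bs Bl q q_def in simp_all)
  moreover have c: "0 < cos (pi / real k)" using cos_pi_div(1) k by simp
  ultimately have "r / cos (pi / real k) \<le> q" using q by (simp add: field_simps)
  thus ?thesis unfolding cycle_eps_def q_def r_def by (simp add: algebra_simps)
qed

text \<open>The empty infimum in \<open>enat\<close> is infinite, and a nonempty one is attained as
  a least element.\<close>

lemma chordal_girth_enatD:
  assumes "chordal_girth G = enat g"
  shows "4 \<le> g" "has_induced_cycle G g" "\<And>k. 4 \<le> k \<Longrightarrow> has_induced_cycle G k \<Longrightarrow> g \<le> k"
proof -
  define I where "I = enat ` {k. 4 \<le> k \<and> has_induced_cycle G k}"
  have Inf: "Inf I = enat g" using assms unfolding chordal_girth_def I_def by simp
  have "I \<noteq> {}" using Inf by (auto simp: Inf_enat_def)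
  then obtain y where "y \<in> I" by blast
  hence "(LEAST x. x \<in> I) \<in> I" by (rule LeastI)
  hence "Inf I \<in> I" using \<open>I \<noteq> {}\<close> unfolding Inf_enat_def by simp
  thus "4 \<le> g" "has_induced_cycle G g" unfolding Inf unfolding I_def by auto
  show "g \<le> k" if "4 \<le> k" "has_induced_cycle G k" for k
  proof -
    have "Inf I \<le> enat k" by (rule Inf_lower) (use that in \<open>simp add: I_def\<close>)
    thus ?thesis unfolding Inf by simp
  qed
qed

lemma chordal_girth_infinityD:
  assumes "chordal_girth G = \<infinity>" "4 \<le> k"
  shows "\<not> has_induced_cycle G k"
proof
  assume "has_induced_cycle G k"
  hence "chordal_girth G \<le> enat k" unfolding chordal_girth_def using assms(2) by (intro INF_lower) simp
  thus False using assms(1) by simp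
qed

theorem theorem2:
  fixes G :: "nat sgraph"
  assumes "G \<in> graph_class"
  shows "conical_distance G =
    (case chordal_girth G of
       enat g \<Rightarrow> 1 / real g * (1 / cos (pi / real g) - 1)
     | \<infinity> \<Rightarrow> 0)"
proof -
  have cd: "cycle_determined G" by (rule graph_class_cycle_determined[OF assms])
  hence G: "simple_graph G" unfolding cycle_determined_def by simp
  \<comment> \<open>The condition on cycles makes \<open>e\<close> feasible through
    \<open>cycle_determined\<close>; the last premise is minimality.\<close>
  have dist: "conical_distance G = e" if "0 \<le> e" "\<And>k f. 4 \<le> k \<Longrightarrow> cycle_map G k f \<Longrightarrow> cycle_eps k \<le> e"
    "\<And>e'. 0 \<le> e' \<Longrightarrow> feasible G e' \<Longrightarrow> e \<le> e'" for e
  proof -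
    have "eps_bound G e" using cd that(1,2) unfolding cycle_determined_def by blast
    hence "feasible G e" by (rule feasible_if_eps_bound[OF G])
    thus ?thesis unfolding conical_distance_def feasible_def[symmetric]
      using that(1,3) by (intro Least_equality) auto
  qed
  show ?thesis
  proof (cases "chordal_girth G")
    case (enat g)
    note g = chordal_girth_enatD[OF enat]
    obtain h where h: "cycle_map G g h" using g(1,2) has_induced_cycle_iff[OF G, of g] by auto
    have "conical_distance G = cycle_eps g"
    proof (rule dist)
      show "0 \<le> cycle_eps g" using cycle_eps_pos[of g] g(1) by simp
      show "cycle_eps k \<le> cycle_eps g" if "4 \<le> k" "cycle_map G k f" for k f
      proof -
        have "has_induced_cycle G k" using that has_induced_cycle_iff[OF G, of k] by auto
        thus ?thesis using cycle_eps_antimono[of g k] g(1) g(3)[OF that(1)] by simp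
      qed
      show "cycle_eps g \<le> e" if "0 \<le> e" "feasible G e" for e
        by (rule cycle_eps_le_if_feasible[OF G g(1) h that])
    qed
    thus ?thesis unfolding enat cycle_eps_def by simp
  next
    case infinity
    \<comment> \<open>Without induced cycles of length at least \<open>4\<close> the condition on
      \<open>cycle_eps\<close> is vacuous, and minimality of \<open>0\<close> is the sign
      condition.\<close>
    have "conical_distance G = 0"
    proof (rule dist)
      show "cycle_eps k \<le> 0" if "4 \<le> k" "cycle_map G k f" for k f
        using chordal_girth_infinityD[OF infinity that(1)] that has_induced_cycle_iff[OF G, of k] by auto
    qed simp_all
    thus ?thesis unfolding infinity by simp
  qed
qed

end
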